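(* For all integers $n \geq 0$, \[ \overline{p}(3n) \equiv (-1)^n r_5(n) \pmod{3} \qquad\text{and}\qquad pod(3n+2) \equiv (-1)^{n} r_5(8n+5) \pmod{3}. \] Moreover, for every odd prime $\ell$ and every integer $n \geq 0$, \[ \overline{p}(3\ell^2n) \equiv \left(\ell - \ell\left(\frac{n}{\ell}\right) + 1\right)\overline{p}(3n) - \ell\, \overline{p}(3n/\ell^2) \pmod{3}, \] where $\overline{p}(3n/\ell^2)$ is interpreted as $0$ unless $\ell^2 \mid 3n$; and for every integer $n\ge0$, \[ (-1)^{n+1}pod(3n+2) \equiv \overline{p}(24n+15) \pmod{3}. \]
   Context: For $|q|<1$ let $(a;q)_\infty=\prod_{k\ge0}(1-aq^k)$. An overpartition of $n$ is a partition of $n$ in which the first occurrence of each part may be overlined; $\overline{p}(n)$ is the number of overpartitions of $n$, with generating function $\sum_{n\ge0}\overline{p}(n)q^n=\frac{(-q;q)_\infty}{(q;q)_\infty}$. $pod(n)$ is the number of partitions of $n$ in which no odd part is repeated, with generating function $\sum_{n\ge0}pod(n)q^n=\frac{(-q;q^2)_\infty}{(q^2;q^2)_\infty}$. $r_5(n)$ is the number of $(x_1,\dots,x_5)\in\mathbb{Z}^5$ with $x_1^2+\cdots+x_5^2=n$. $\left(\frac{\cdot}{\ell}\right)$ denotes the Legendre symbol modulo $\ell$. *)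

theory Defs
  imports "HOL-Library.Multiset" "HOL-Number_Theory.Number_Theory"
begin

definition partitions :: "nat \<Rightarrow> nat multiset set" where
  "partitions n = {P. 0 \<notin># P \<and> sum_mset P = n}"

text \<open>
  Only the first occurrence of each part size may be overlined, so an overpartition is a
  partition \<open>P\<close> together with the set \<open>S\<close> of those part sizes whose first occurrence is overlined.
\<close>

definition overpartitions :: "nat \<Rightarrow> (nat multiset \<times> nat set) set" where
  "overpartitions n = {(P, S). P \<in> partitions n \<and> S \<subseteq> set_mset P}"

definition num_overpartitions :: "nat \<Rightarrow> nat" where
  "num_overpartitions n = card (overpartitions n)"

definition pod :: "nat \<Rightarrow> nat" where
  "pod n = card {P \<in> partitions n. \<forall>k. odd k \<longrightarrow> count P k \<le> 1}"

definition r5 :: "nat \<Rightarrow> nat" where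
  "r5 n = card {(x1 :: int, x2 :: int, x3 :: int, x4 :: int, x5 :: int).
     x1\<^sup>2 + x2\<^sup>2 + x3\<^sup>2 + x4\<^sup>2 + x5\<^sup>2 = int n}"

end

theory Submission
  imports Defs "HOL-Computational_Algebra.Formal_Power_Series"
begin

text \<open>
  By Gauss, the generating functions of overpartitions and of \<open>pod\<close> are, up to \<open>q \<mapsto> - q\<close>, the inverses
  of \<open>\<phi> = \<Sum>x. q^(x^2)\<close> and of the triangular series \<open>\<psi>\<close>. Modulo 3 a cube \<open>T\<^sup>3\<close> is \<open>T(q\<^sup>3)\<close>, so
  \<open>1 / T \<equiv> T\<^sup>2 / T(q\<^sup>3)\<close>, and the required residue class of exponents of \<open>T\<^sup>2\<close> carries \<open>T(q\<^sup>3)\<^sup>2\<close>. This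
  gives \<open>\<phi>\<^sup>5 \<equiv> \<phi>\<^sup>2 \<phi>(q\<^sup>3)\<close> and \<open>\<psi>\<^sup>5 \<equiv> \<psi>\<^sup>2 \<psi>(q\<^sup>3)\<close>; thus everything is controlled modulo 3 by the number of
  representations by \<open>x\<^sup>2 + y\<^sup>2 + 3 z\<^sup>2\<close>. That number satisfies an exact Hecke relation at every prime
  \<open>l > 3\<close>, since the form is the norm form on the trace-zero part of an order in the quaternion algebra
  \<open>(-1, -3)\<close> inside a norm-Euclidean maximal order: one counts the pairs of an element \<open>a\<close> of norm
  \<open>l\<close> and a trace-zero element \<open>p\<close> through \<open>a p a\<^sup>*\<close>, the elements \<open>a\<close> up to units being the \<open>l + 1\<close>
  lines in the plane over the field with \<open>l\<close> elements.
\<close>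

unbundle fps_syntax

section \<open>Truncated power series\<close>

text \<open>On trace-zero elements of the suborder the norm is \<open>b^2 + 3 c^2 + 3 d^2\<close>,
  and its values at multiples of 3 give the ternary form; hence the counts at norm
  \<open>3 n\<close>. Division with remainder takes place in the maximal order, while the form lives
  on a suborder of index 4; the passage between them uses units and the oddness of \<open>l\<close>.
  The primes 2 and 3 stay outside the quaternion argument: 2 divides this index, and 3 ramifies in
  the algebra. The prime 3 is settled by a descent from \<open>9 n\<close> to \<open>n\<close>. The
  Hecke relation at norm \<open>3 n\<close> produces the symbol of \<open>- 3 n\<close>; the symbol
  of \<open>- 3\<close> at \<open>l\<close> is that of \<open>l\<close> at 3, hence congruent to
  \<open>l\<close> modulo 3, and this is the origin of the coefficient \<open>l (n / l)\<close>. For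
  \<open>pod\<close> the link is the argument \<open>8 n + 5\<close>: half of its representations by
  the ternary form have all entries odd, and these are the triangular representations of
  \<open>n\<close>. The resulting factor 2 matches the one that the doubled indexing of triangular
  numbers puts into the inverse of \<open>pod\<close>.\<close>

definition agree :: "nat \<Rightarrow> 'a :: zero fps \<Rightarrow> 'a fps \<Rightarrow> bool" where
  "agree n F G \<longleftrightarrow> (\<forall>i\<le>n. F $ i = G $ i)"

lemma agree_mult:
  fixes F G :: "'a :: semiring_0 fps"
  assumes "agree n F F'" "agree n G G'"
  shows "agree n (F * G) (F' * G')"
  using assms by (auto simp: agree_def fps_mult_nth intro!: sum.cong)

lemma agree_cancel_left:
  fixes F G H :: "'a :: ring_1 fps"
  assumes "F $ 0 = 1" "agree n (F * G) (F * H)"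
  shows "agree n G H"
proof -
  have "G $ i = H $ i" if "i \<le> n" for i
    using that
  proof (induction i rule: less_induct)
    case (less i)
    have split: "(F * K) $ i = K $ i + (\<Sum>j=1..i. F $ j * K $ (i - j))" for K
      using assms(1) by (simp add: fps_mult_nth sum.atLeast_Suc_atMost)
    have "(F * G) $ i = (F * H) $ i" using assms(2) less.prems by (simp add: agree_def)
    moreover have "(\<Sum>j=1..i. F $ j * G $ (i - j)) = (\<Sum>j=1..i. F $ j * H $ (i - j))"
      using less by (intro sum.cong) auto
    ultimately show ?case by (simp add: split)
  qed
  then show ?thesis by (simp add: agree_def)
qed

lemma agree_add_X_power: "n < m \<Longrightarrow> agree n (F + fps_X ^ m * G) (F :: 'a :: comm_ring_1 fps)"
  by (simp add: agree_def fps_X_power_mult_nth)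

text \<open>\<open>F n\<close> is a finite product \<open>B n / R n\<close>, and \<open>T n\<close>
  is a partial theta sum. If \<open>B n * T n\<close> equals \<open>R n\<close> up to order
  \<open>n\<close>, then so does \<open>R n * (F n * T n)\<close>, and \<open>R n\<close> cancels
  because its constant term is 1. Every coefficient is settled at a finite stage, so no infinite
  product has to be formed.\<close>

lemma gauss_truncation:
  fixes P \<Phi> :: "int fps"
  assumes "\<And>n. agree n (F n) P" "\<And>n. agree n (T n) \<Phi>"
    and "\<And>n. F n * R n = B n" "\<And>n. fps_X ^ Suc n dvd B n * T n - R n" "\<And>n. R n $ 0 = 1"
  shows "P * \<Phi> = 1"
proof (rule fps_ext)
  fix n
  obtain S where S: "B n * T n - R n = fps_X ^ Suc n * S"
    using assms(4)[of n] by (elim dvdE)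
  have "R n * (F n * T n) = F n * R n * T n" by (simp only: mult_ac)
  also have "\<dots> = R n * 1 + fps_X ^ Suc n * S"
    unfolding assms(3) S[symmetric] by simp
  finally have "agree n (R n * (F n * T n)) (R n * 1)"
    using agree_add_X_power[of n "Suc n"] by simp
  then have "agree n (F n * T n) 1" by (rule agree_cancel_left[OF assms(5)])
  moreover have "agree n (F n * T n) (P * \<Phi>)" using assms(1,2) by (rule agree_mult)
  ultimately show "(P * \<Phi>) $ n = 1 $ n" by (simp add: agree_def)
qed

section \<open>Finite forms of Gauss's identities\<close>

text \<open>Both identities are due to Shanks; the differences of the right-hand sides for consecutive
  \<open>n\<close> telescope.\<close>

lemma shanks_squares:
  fixes q :: "'a :: comm_ring_1"
  shows "(\<Prod>k=1..n. 1 + q ^ k) * (1 + 2 * (\<Sum>s=1..n. (-1) ^ s * q ^ s\<^sup>2)) =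
    (\<Sum>s\<le>n. (-1) ^ s * (\<Prod>k=Suc s..n. 1 - q ^ k) * (\<Prod>k<s. 1 + q ^ k) * q ^ (s * Suc n))"
proof (induction n)
  case 0
  show ?case by simp
next
  case (Suc n)
  define b where "b s = (\<Prod>k<s. 1 + q ^ k)" for s
  define R where "R s n = (\<Prod>k=Suc s..n. 1 - q ^ k)" for s n
  define t where "t n s = (-1) ^ s * R s n * b s * q ^ (s * Suc n)" for n s
  define B where "B n = (\<Prod>k=1..n. 1 + q ^ k)" for n
  define \<phi> where "\<phi> n = 1 + 2 * (\<Sum>s=1..n. (-1) ^ s * q ^ s\<^sup>2)" for n
  have b_Suc: "b (Suc s) = b s * (1 + q ^ s)" for s by (simp add: b_def)
  \<comment> \<open>The factor of \<open>b\<close> at \<open>k = 0\<close> is \<open>1 + 1\<close>;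
    it is the source of the 2 in front of the theta sum.\<close>
  have bB: "b (Suc m) = 2 * B m" for m
    by (induction m) (simp_all add: b_def B_def)
  have R_Suc: "R s (Suc n) = R s n * (1 - q ^ Suc n)" if "s \<le> n" for s
    using that by (simp add: R_def)
  have R_split: "R s n = (1 - q ^ Suc s) * R (Suc s) n" if "s < n" for s
    using that by (simp add: R_def prod.atLeast_Suc_atMost)
  have R_empty: "R n n = 1" for n by (simp add: R_def)
  \<comment> \<open>The left-hand side passes from \<open>n\<close> to \<open>Suc n\<close> by the
    factor \<open>1 + q ^ Suc n\<close> and one new square. So the terms at \<open>n\<close> are
    scaled by that factor before they are subtracted, and the partial sums acquire a closed
    form.\<close>
  have tele: "(\<Sum>s\<le>m. t (Suc n) s - (1 + q ^ Suc n) * t n s) =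
      (-1) ^ Suc m * b (Suc m) * R m n * q ^ (Suc m * Suc n)" if "m \<le> n" for m
    using that
  proof (induction m)
    case 0
    show ?case using R_Suc[of 0] by (simp add: t_def b_def algebra_simps)
  next
    case (Suc m)
    have "q ^ (Suc m * Suc (Suc n)) = q ^ (Suc m * Suc n) * q ^ Suc m"
      by (simp add: power_add[symmetric] algebra_simps)
    then have "t (Suc n) (Suc m) - (1 + q ^ Suc n) * t n (Suc m) =
      (-1) ^ Suc m * b (Suc m) * R (Suc m) n * q ^ (Suc m * Suc n) *
        (q ^ Suc m * (1 - q ^ Suc n) - (1 + q ^ Suc n))"
      unfolding t_def R_Suc[OF Suc.prems] by (simp only: algebra_simps mult_1_left mult_1_right)
    \<comment> \<open>The bracket is split so that its first part cancels the closed form of the sum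
      up to \<open>m\<close>, while the second supplies the factor \<open>1 + q ^ Suc m\<close> that
      extends \<open>b\<close>.\<close>
    also have "q ^ Suc m * (1 - q ^ Suc n) - (1 + q ^ Suc n) =
        - (1 - q ^ Suc m) - q ^ Suc n * (1 + q ^ Suc m)"
      by (simp add: algebra_simps)
    finally have diff: "t (Suc n) (Suc m) - (1 + q ^ Suc n) * t n (Suc m) =
      (-1) ^ Suc m * b (Suc m) * R (Suc m) n * q ^ (Suc m * Suc n) *
        (- (1 - q ^ Suc m) - q ^ Suc n * (1 + q ^ Suc m))" .
    define X where "X = (-1) ^ Suc m * b (Suc m) * R (Suc m) n * q ^ (Suc m * Suc n)"
    have IH: "(\<Sum>s\<le>m. t (Suc n) s - (1 + q ^ Suc n) * t n s) = X * (1 - q ^ Suc m)"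
      using Suc R_split[of m] by (simp add: X_def mult_ac)
    have "(\<Sum>s\<le>Suc m. t (Suc n) s - (1 + q ^ Suc n) * t n s) = - (X * (1 + q ^ Suc m) * q ^ Suc n)"
      unfolding sum.atMost_Suc diff IH X_def[symmetric] by (simp add: algebra_simps)
    also have "\<dots> = (-1) ^ Suc (Suc m) * b (Suc (Suc m)) * R (Suc m) n * q ^ (Suc (Suc m) * Suc n)"
      unfolding b_Suc[of "Suc m"] X_def by (simp add: power_add algebra_simps)
    finally show ?case .
  qed
  have "(\<Sum>s\<le>Suc n. t (Suc n) s) = (\<Sum>s\<le>n. t (Suc n) s - (1 + q ^ Suc n) * t n s)
      + (1 + q ^ Suc n) * (\<Sum>s\<le>n. t n s) + t (Suc n) (Suc n)"
    by (simp add: sum_subtractf sum_distrib_left)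
  also have "(\<Sum>s\<le>n. t (Suc n) s - (1 + q ^ Suc n) * t n s) = (-1) ^ Suc n * b (Suc n) * q ^ (Suc n * Suc n)"
    using tele[of n] R_empty by simp
  also have "t (Suc n) (Suc n) = (-1) ^ Suc n * b (Suc n) * q ^ (Suc n * Suc n) * q ^ Suc n"
    using R_empty[of "Suc n"] by (simp add: t_def algebra_simps power_add)
  also have "(\<Sum>s\<le>n. t n s) = B n * \<phi> n"
    using Suc.IH by (simp add: t_def R_def b_def B_def \<phi>_def)
  also have "(-1) ^ Suc n * b (Suc n) * q ^ (Suc n * Suc n) + (1 + q ^ Suc n) * (B n * \<phi> n)
      + (-1) ^ Suc n * b (Suc n) * q ^ (Suc n * Suc n) * q ^ Suc n =
      B n * (1 + q ^ Suc n) * (\<phi> n + 2 * ((-1) ^ Suc n * q ^ (Suc n * Suc n)))"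
    unfolding bB by (simp only: algebra_simps mult_1_left mult_1_right)
  also have "\<phi> n + 2 * ((-1) ^ Suc n * q ^ (Suc n * Suc n)) = \<phi> (Suc n)"
    by (simp add: \<phi>_def power2_eq_square algebra_simps)
  also have "B n * (1 + q ^ Suc n) = B (Suc n)" by (simp add: B_def)
  finally show ?case by (simp add: t_def R_def b_def B_def \<phi>_def)
qed

definition tri :: "nat \<Rightarrow> nat" where
  "tri s = s * Suc s div 2"

lemma tri_simps: "tri 0 = 0" "tri (Suc s) = tri s + Suc s"
proof -
  have "even (s * Suc s)" by simp
  moreover have "Suc s * Suc (Suc s) = s * Suc s + 2 * Suc s" by simp
  ultimately show "tri (Suc s) = tri s + Suc s" unfolding tri_def by presburger
qed (simp add: tri_def)

lemma tri_double: "tri (2 * n) = n * (2 * n + 1)"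
  by (simp add: tri_def)

lemma shanks_triangles:
  fixes q :: "'a :: comm_ring_1"
  shows "(\<Prod>k<n. 1 - q ^ (2 * k + 1)) * (\<Sum>s<2*n. q ^ tri s) =
    (\<Sum>s<n. (\<Prod>k=Suc s..n. 1 - q ^ (2 * k)) * (\<Prod>k<s. 1 - q ^ (2 * k + 1)) * q ^ (s * (2 * n + 1)))"
proof (induction n)
  case 0
  show ?case by simp
next
  case (Suc n)
  define c where "c s = (\<Prod>k<s. 1 - q ^ (2 * k + 1))" for s
  define R where "R s n = (\<Prod>k=Suc s..n. 1 - q ^ (2 * k))" for s n
  define t where "t n s = R s n * c s * q ^ (s * (2 * n + 1))" for n s
  define \<psi> where "\<psi> n = (\<Sum>s<2*n. q ^ tri s)" for n
  \<comment> \<open>\<open>1 - p\<close> is the factor by which \<open>c\<close> grows from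
    \<open>n\<close> to \<open>Suc n\<close>, and the two new triangular powers are
    \<open>p ^ n\<close> and \<open>p ^ Suc n\<close>.\<close>
  define p where "p = q ^ (2 * n + 1)"
  have c_Suc: "c (Suc s) = c s * (1 - q ^ (2 * s + 1))" for s by (simp add: c_def)
  have R_Suc: "R s (Suc n) = R s n * (1 - q ^ (2 * Suc n))" if "s \<le> n" for s
    using that by (simp add: R_def)
  have R_split: "R s n = (1 - q ^ (2 * Suc s)) * R (Suc s) n" if "s < n" for s
    using that by (simp add: R_def prod.atLeast_Suc_atMost)
  have t_Suc: "t (Suc n) s = R s n * c s * p ^ s * (q ^ (2 * s) * (1 - p * q))" if "s \<le> n" for s
  proof -
    have "q ^ (s * (2 * Suc n + 1)) = p ^ s * q ^ (2 * s)" "q ^ (2 * Suc n) = p * q"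
      by (simp_all add: p_def power_mult[symmetric] power_add[symmetric] algebra_simps)
    then show ?thesis unfolding t_def R_Suc[OF that] by (simp only: mult_ac)
  qed
  have t_p: "t n s = R s n * c s * p ^ s" for s
    unfolding t_def p_def power_mult[symmetric] by (simp only: mult.commute)
  have tele: "(\<Sum>s<Suc m. t (Suc n) s - (1 - p) * t n s) = R m n * c (Suc m) * p ^ Suc m" if "m < n" for m
    using that
  proof (induction m)
    case 0
    show ?case using t_Suc[of 0] by (simp add: t_p c_def algebra_simps)
  next
    case (Suc m)
    have diff: "t (Suc n) (Suc m) - (1 - p) * t n (Suc m) =
      R (Suc m) n * c (Suc m) * p ^ Suc m * (p * (1 - q ^ (2 * Suc m + 1)) - (1 - q ^ (2 * Suc m)))"
      using t_Suc[of "Suc m"] Suc.prems by (simp add: t_p algebra_simps)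
    have IH: "(\<Sum>s<Suc m. t (Suc n) s - (1 - p) * t n s) =
      (1 - q ^ (2 * Suc m)) * R (Suc m) n * c (Suc m) * p ^ Suc m"
      using Suc R_split[of m] by simp
    have "(\<Sum>s<Suc (Suc m). t (Suc n) s - (1 - p) * t n s) =
      R (Suc m) n * (c (Suc m) * (1 - q ^ (2 * Suc m + 1))) * (p * p ^ Suc m)"
      unfolding sum.lessThan_Suc[of _ "Suc m"] diff IH by (simp only: algebra_simps mult_1_left mult_1_right)
    then show ?case unfolding c_Suc[of "Suc m"] power_Suc[of p "Suc m"] .
  qed
  \<comment> \<open>For \<open>n = 0\<close> the sum is empty and the right-hand side is zero
    because of \<open>1 - q ^ 0\<close>; otherwise this is \<open>tele\<close> at
    \<open>n - 1\<close>.\<close>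
  have tele': "(\<Sum>s<n. t (Suc n) s - (1 - p) * t n s) = (1 - q ^ (2 * n)) * c n * p ^ n"
  proof (cases n)
    case (Suc m)
    then have "R m n = 1 - q ^ (2 * n)" by (simp add: R_def)
    then show ?thesis using tele[of m] Suc by simp
  qed simp
  have "(\<Sum>s<Suc n. t (Suc n) s) =
      (\<Sum>s<n. t (Suc n) s - (1 - p) * t n s) + (1 - p) * (\<Sum>s<n. t n s) + t (Suc n) n"
    by (simp add: sum_subtractf sum_distrib_left)
  also have "t (Suc n) n = c n * p ^ n * (q ^ (2 * n) * (1 - p * q))"
    using t_Suc[of n] by (simp add: R_def)
  also have "(\<Sum>s<n. t n s) = c n * \<psi> n"
    using Suc.IH by (simp add: t_def R_def c_def \<psi>_def)
  also have "(\<Sum>s<n. t (Suc n) s - (1 - p) * t n s) = (1 - q ^ (2 * n)) * c n * p ^ n"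
    by (rule tele')
  also have "(1 - q ^ (2 * n)) * c n * p ^ n + (1 - p) * (c n * \<psi> n) + c n * p ^ n * (q ^ (2 * n) * (1 - p * q))
     = c n * (1 - p) * \<psi> n + c n * (1 - p * (q ^ (2 * n) * q)) * p ^ n"
    by (simp only: algebra_simps mult_1_left mult_1_right)
  also have "q ^ (2 * n) * q = p" by (simp add: p_def)
  also have "c n * (1 - p) * \<psi> n + c n * (1 - p * p) * p ^ n = c n * (1 - p) * (\<psi> n + p ^ n + p ^ n * p)"
    by (simp only: algebra_simps mult_1_left mult_1_right)
  also have "\<psi> n + p ^ n + p ^ n * p = \<psi> (Suc n)"
  proof -
    have "\<psi> (Suc n) = \<psi> n + q ^ tri (2 * n) + q ^ tri (Suc (2 * n))" by (simp add: \<psi>_def)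
    moreover have "q ^ tri (2 * n) = p ^ n"
      unfolding tri_double p_def power_mult[symmetric] by (simp only: mult.commute)
    ultimately show ?thesis unfolding tri_simps by (simp add: power_add p_def)
  qed
  also have "c n * (1 - p) = c (Suc n)" by (simp add: c_Suc p_def)
  finally show ?case by (simp add: t_def R_def c_def \<psi>_def)
qed

section \<open>Generating functions of weighted partitions\<close>

definition bounded_partitions :: "nat \<Rightarrow> nat \<Rightarrow> nat multiset set" where
  "bounded_partitions N n = {P. set_mset P \<subseteq> {1..N} \<and> sum_mset P = n}"

text \<open>\<open>w k m\<close> is the weight of using the part \<open>k\<close> exactly
  \<open>m\<close> times, so this is the local factor of \<open>k\<close> in an Euler product; both
  kinds of partitions arise by a choice of \<open>w\<close>.\<close>

definition weight_fps :: "(nat \<Rightarrow> nat \<Rightarrow> int) \<Rightarrow> nat \<Rightarrow> int fps" where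
  "weight_fps w k = Abs_fps (\<lambda>n. if k dvd n then w k (n div k) else 0)"

definition partition_fps :: "(nat \<Rightarrow> nat \<Rightarrow> int) \<Rightarrow> nat \<Rightarrow> int fps" where
  "partition_fps w N =
    Abs_fps (\<lambda>n. \<Sum>P\<in>bounded_partitions N n. \<Prod>k=1..N. w k (count P k))"

lemma partitions_eq_bounded: "n \<le> N \<Longrightarrow> partitions n = bounded_partitions N n"
proof -
  assume "n \<le> N"
  have "k \<le> sum_mset P" if "k \<in># P" for k and P :: "nat multiset"
    using that by (metis le_add1 multi_member_split sum_mset.add_mset)
  with \<open>n \<le> N\<close> show ?thesis
    unfolding partitions_def bounded_partitions_def
    by (fastforce simp: Suc_le_eq intro: le_trans gr0I)
qed

lemma finite_bounded_partitions: "finite (bounded_partitions N n)"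
proof -
  have size: "size P \<le> sum_mset P" if "0 \<notin># P" for P :: "nat multiset"
    using that by (induction P) auto
  have "bounded_partitions N n \<subseteq> (\<Union>m\<le>n. multisets_of_size {1..N} m)"
    using size by (force simp: bounded_partitions_def multisets_of_size_def)
  then show ?thesis
    by (rule finite_subset) (intro finite_UN_I finite_atMost finite_multisets_of_size finite_atLeastAtMost)
qed

text \<open>A partition is split into its copies of \<open>Suc N\<close> and the rest; the index
  \<open>i\<close> of the convolution is the total that these copies contribute.\<close>

lemma partition_fps_Suc: "partition_fps w (Suc N) = partition_fps w N * weight_fps w (Suc N)"
proof (rule fps_ext)
  fix n
  let ?K = "Suc N"
  define I where "I = {i \<in> {0..n}. ?K dvd i}"
  define g where "g = (\<lambda>i P. (\<Prod>k=1..N. w k (count P k)) * w ?K (i div ?K))"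
  have "(partition_fps w N * weight_fps w ?K) $ n =
      (\<Sum>i=0..n. weight_fps w ?K $ i * partition_fps w N $ (n - i))"
    by (simp add: mult.commute[of "partition_fps w N"] fps_mult_nth)
  also have "\<dots> = (\<Sum>i\<in>I. weight_fps w ?K $ i * partition_fps w N $ (n - i))"
    by (rule sum.mono_neutral_right) (auto simp: I_def weight_fps_def)
  also have "\<dots> = (\<Sum>i\<in>I. \<Sum>P\<in>bounded_partitions N (n - i). g i P)"
    by (intro sum.cong)
      (auto simp: I_def weight_fps_def partition_fps_def g_def sum_distrib_left mult.commute)
  also have "\<dots> = (\<Sum>(i, P)\<in>(SIGMA i:I. bounded_partitions N (n - i)). g i P)"
    by (rule sum.Sigma) (auto simp: I_def finite_bounded_partitions)
  also have "\<dots> = (\<Sum>P\<in>bounded_partitions ?K n. \<Prod>k=1..?K. w k (count P k))"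
  proof (rule sum.reindex_bij_witness[where
        j = "\<lambda>(i, P). P + replicate_mset (i div ?K) ?K" and
        i = "\<lambda>P. (count P ?K * ?K, filter_mset (\<lambda>k. k \<noteq> ?K) P)"])
    fix z assume "z \<in> (SIGMA i:I. bounded_partitions N (n - i))"
    then obtain i P where z: "z = (i, P)" and i: "i \<le> n" "?K dvd i"
      and P: "set_mset P \<subseteq> {1..N}" "sum_mset P = n - i"
      by (auto simp: I_def bounded_partitions_def)
    have nP: "?K \<notin># P" using P by auto
    then have c0: "count P ?K = 0" by (simp add: not_in_iff)
    moreover have "filter_mset (\<lambda>k. k \<noteq> ?K) P = P"
      by (rule multiset_eqI) (use c0 in simp)
    moreover have "filter_mset (\<lambda>k. k \<noteq> ?K) (replicate_mset m ?K) = {#}" for m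
      by (induction m) auto
    ultimately show "(\<lambda>P. (count P ?K * ?K, filter_mset (\<lambda>k. k \<noteq> ?K) P))
        ((\<lambda>(i, P). P + replicate_mset (i div ?K) ?K) z) = z"
      using dvd_div_mult_self[OF i(2)] by (simp add: z)
    show "(\<lambda>(i, P). P + replicate_mset (i div ?K) ?K) z \<in> bounded_partitions ?K n"
      using dvd_div_mult_self[OF i(2)] i P
      by (auto simp: z bounded_partitions_def split: if_splits)
    have "(\<Prod>k=1..N. w k (count (P + replicate_mset (i div ?K) ?K) k)) = (\<Prod>k=1..N. w k (count P k))"
      by (rule prod.cong) auto
    then show "(\<Prod>k=1..?K. w k (count ((\<lambda>(i, P). P + replicate_mset (i div ?K) ?K) z) k)) =
        (case z of (i, P) \<Rightarrow> g i P)"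
      using c0 by (simp add: z g_def)
  next
    fix P assume P: "P \<in> bounded_partitions ?K n"
    have split: "filter_mset (\<lambda>k. k \<noteq> ?K) P + replicate_mset (count P ?K) ?K = P"
      by (rule multiset_eqI) auto
    then show "(\<lambda>(i, P). P + replicate_mset (i div ?K) ?K) (count P ?K * ?K, filter_mset (\<lambda>k. k \<noteq> ?K) P) = P"
      by (simp del: mult_Suc_right)
    have "sum_mset (filter_mset (\<lambda>k. k \<noteq> ?K) P) + count P ?K * ?K = n"
      using P arg_cong[OF split, of sum_mset] by (simp add: bounded_partitions_def)
    then show "(count P ?K * ?K, filter_mset (\<lambda>k. k \<noteq> ?K) P) \<in> (SIGMA i:I. bounded_partitions N (n - i))"
      using P by (auto simp: I_def bounded_partitions_def le_Suc_eq simp del: mult_Suc_right)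
  qed
  finally show "partition_fps w ?K $ n = (partition_fps w N * weight_fps w ?K) $ n"
    by (simp add: partition_fps_def)
qed

lemma partition_fps_0: "partition_fps w 0 = 1"
proof (rule fps_ext)
  fix n
  have "bounded_partitions 0 n = (if n = 0 then {{#}} else {})"
    by (auto simp: bounded_partitions_def)
  then show "partition_fps w 0 $ n = 1 $ n" by (simp add: partition_fps_def)
qed

text \<open>Multiplication by \<open>1 - fps_X ^ k\<close> takes differences of the weights, so
  weights that are eventually constant in the multiplicity leave a polynomial.\<close>

lemma weight_fps_mult_one_minus:
  assumes "0 < k"
  shows "weight_fps w k * (1 - fps_X ^ k) =
    Abs_fps (\<lambda>n. if k dvd n then w k (n div k) - (if n = 0 then 0 else w k (n div k - 1)) else 0)"
proof (rule fps_ext)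
  fix n
  have "(weight_fps w k * (1 - fps_X ^ k)) $ n =
      weight_fps w k $ n - (if n < k then 0 else weight_fps w k $ (n - k))"
    by (simp add: right_diff_distrib fps_X_power_mult_right_nth)
  also have "\<dots> = (if k dvd n then w k (n div k) - (if n = 0 then 0 else w k (n div k - 1)) else 0)"
  proof (cases "n < k")
    case True
    then show ?thesis using assms by (auto simp: weight_fps_def dest: dvd_imp_le)
  next
    case False
    then obtain m where "n = k + m" using le_Suc_ex by (metis not_less)
    then show ?thesis using assms by (simp add: weight_fps_def)
  qed
  finally show "(weight_fps w k * (1 - fps_X ^ k)) $ n =
    Abs_fps (\<lambda>n. if k dvd n then w k (n div k) - (if n = 0 then 0 else w k (n div k - 1)) else 0) $ n"
    by simp
qed

section \<open>Weights of overpartitions and of partitions with distinct odd parts\<close>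

definition overpartition_weight :: "nat \<Rightarrow> nat \<Rightarrow> int" where
  "overpartition_weight k m = (if m = 0 then 1 else 2)"

definition pod_weight :: "nat \<Rightarrow> nat \<Rightarrow> int" where
  "pod_weight k m = (if odd k \<and> 1 < m then 0 else 1)"

lemma weight_fps_overpartition:
  assumes "0 < k"
  shows "weight_fps overpartition_weight k * (1 - fps_X ^ k) = 1 + fps_X ^ k"
  unfolding weight_fps_mult_one_minus[OF assms]
proof (rule fps_ext)
  fix n
  have "(if k dvd n then overpartition_weight k (n div k)
      - (if n = 0 then 0 else overpartition_weight k (n div k - 1)) else 0) = (1 + fps_X ^ k :: int fps) $ n"
  proof (cases "k dvd n")
    case True
    then obtain m where "n = k * m" ..
    then show ?thesis using assms
      by (cases m; cases "m - 1") (auto simp: overpartition_weight_def)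
  next
    case False
    then have "n \<noteq> 0" "n \<noteq> k" by (metis dvd_0_right, metis dvd_refl)
    then show ?thesis using False by simp
  qed
  then show "Abs_fps (\<lambda>n. if k dvd n then overpartition_weight k (n div k)
      - (if n = 0 then 0 else overpartition_weight k (n div k - 1)) else 0) $ n = (1 + fps_X ^ k :: int fps) $ n"
    by simp
qed

lemma weight_fps_pod_even:
  assumes "0 < k" "even k"
  shows "weight_fps pod_weight k * (1 - fps_X ^ k) = 1"
  unfolding weight_fps_mult_one_minus[OF assms(1)]
  using assms(2) by (intro fps_ext) (auto simp: pod_weight_def)

lemma weight_fps_pod_odd:
  assumes "odd k"
  shows "weight_fps pod_weight k = 1 + fps_X ^ k"
proof (rule fps_ext)
  fix n
  show "weight_fps pod_weight k $ n = (1 + fps_X ^ k :: int fps) $ n"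
  proof (cases "k dvd n")
    case True
    then obtain m where "n = k * m" ..
    then show ?thesis using assms odd_pos[OF assms]
      by (cases m; cases "m - 1") (auto simp: weight_fps_def pod_weight_def)
  next
    case False
    then have "n \<noteq> 0" "n \<noteq> k" by (metis dvd_0_right, metis dvd_refl)
    then show ?thesis using False by (simp add: weight_fps_def)
  qed
qed

lemma partition_fps_overpartition:
  "partition_fps overpartition_weight n * (\<Prod>k=1..n. 1 - fps_X ^ k) = (\<Prod>k=1..n. 1 + fps_X ^ k)"
proof (induction n)
  case (Suc n)
  have "partition_fps overpartition_weight (Suc n) * (\<Prod>k=1..Suc n. 1 - fps_X ^ k) =
    (partition_fps overpartition_weight n * (\<Prod>k=1..n. 1 - fps_X ^ k)) *
    (weight_fps overpartition_weight (Suc n) * (1 - fps_X ^ Suc n))"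
    unfolding partition_fps_Suc by (simp add: mult_ac)
  then show ?case unfolding Suc weight_fps_overpartition[OF zero_less_Suc] by simp
qed (simp add: partition_fps_0)

lemma partition_fps_pod:
  "partition_fps pod_weight (2 * n) * (\<Prod>k=1..n. 1 - fps_X ^ (2 * k)) = (\<Prod>k<n. 1 + fps_X ^ (2 * k + 1))"
proof (induction n)
  case (Suc n)
  have double_Suc: "2 * Suc n = Suc (Suc (2 * n))" by simp
  have "partition_fps pod_weight (2 * Suc n) =
      partition_fps pod_weight (2 * n) * weight_fps pod_weight (2 * n + 1) * weight_fps pod_weight (2 * Suc n)"
    unfolding double_Suc partition_fps_Suc by simp
  then have "partition_fps pod_weight (2 * Suc n) * (\<Prod>k=1..Suc n. 1 - fps_X ^ (2 * k)) =
    (partition_fps pod_weight (2 * n) * (\<Prod>k=1..n. 1 - fps_X ^ (2 * k))) * weight_fps pod_weight (2 * n + 1) *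
    (weight_fps pod_weight (2 * Suc n) * (1 - fps_X ^ (2 * Suc n)))"
    by (simp add: mult_ac)
  also have "weight_fps pod_weight (2 * Suc n) * (1 - fps_X ^ (2 * Suc n)) = 1"
    by (rule weight_fps_pod_even) simp_all
  also have "weight_fps pod_weight (2 * n + 1) = 1 + fps_X ^ (2 * n + 1)"
    by (rule weight_fps_pod_odd) simp
  finally show ?case unfolding Suc by simp
qed (simp add: partition_fps_0)

lemma num_overpartitions_eq_sum: "num_overpartitions n = (\<Sum>P\<in>partitions n. 2 ^ card (set_mset P))"
proof -
  have "overpartitions n = (SIGMA P:partitions n. Pow (set_mset P))"
    by (auto simp: overpartitions_def)
  moreover have "finite (partitions n)"
    using partitions_eq_bounded[of n n] finite_bounded_partitions by simp
  ultimately show ?thesis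
    by (simp add: num_overpartitions_def card_SigmaI card_Pow)
qed

lemma partition_fps_overpartition_nth:
  assumes "n \<le> N"
  shows "partition_fps overpartition_weight N $ n = int (num_overpartitions n)"
proof -
  have "(\<Prod>k=1..N. overpartition_weight k (count P k)) = 2 ^ card (set_mset P)"
    if "P \<in> bounded_partitions N n" for P
  proof -
    have "(\<Prod>k=1..N. overpartition_weight k (count P k)) = (\<Prod>k\<in>set_mset P. 2)"
      using that by (intro prod.mono_neutral_cong_right)
        (auto simp: bounded_partitions_def overpartition_weight_def not_in_iff)
    then show ?thesis by simp
  qed
  then show ?thesis
    by (simp add: partition_fps_def num_overpartitions_eq_sum partitions_eq_bounded[OF assms])
qed

lemma partition_fps_pod_nth:
  assumes "n \<le> N"
  shows "partition_fps pod_weight N $ n = int (pod n)"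
proof -
  let ?good = "\<lambda>P. \<forall>k. odd k \<longrightarrow> count P k \<le> 1"
  have "(\<Prod>k=1..N. pod_weight k (count P k)) = (if ?good P then 1 else 0)"
    if P: "P \<in> bounded_partitions N n" for P
  proof (cases "?good P")
    case True
    then have "(\<Prod>k=1..N. pod_weight k (count P k)) = 1"
      by (intro prod.neutral) (auto simp: pod_weight_def not_less)
    then show ?thesis using True by simp
  next
    case False
    then obtain k where k: "odd k" "1 < count P k" by (auto simp: not_le)
    then have "k \<in># P" by (simp flip: count_greater_zero_iff)
    then have "k \<in> {1..N}" using P by (auto simp: bounded_partitions_def)
    then have "(\<Prod>k=1..N. pod_weight k (count P k)) = 0"
      using k by (intro prod_zero) (auto simp: pod_weight_def)
    then show ?thesis unfolding if_not_P[OF False] .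
  qed
  then have "partition_fps pod_weight N $ n = (\<Sum>P\<in>bounded_partitions N n. if ?good P then 1 else 0)"
    by (simp add: partition_fps_def)
  also have "\<dots> = int (card {P \<in> bounded_partitions N n. ?good P})"
    using finite_bounded_partitions by (simp add: sum.If_cases Int_def)
  finally show ?thesis by (simp add: pod_def partitions_eq_bounded[OF assms])
qed

section \<open>Counting series and reduction modulo 3\<close>

definition counting :: "('a \<Rightarrow> nat) \<Rightarrow> int fps" where
  "counting f = Abs_fps (\<lambda>n. int (card {x. f x = n}))"

text \<open>\<open>card\<close> is 0 on infinite sets; this condition makes the coefficients of
  \<open>counting\<close> genuine counts and turns products into counts of pairs.\<close>

definition finite_fibres :: "('a \<Rightarrow> nat) \<Rightarrow> bool" where
  "finite_fibres f \<longleftrightarrow> (\<forall>n. finite {x. f x = n})"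

definition alternate :: "int fps \<Rightarrow> int fps" where
  "alternate F = Abs_fps (\<lambda>n. (-1) ^ n * F $ n)"

definition dilate3 :: "int fps \<Rightarrow> int fps" where
  "dilate3 F = Abs_fps (\<lambda>n. if 3 dvd n then F $ (n div 3) else 0)"

definition extract3 :: "nat \<Rightarrow> int fps \<Rightarrow> int fps" where
  "extract3 r F = Abs_fps (\<lambda>n. F $ (3 * n + r))"

lemma counting_mult:
  assumes "finite_fibres f" "finite_fibres g"
  shows "counting f * counting g = counting (\<lambda>(x, y). f x + g y)"
    and "finite_fibres (\<lambda>(x, y). f x + g y)"
proof -
  have split: "{z. (\<lambda>(x, y). f x + g y) z = n} = (\<Union>i\<in>{0..n}. {x. f x = i} \<times> {y. g y = n - i})" for n
    by auto
  show fin: "finite_fibres (\<lambda>(x, y). f x + g y)"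
    unfolding finite_fibres_def split using assms by (auto simp: finite_fibres_def)
  show "counting f * counting g = counting (\<lambda>(x, y). f x + g y)"
  proof (rule fps_ext)
    fix n
    have "card {z. (\<lambda>(x, y). f x + g y) z = n} = (\<Sum>i\<in>{0..n}. card ({x. f x = i} \<times> {y. g y = n - i}))"
      unfolding split
      by (rule card_UN_disjoint) (use assms in \<open>auto simp: finite_fibres_def\<close>)
    then show "(counting f * counting g) $ n = counting (\<lambda>(x, y). f x + g y) $ n"
      by (simp add: counting_def fps_mult_nth card_cartesian_product)
  qed
qed

lemma dilate3_counting: "dilate3 (counting f) = counting (\<lambda>x. 3 * f x)"
proof (rule fps_ext)
  fix n
  show "dilate3 (counting f) $ n = counting (\<lambda>x. 3 * f x) $ n"
  proof (cases "3 dvd n")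
    case True
    then obtain m where "n = 3 * m" ..
    then show ?thesis by (simp add: dilate3_def counting_def)
  next
    case False
    then have "{x. 3 * f x = n} = {}" by auto
    then show ?thesis using False by (simp add: dilate3_def counting_def)
  qed
qed

lemma finite_fibres_mult3: "finite_fibres f \<Longrightarrow> finite_fibres (\<lambda>x. 3 * f x)"
  unfolding finite_fibres_def
proof
  fix n assume "\<forall>n. finite {x. f x = n}"
  then have "finite {x. f x = n div 3}" by blast
  then show "finite {x. 3 * f x = n}" by (rule rev_finite_subset) auto
qed

lemma alternate_mult: "alternate (F * G) = alternate F * alternate G"
proof (rule fps_ext)
  fix n
  have "(-1) ^ n * (F $ i * G $ (n - i)) = ((-1) ^ i * F $ i) * ((-1) ^ (n - i) * G $ (n - i))"
    if "i \<in> {0..n}" for i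
  proof -
    have "(-1 :: int) ^ n = (-1) ^ i * (-1) ^ (n - i)"
      using that by (simp flip: power_add)
    then show ?thesis by (simp only: mult_ac)
  qed
  then show "alternate (F * G) $ n = (alternate F * alternate G) $ n"
    unfolding alternate_def fps_mult_nth fps_nth_Abs_fps sum_distrib_left by (rule sum.cong[OF refl])
qed

lemma alternate_alternate [simp]: "alternate (alternate F) = F"
  by (rule fps_ext) (simp add: alternate_def flip: power_add mult.assoc mult_2)

lemma alternate_1 [simp]: "alternate 1 = 1"
  by (rule fps_ext) (simp add: alternate_def)

text \<open>A series in \<open>q^3\<close> does not mix residue classes of exponents. A contributing
  index \<open>i\<close> is congruent to \<open>r\<close> modulo 3, and \<open>r < 3\<close> makes
  \<open>r\<close> the least such index, so \<open>i = 3 * j + r\<close>.\<close>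

lemma extract3_mult_dilate3:
  assumes "r < 3"
  shows "extract3 r (F * dilate3 G) = extract3 r F * G"
proof (rule fps_ext)
  fix n
  have "extract3 r (F * dilate3 G) $ n = (\<Sum>i=0..3 * n + r. F $ i * dilate3 G $ (3 * n + r - i))"
    by (simp add: extract3_def fps_mult_nth)
  also have "\<dots> = (\<Sum>i\<in>(\<lambda>j. 3 * j + r) ` {0..n}. F $ i * dilate3 G $ (3 * n + r - i))"
  proof (rule sum.mono_neutral_right)
    show "\<forall>i\<in>{0..3 * n + r} - (\<lambda>j. 3 * j + r) ` {0..n}. F $ i * dilate3 G $ (3 * n + r - i) = 0"
    proof
      fix i assume i: "i \<in> {0..3 * n + r} - (\<lambda>j. 3 * j + r) ` {0..n}"
      have "\<not> 3 dvd 3 * n + r - i"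
      proof
        assume "3 dvd 3 * n + r - i"
        then obtain k where k: "3 * n + r - i = 3 * k" ..
        with i assms have "k \<le> n" "i = 3 * (n - k) + r" by auto
        then show False using i by auto
      qed
      then show "F $ i * dilate3 G $ (3 * n + r - i) = 0" by (simp add: dilate3_def)
    qed
  qed auto
  also have "\<dots> = (\<Sum>j=0..n. F $ (3 * j + r) * dilate3 G $ (3 * n + r - (3 * j + r)))"
    by (subst sum.reindex) (auto simp: inj_on_def)
  also have "\<dots> = (\<Sum>j=0..n. F $ (3 * j + r) * G $ (n - j))"
    by (rule sum.cong) (simp_all add: dilate3_def flip: diff_mult_distrib2)
  finally show "extract3 r (F * dilate3 G) $ n = (extract3 r F * G) $ n"
    by (simp add: extract3_def fps_mult_nth)
qed

lemma extract3_diff: "extract3 r (F - G) = extract3 r F - extract3 r G"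
  by (rule fps_ext) (simp add: extract3_def)

lemma extract3_const_mult: "extract3 r (fps_const c * F) = fps_const c * extract3 r F"
  by (rule fps_ext) (simp add: extract3_def)

lemma const_dvd_fps_iff: "fps_const (c :: int) dvd F \<longleftrightarrow> (\<forall>n. c dvd F $ n)"
proof
  assume "\<forall>n. c dvd F $ n"
  then have "\<forall>n. \<exists>k. F $ n = c * k" by (simp add: dvd_def)
  then obtain g where "\<And>n. F $ n = c * g n" by metis
  then have "F = fps_const c * Abs_fps g" by (intro fps_ext) simp
  then show "fps_const c dvd F" by simp
qed (auto elim!: dvdE)

text \<open>Frobenius and Fermat modulo 3. Additivity of cubing is applied to polynomials, one
  monomial at a time; a coefficient of the cube depends only on a cutoff of the series.\<close>

lemma cube_cong_dilate3: "fps_const 3 dvd F ^ 3 - dilate3 F"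
proof -
  have poly: "fps_const 3 dvd (fps_cutoff n F) ^ 3 - dilate3 (fps_cutoff n F)" for n
  proof (induction n)
    case 0
    have "dilate3 0 = 0" by (rule fps_ext) (simp add: dilate3_def)
    then show ?case by simp
  next
    case (Suc n)
    define P M where "P = fps_cutoff n F" and "M = fps_const (F $ n) * fps_X ^ n"
    have cut: "fps_cutoff (Suc n) F = P + M"
      by (rule fps_ext) (auto simp: P_def M_def less_Suc_eq)
    have dil: "dilate3 (P + M) = dilate3 P + dilate3 M"
      by (rule fps_ext) (simp add: dilate3_def)
    have M: "M ^ 3 - dilate3 M = fps_const ((F $ n) ^ 3 - F $ n) * fps_X ^ (3 * n)"
    proof -
      have "M ^ 3 = fps_const ((F $ n) ^ 3) * fps_X ^ (3 * n)"
        by (simp add: M_def power_mult_distrib fps_const_power mult.commute flip: power_mult)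
      moreover have "dilate3 M = fps_const (F $ n) * fps_X ^ (3 * n)"
        by (rule fps_ext) (auto simp: dilate3_def M_def)
      ultimately show ?thesis by (simp add: left_diff_distrib flip: fps_const_sub)
    qed
    have "3 dvd a ^ 3 - a" for a :: int
    proof -
      have "a mod 3 = 0 \<or> a mod 3 = 1 \<or> a mod 3 = 2" by auto
      then have "(a ^ 3 - a) mod 3 = 0"
        by (subst mod_diff_eq[symmetric], subst power_mod[symmetric]) auto
      then show ?thesis by auto
    qed
    then have "fps_const 3 dvd M ^ 3 - dilate3 M"
      unfolding M by (intro dvd_mult2) (auto simp: const_dvd_fps_iff)
    moreover have "fps_const 3 dvd P ^ 3 - dilate3 P" using Suc by (simp add: P_def)
    moreover have "fps_const 3 = (3 :: int fps)" by (simp add: numeral_fps_const)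
    moreover have "(P + M) ^ 3 - dilate3 (P + M) =
        (P ^ 3 - dilate3 P) + (M ^ 3 - dilate3 M) + 3 * (P\<^sup>2 * M + P * M\<^sup>2)"
      unfolding dil by (simp add: power3_eq_cube power2_eq_square algebra_simps)
    ultimately show ?case unfolding cut by (metis dvd_add dvd_triv_left)
  qed
  have "3 dvd (F ^ 3 - dilate3 F) $ n" for n
  proof -
    let ?P = "fps_cutoff (Suc n) F"
    have F: "agree n F ?P" by (simp add: agree_def)
    then have "agree n (F * (F * F)) (?P * (?P * ?P))" by (intro agree_mult)
    then have "(F ^ 3) $ n = (?P ^ 3) $ n" by (simp add: agree_def power3_eq_cube mult.assoc)
    moreover have "dilate3 F $ n = dilate3 ?P $ n" by (simp add: dilate3_def less_Suc_eq_le)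
    ultimately show ?thesis using poly[of "Suc n"] by (simp add: const_dvd_fps_iff)
  qed
  then show ?thesis by (simp add: const_dvd_fps_iff)
qed

text \<open>If \<open>P = c / T\<close>, then \<open>P = c T\<^sup>2 / T\<^sup>3 \<equiv> c T\<^sup>2 / T(q\<^sup>3)\<close>, and the denominator passes through the
  extraction of a residue class modulo 3.\<close>

lemma extract3_cong:
  fixes P T :: "int fps"
  assumes PT: "P * T = fps_const c" and c: "\<not> 3 dvd c" and r: "r < 3"
    and square: "extract3 r (T\<^sup>2) = (dilate3 T)\<^sup>2"
  shows "3 dvd extract3 r P $ n - c * (T\<^sup>2 * dilate3 T) $ n"
proof -
  obtain D where D: "T ^ 3 - dilate3 T = fps_const 3 * D"
    using cube_cong_dilate3 dvdE by metis
  have "P * dilate3 T = P * (T ^ 3 - fps_const 3 * D)" unfolding D[symmetric] by simp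
  also have "\<dots> = (P * T) * T\<^sup>2 - fps_const 3 * (P * D)"
    by (simp only: power3_eq_cube power2_eq_square right_diff_distrib mult_ac)
  finally have dil: "P * dilate3 T = fps_const c * T\<^sup>2 - fps_const 3 * (P * D)" by (simp only: PT)
  define E where "E = extract3 r (P * D)"
  have ext: "extract3 r P * T = fps_const c * (dilate3 T)\<^sup>2 - fps_const 3 * E"
    using arg_cong[OF dil, of "extract3 r"]
    by (simp add: extract3_mult_dilate3[OF r] extract3_diff extract3_const_mult square E_def)
  \<comment> \<open>Division by \<open>T\<close> is replaced by multiplication by \<open>P\<close>,
    at the cost of a factor \<open>c\<close>, which is cancelled at the end as a unit modulo
    3.\<close>
  have "fps_const c * extract3 r P = (extract3 r P * T) * P" by (simp only: PT[symmetric] mult_ac)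
  also have "\<dots> = fps_const c * ((P * dilate3 T) * dilate3 T) - fps_const 3 * (E * P)"
    unfolding ext by (simp only: left_diff_distrib right_diff_distrib power2_eq_square mult_ac)
  also have "\<dots> = fps_const c * (fps_const c * (T\<^sup>2 * dilate3 T))
      - fps_const 3 * (fps_const c * (P * D * dilate3 T) + E * P)"
    unfolding dil by (simp only: left_diff_distrib right_diff_distrib distrib_left mult_ac diff_diff_eq)
  finally have "fps_const c * (extract3 r P - fps_const c * (T\<^sup>2 * dilate3 T)) =
      fps_const 3 * (- (fps_const c * (P * D * dilate3 T) + E * P))"
    by (simp only: right_diff_distrib mult_minus_right) simp
  then have "(fps_const c * (extract3 r P - fps_const c * (T\<^sup>2 * dilate3 T))) $ n =
      (fps_const 3 * (- (fps_const c * (P * D * dilate3 T) + E * P))) $ n" by (rule arg_cong)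
  then have "3 dvd c * (extract3 r P $ n - c * (T\<^sup>2 * dilate3 T) $ n)"
    unfolding fps_mult_left_const_nth fps_sub_nth by (metis dvd_triv_left)
  moreover have "prime (3 :: int)" by simp
  ultimately show ?thesis using c prime_dvd_mult_iff by blast
qed

text \<open>The slack 1 is for triangular numbers: \<open>tri_int (- 1) = 0\<close> and
  \<open>tri_int (- 2) = 1\<close>.\<close>

lemma finite_fibres_int:
  assumes "\<And>x :: int. \<bar>x\<bar> \<le> int (f x) + 1"
  shows "finite_fibres f"
  unfolding finite_fibres_def
proof
  fix n
  have "{x. f x = n} \<subseteq> {- int n - 1..int n + 1}"
  proof
    fix x assume "x \<in> {x. f x = n}"
    then show "x \<in> {- int n - 1..int n + 1}" using assms[of x] by auto
  qed
  then show "finite {x. f x = n}" by (rule finite_subset) simp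
qed

definition square_nat :: "int \<Rightarrow> nat" where
  "square_nat x = nat (x\<^sup>2)"

text \<open>Indexed by all integers, every triangular number is counted twice; this is why the factor 2
  appears in \<open>pod_fps_gauss\<close> and in \<open>pod_cong_ternary_tri\<close>.\<close>

definition tri_int :: "int \<Rightarrow> nat" where
  "tri_int x = nat (x * (x + 1) div 2)"

lemma int_square_nat: "int (square_nat x) = x\<^sup>2"
  by (simp add: square_nat_def)

lemma int_tri_int: "2 * int (tri_int x) = x * (x + 1)"
proof -
  have "0 \<le> x * (x + 1)" by (cases "0 \<le> x") (auto simp: zero_le_mult_iff)
  moreover have "even (x * (x + 1))" by simp
  ultimately show ?thesis by (simp add: tri_int_def)
qed

lemma finite_fibres_square_nat: "finite_fibres square_nat"
proof (rule finite_fibres_int)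
  fix x :: int
  have "\<bar>x\<bar> \<le> x\<^sup>2" using self_le_power[of "\<bar>x\<bar>" 2] by (cases "x = 0") auto
  then show "\<bar>x\<bar> \<le> int (square_nat x) + 1" by (simp add: int_square_nat)
qed

lemma finite_fibres_tri_int: "finite_fibres tri_int"
proof (rule finite_fibres_int)
  fix x :: int
  have "0 \<le> (x - 1) * (x - 2)" by (simp add: zero_le_mult_iff) linarith
  moreover have "0 \<le> (x + 2) * (x + 1)" by (simp add: zero_le_mult_iff) linarith
  ultimately have "2 * \<bar>x\<bar> \<le> 2 * int (tri_int x) + 2"
    unfolding int_tri_int by (simp add: algebra_simps abs_if)
  then show "\<bar>x\<bar> \<le> int (tri_int x) + 1" by simp
qed

section \<open>Gauss's identities\<close>

definition overpartition_fps :: "int fps" where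
  "overpartition_fps = Abs_fps (\<lambda>n. int (num_overpartitions n))"

definition pod_fps :: "int fps" where
  "pod_fps = Abs_fps (\<lambda>n. int (pod n))"

lemma card_squares: "m \<le> n \<Longrightarrow>
  int (card {x. square_nat x = m}) = (if m = 0 then 1 else 0) + 2 * (\<Sum>s=1..n. if m = s\<^sup>2 then 1 else 0)"
proof -
  assume "m \<le> n"
  show ?thesis
  proof (cases "\<exists>s. m = s\<^sup>2")
    case True
    then obtain s where s: "m = s\<^sup>2" by blast
    have eq: "m = t\<^sup>2 \<longleftrightarrow> t = s" for t by (auto simp: s)
    have "{x. square_nat x = m} = {int s, - int s}"
    proof -
      have "square_nat x = m \<longleftrightarrow> x\<^sup>2 = (int s)\<^sup>2" for x
        unfolding s by (metis int_square_nat of_nat_eq_iff of_nat_power)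
      then show ?thesis by (auto simp: power2_eq_iff)
    qed
    moreover have "s \<le> n" using \<open>m \<le> n\<close> self_le_power[of s 2] by (cases "s = 0") (auto simp: s)
    ultimately show ?thesis by (cases "s = 0") (auto simp: eq s)
  next
    case False
    have "{x. square_nat x = m} = {}"
    proof (rule equals0I)
      fix x assume "x \<in> {x. square_nat x = m}"
      then have "int m = x\<^sup>2" using int_square_nat[of x] by simp
      then have "m = (nat \<bar>x\<bar>)\<^sup>2"
        by (metis nat_abs_int_diff nat_int nat_power_eq power2_abs abs_ge_zero)
      with False show False by blast
    qed
    moreover have "m \<noteq> 0" using False by (metis zero_power2)
    ultimately show ?thesis using False by simp
  qed
qed

lemma prod_nth_0: "(\<And>x. x \<in> A \<Longrightarrow> f x $ 0 = 1) \<Longrightarrow> (\<Prod>x\<in>A. f x :: int fps) $ 0 = 1"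
  by (induction A rule: infinite_finite_induct) auto

text \<open>On the right-hand sides of the finite identities every term with \<open>s > 0\<close>
  carries a power of \<open>q ^ m\<close>, so to the precision that \<open>gauss_truncation\<close>
  asks for only the term at \<open>s = 0\<close> survives.\<close>

lemma dvd_sum_minus_first:
  fixes q :: "'a :: comm_ring_1"
  assumes "p dvd q ^ m"
  shows "p dvd (\<Sum>s\<le>n. t s * q ^ (s * m)) - t 0"
proof -
  have "(\<Sum>s\<le>n. t s * q ^ (s * m)) - t 0 = (\<Sum>s=1..n. t s * q ^ (s * m))"
    by (simp add: atMost_atLeast0 sum.atLeast_Suc_atMost)
  moreover have "p dvd t s * q ^ (s * m)" if "s \<in> {1..n}" for s
  proof -
    have "q ^ (s * m) = q ^ m * q ^ ((s - 1) * m)"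
      using that by (cases s) (simp_all add: power_add)
    then show ?thesis using assms by simp
  qed
  ultimately show ?thesis by (simp only: dvd_sum)
qed

lemma overpartition_fps_gauss: "alternate overpartition_fps * counting square_nat = 1"
proof -
  have "overpartition_fps * alternate (counting square_nat) = 1"
  proof (rule gauss_truncation)
    fix n
    show "agree n (partition_fps overpartition_weight n) overpartition_fps"
      by (simp add: agree_def partition_fps_overpartition_nth overpartition_fps_def)
    show "agree n (1 + 2 * (\<Sum>s=1..n. (-1) ^ s * fps_X ^ s\<^sup>2)) (alternate (counting square_nat))"
      unfolding agree_def
    proof (intro allI impI)
      fix m assume "m \<le> n"
      have coeff: "((-1) ^ s * fps_X ^ s\<^sup>2 :: int fps) $ m = (-1) ^ m * (if m = s\<^sup>2 then 1 else 0)" for s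
      proof -
        have "((-1) ^ s * fps_X ^ s\<^sup>2 :: int fps) = fps_const ((-1) ^ s) * fps_X ^ s\<^sup>2"
          by (simp flip: fps_const_power fps_const_neg)
        \<comment> \<open>A number and its square have the same parity, so the sign in the finite
          identity depends only on the exponent and is the one that \<open>alternate\<close>
          produces.\<close>
        moreover have "(-1 :: int) ^ s = (-1) ^ (s\<^sup>2)" by (simp add: minus_one_power_iff)
        ultimately show ?thesis by simp
      qed
      have "(1 + 2 * (\<Sum>s=1..n. (-1) ^ s * fps_X ^ s\<^sup>2) :: int fps) $ m =
          (if m = 0 then 1 else 0) + 2 * (\<Sum>s=1..n. (-1) ^ m * (if m = s\<^sup>2 then 1 else 0))"
        by (simp add: fps_sum_nth coeff numeral_fps_const)
      also have "\<dots> = (-1) ^ m * int (card {x. square_nat x = m})"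
        unfolding card_squares[OF \<open>m \<le> n\<close>] by (simp add: sum_distrib_left algebra_simps)
      finally show "(1 + 2 * (\<Sum>s=1..n. (-1) ^ s * fps_X ^ s\<^sup>2) :: int fps) $ m =
          alternate (counting square_nat) $ m"
        by (simp add: alternate_def counting_def)
    qed
    show "partition_fps overpartition_weight n * (\<Prod>k=1..n. 1 - fps_X ^ k) = (\<Prod>k=1..n. 1 + fps_X ^ k)"
      by (rule partition_fps_overpartition)
    show "fps_X ^ Suc n dvd (\<Prod>k=1..n. 1 + fps_X ^ k) * (1 + 2 * (\<Sum>s=1..n. (-1) ^ s * fps_X ^ s\<^sup>2)) -
        (\<Prod>k=1..n. 1 - fps_X ^ k :: int fps)"
      unfolding shanks_squares
      using dvd_sum_minus_first[of "fps_X ^ Suc n" fps_X "Suc n"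
          "\<lambda>s. (-1) ^ s * (\<Prod>k=Suc s..n. 1 - fps_X ^ k) * (\<Prod>k<s. 1 + fps_X ^ k) :: int fps" n]
      by simp
    show "(\<Prod>k=1..n. 1 - fps_X ^ k :: int fps) $ 0 = 1"
      by (rule prod_nth_0) simp
  qed
  from arg_cong[OF this, of alternate] show ?thesis by (simp add: alternate_mult)
qed


section \<open>Triangular numbers indexed by all integers\<close>

lemma tri_int_int: "tri_int (int s) = tri s"
proof -
  have "2 * tri s = s * (s + 1)" by (induction s) (simp_all add: tri_simps)
  then have "2 * int (tri_int (int s)) = 2 * int (tri s)"
    unfolding int_tri_int by (metis of_nat_1 of_nat_add of_nat_mult of_nat_numeral)
  then show ?thesis by simp
qed

lemma tri_int_reflect: "tri_int (- 1 - x) = tri_int x"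
proof -
  have "2 * int (tri_int (- 1 - x)) = 2 * int (tri_int x)"
    unfolding int_tri_int by (simp add: algebra_simps)
  then show ?thesis by simp
qed

lemma le_tri: "s \<le> tri s"
  by (induction s) (simp_all add: tri_simps)

text \<open>The reflection x \<mapsto> -1 - x preserves triangular numbers, exchanges negative and
  nonnegative integers, and has no fixed point.\<close>

lemma counting_tri_int: "counting tri_int = fps_const 2 * counting tri"
proof (rule fps_ext)
  fix m
  let ?S = "{s. tri s = m}"
  have "finite ?S"
    by (rule finite_subset[of _ "{..m}"]) (use le_tri in auto)
  have "{x. tri_int x = m} = int ` ?S \<union> (\<lambda>s. - 1 - int s) ` ?S"
  proof (intro equalityI subsetI)
    fix x assume x: "x \<in> {x. tri_int x = m}"
    show "x \<in> int ` ?S \<union> (\<lambda>s. - 1 - int s) ` ?S"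
    proof (cases "0 \<le> x")
      case True
      then obtain s where "x = int s" by (rule nonneg_int_cases)
      with x show ?thesis by (auto simp: tri_int_int)
    next
      case False
      then have "0 \<le> - 1 - x" by simp
      then obtain s where s: "- 1 - x = int s" by (rule nonneg_int_cases)
      then have "tri s = m" using x tri_int_reflect[of x] tri_int_int[of s] by simp
      moreover have "x = - 1 - int s" using s by simp
      ultimately show ?thesis by blast
    qed
  qed (auto simp: tri_int_int tri_int_reflect)
  moreover have "int ` ?S \<inter> (\<lambda>s. - 1 - int s) ` ?S = {}" by auto
  ultimately have "card {x. tri_int x = m} = card (int ` ?S) + card ((\<lambda>s. - 1 - int s) ` ?S)"
    using \<open>finite ?S\<close> by (simp add: card_Un_disjoint)
  also have "\<dots> = 2 * card ?S"
    by (simp add: card_image inj_on_def)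
  finally show "counting tri_int $ m = (fps_const 2 * counting tri) $ m"
    by (simp add: counting_def)
qed

text \<open>The finite identity is used at \<open>q = - fps_X\<close>: odd powers change sign, which
  turns its factors into those of the \<open>pod\<close> product.\<close>

lemma pod_fps_gauss: "alternate pod_fps * counting tri_int = fps_const 2"
proof -
  have minus_X_even: "(- fps_X :: int fps) ^ (2 * k) = fps_X ^ (2 * k)" for k
    by simp
  have minus_X_odd: "1 - (- fps_X :: int fps) ^ (2 * k + 1) = 1 + fps_X ^ (2 * k + 1)" for k
    by simp
  have "pod_fps * alternate (counting tri) = 1"
  proof (rule gauss_truncation)
    fix n
    \<comment> \<open>The stage is \<open>Suc n\<close>, since at stage 0 the right-hand sum of the
      finite identity is empty and has no term at \<open>s = 0\<close>.\<close>
    show "agree n (partition_fps pod_weight (2 * Suc n)) pod_fps"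
      by (auto simp: agree_def pod_fps_def intro!: partition_fps_pod_nth)
    show "agree n (\<Sum>s<2 * Suc n. (- fps_X) ^ tri s) (alternate (counting tri))"
      unfolding agree_def
    proof (intro allI impI)
      fix m assume "m \<le> n"
      have coeff: "((- fps_X) ^ k :: int fps) $ m = (if m = k then (-1) ^ m else 0)" for k
      proof -
        have "(- fps_X :: int fps) ^ k = fps_const ((-1) ^ k) * fps_X ^ k"
          unfolding power_minus[of fps_X] by (simp flip: fps_const_power fps_const_neg)
        then show ?thesis by simp
      qed
      have "{s. tri s = m} = {s \<in> {..<2 * Suc n}. m = tri s}"
      proof -
        have "s < 2 * Suc n" if "tri s = m" for s
          using that le_tri[of s] \<open>m \<le> n\<close> by simp
        then show ?thesis by auto
      qed
      then have "alternate (counting tri) $ m = (\<Sum>s\<in>{s \<in> {..<2 * Suc n}. m = tri s}. (-1) ^ m)"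
        by (simp only: alternate_def counting_def fps_nth_Abs_fps sum_constant mult.commute)
      also have "\<dots> = (\<Sum>s<2 * Suc n. if m = tri s then (-1) ^ m else 0)"
        by (rule sum.inter_filter) simp
      finally show "(\<Sum>s<2 * Suc n. (- fps_X) ^ tri s :: int fps) $ m = alternate (counting tri) $ m"
        by (simp only: fps_sum_nth coeff)
    qed
    show "partition_fps pod_weight (2 * Suc n) * (\<Prod>k=1..Suc n. 1 - fps_X ^ (2 * k)) =
        (\<Prod>k<Suc n. 1 + fps_X ^ (2 * k + 1))"
      by (rule partition_fps_pod)
    have "fps_X ^ Suc n dvd (- fps_X :: int fps) ^ (2 * Suc n + 1)"
      unfolding power_minus[of fps_X] by (intro dvd_mult le_imp_power_dvd) simp
    from dvd_sum_minus_first[OF this, of "\<lambda>s. (\<Prod>k=Suc s..Suc n. 1 - (- fps_X) ^ (2 * k)) *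
        (\<Prod>k<s. 1 - (- fps_X) ^ (2 * k + 1))" n]
    show "fps_X ^ Suc n dvd (\<Prod>k<Suc n. 1 + fps_X ^ (2 * k + 1)) * (\<Sum>s<2 * Suc n. (- fps_X) ^ tri s) -
        (\<Prod>k=1..Suc n. 1 - fps_X ^ (2 * k) :: int fps)"
      unfolding minus_X_odd[symmetric] shanks_triangles unfolding minus_X_even
      by (simp only: lessThan_Suc_atMost lessThan_0 prod.empty mult_1_right One_nat_def)
    show "(\<Prod>k=1..Suc n. 1 - fps_X ^ (2 * k) :: int fps) $ 0 = 1"
      by (rule prod_nth_0) simp
  qed
  then have "alternate pod_fps * counting tri = 1"
    by (metis alternate_1 alternate_alternate alternate_mult)
  then show ?thesis unfolding counting_tri_int by (metis mult.left_commute mult_1_right)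
qed

section \<open>Reduction to a ternary form\<close>

definition ternary :: "nat \<Rightarrow> nat" where
  "ternary n = card {(x :: int, y :: int, z :: int). x\<^sup>2 + y\<^sup>2 + 3 * z\<^sup>2 = int n}"

definition ternary_tri :: "nat \<Rightarrow> nat" where
  "ternary_tri n = card {(x, y, z). tri_int x + tri_int y + 3 * tri_int z = n}"

text \<open>-1 is a nonresidue modulo 3. This is what confines a prescribed residue class of
  exponents of a squared theta series to arguments in a single class modulo 3.\<close>

lemma mod_3_sum_squares:
  fixes x y :: int
  assumes "3 dvd x\<^sup>2 + y\<^sup>2"
  shows "3 dvd x" "3 dvd y"
proof -
  have "x mod 3 = 0 \<or> x mod 3 = 1 \<or> x mod 3 = 2" "y mod 3 = 0 \<or> y mod 3 = 1 \<or> y mod 3 = 2" by auto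
  moreover have "((x mod 3)\<^sup>2 + (y mod 3)\<^sup>2) mod 3 = 0"
  proof -
    have "((x mod 3)\<^sup>2 mod 3 + (y mod 3)\<^sup>2 mod 3) mod 3 = (x\<^sup>2 mod 3 + y\<^sup>2 mod 3) mod 3"
      by (simp only: power_mod)
    then have "((x mod 3)\<^sup>2 + (y mod 3)\<^sup>2) mod 3 = (x\<^sup>2 + y\<^sup>2) mod 3" by (simp only: mod_add_eq)
    then show ?thesis using assms by simp
  qed
  ultimately have "x mod 3 = 0 \<and> y mod 3 = 0" by auto
  then show "3 dvd x" "3 dvd y" by auto
qed

lemma counting_nth: "counting f $ n = int (card {x. f x = n})"
  by (simp add: counting_def)

text \<open>\<open>h\<close> parametrizes the only arguments that reach the residue class:
  \<open>3 * x\<close> for squares, \<open>3 * x + 1\<close> for triangular numbers. It multiplies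
  \<open>f\<close> by 9, up to the shift that accounts for \<open>r\<close>, and the extraction
  removes one factor 3.\<close>

lemma extract3_square_counting:
  assumes fin: "finite_fibres f"
    and inj: "inj h"
    and iff: "\<And>x y n. f x + f y = 3 * n + r \<longleftrightarrow> (\<exists>x' y'. x = h x' \<and> y = h y' \<and> 3 * f x' + 3 * f y' = n)"
  shows "extract3 r ((counting f)\<^sup>2) = (dilate3 (counting f))\<^sup>2"
proof (rule fps_ext)
  fix n
  have "{z. (\<lambda>(x, y). f x + f y) z = 3 * n + r} = map_prod h h ` {z. (\<lambda>(x, y). 3 * f x + 3 * f y) z = n}"
  proof (intro equalityI subsetI)
    fix z assume z: "z \<in> {z. (\<lambda>(x, y). f x + f y) z = 3 * n + r}"
    obtain x y where xy: "z = (x, y)" by (cases z)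
    obtain x' y' where "x = h x'" "y = h y'" "3 * f x' + 3 * f y' = n"
      using iff[of x y n] z by (auto simp: xy)
    then have "z = map_prod h h (x', y')" "(x', y') \<in> {z. (\<lambda>(x, y). 3 * f x + 3 * f y) z = n}"
      by (simp_all add: xy)
    then show "z \<in> map_prod h h ` {z. (\<lambda>(x, y). 3 * f x + 3 * f y) z = n}" by (rule image_eqI)
  next
    fix z assume "z \<in> map_prod h h ` {z. (\<lambda>(x, y). 3 * f x + 3 * f y) z = n}"
    then obtain x' y' where z: "z = (h x', h y')" and n: "3 * f x' + 3 * f y' = n" by auto
    have "f (h x') + f (h y') = 3 * n + r" unfolding iff using n by blast
    then show "z \<in> {z. (\<lambda>(x, y). f x + f y) z = 3 * n + r}" by (simp add: z)
  qed
  moreover have "inj_on (map_prod h h) A" for A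
    using inj by (auto simp: inj_on_def map_prod_def)
  ultimately have "card {z. (\<lambda>(x, y). f x + f y) z = 3 * n + r} = card {z. (\<lambda>(x, y). 3 * f x + 3 * f y) z = n}"
    by (simp add: card_image)
  then show "extract3 r ((counting f)\<^sup>2) $ n = (dilate3 (counting f))\<^sup>2 $ n"
    using counting_mult(1)[OF fin fin]
      counting_mult(1)[OF finite_fibres_mult3[OF fin] finite_fibres_mult3[OF fin]]
    by (simp add: power2_eq_square dilate3_counting extract3_def counting_nth)
qed

lemma extract3_square_nat: "extract3 0 ((counting square_nat)\<^sup>2) = (dilate3 (counting square_nat))\<^sup>2"
proof (rule extract3_square_counting[OF finite_fibres_square_nat])
  show "inj ((*) (3 :: int))" by (simp add: inj_on_def)
  fix x y n
  have nat_iff: "square_nat x + square_nat y = 3 * n + 0 \<longleftrightarrow> x\<^sup>2 + y\<^sup>2 = 3 * int n"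
    by (simp flip: of_nat_eq_iff[where ?'a = int] add: int_square_nat)
  have nat_iff': "3 * square_nat x + 3 * square_nat y = n \<longleftrightarrow> 3 * x\<^sup>2 + 3 * y\<^sup>2 = int n" for x y
    by (simp flip: of_nat_eq_iff[where ?'a = int] add: int_square_nat)
  show "square_nat x + square_nat y = 3 * n + 0 \<longleftrightarrow>
      (\<exists>x' y'. x = 3 * x' \<and> y = 3 * y' \<and> 3 * square_nat x' + 3 * square_nat y' = n)"
    unfolding nat_iff nat_iff'
  proof
    assume eq: "x\<^sup>2 + y\<^sup>2 = 3 * int n"
    then have "3 dvd x\<^sup>2 + y\<^sup>2" by simp
    from mod_3_sum_squares[OF this] obtain x' y' where "x = 3 * x'" "y = 3 * y'" by (metis dvdE)
    then show "\<exists>x' y'. x = 3 * x' \<and> y = 3 * y' \<and> 3 * x'\<^sup>2 + 3 * y'\<^sup>2 = int n" using eq by auto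
  qed auto
qed

text \<open>Since 8 times a triangular number plus 1 is \<open>(2 * x + 1)^2\<close>, the residue 2
  becomes a sum of two squares divisible by 3, which forces \<open>x = 3 * x' + 1\<close>. The
  triangular number of \<open>x\<close> is then 9 times that of \<open>x'\<close>, plus 1.\<close>

lemma extract3_tri_int: "extract3 2 ((counting tri_int)\<^sup>2) = (dilate3 (counting tri_int))\<^sup>2"
proof (rule extract3_square_counting[OF finite_fibres_tri_int])
  show "inj (\<lambda>x :: int. 3 * x + 1)" by (simp add: inj_on_def)
  fix x y n
  have tri: "8 * int (tri_int x) = (2 * x + 1)\<^sup>2 - 1" for x
    using int_tri_int[of x] by (simp add: power2_eq_square algebra_simps)
  have nat_iff: "tri_int x + tri_int y = 3 * n + 2 \<longleftrightarrow> (2 * x + 1)\<^sup>2 + (2 * y + 1)\<^sup>2 = 24 * int n + 18"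
    using tri[of x] tri[of y] by linarith
  have nat_iff': "3 * tri_int x + 3 * tri_int y = n \<longleftrightarrow>
      3 * (2 * x + 1)\<^sup>2 + 3 * (2 * y + 1)\<^sup>2 = 8 * int n + 6" for x y
    using tri[of x] tri[of y] by linarith
  have scale: "(2 * (3 * x + 1) + 1)\<^sup>2 = 9 * (2 * x + 1)\<^sup>2" for x :: int
    by (simp add: power2_eq_square algebra_simps)
  show "tri_int x + tri_int y = 3 * n + 2 \<longleftrightarrow>
      (\<exists>x' y'. x = 3 * x' + 1 \<and> y = 3 * y' + 1 \<and> 3 * tri_int x' + 3 * tri_int y' = n)"
    unfolding nat_iff nat_iff'
  proof
    assume eq: "(2 * x + 1)\<^sup>2 + (2 * y + 1)\<^sup>2 = 24 * int n + 18"
    then have "3 dvd (2 * x + 1)\<^sup>2 + (2 * y + 1)\<^sup>2" by simp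
    then have "3 dvd 2 * x + 1" "3 dvd 2 * y + 1" by (rule mod_3_sum_squares)+
    then have "3 dvd x - 1" "3 dvd y - 1" by presburger+
    then obtain x' y' where xy: "x = 3 * x' + 1" "y = 3 * y' + 1" by (metis diff_eq_eq dvdE)
    have "9 * (2 * x' + 1)\<^sup>2 + 9 * (2 * y' + 1)\<^sup>2 = 24 * int n + 18"
      using eq unfolding xy scale .
    with xy show "\<exists>x' y'. x = 3 * x' + 1 \<and> y = 3 * y' + 1 \<and>
        3 * (2 * x' + 1)\<^sup>2 + 3 * (2 * y' + 1)\<^sup>2 = 8 * int n + 6"
      by (intro exI conjI) (assumption | linarith)+
  next
    assume "\<exists>x' y'. x = 3 * x' + 1 \<and> y = 3 * y' + 1 \<and>
        3 * (2 * x' + 1)\<^sup>2 + 3 * (2 * y' + 1)\<^sup>2 = 8 * int n + 6"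
    then obtain x' y' where xy: "x = 3 * x' + 1" "y = 3 * y' + 1"
      and eq: "3 * (2 * x' + 1)\<^sup>2 + 3 * (2 * y' + 1)\<^sup>2 = 8 * int n + 6" by blast
    show "(2 * x + 1)\<^sup>2 + (2 * y + 1)\<^sup>2 = 24 * int n + 18"
      unfolding xy scale using eq by linarith
  qed
qed

lemma square_times_dilate3_nth:
  assumes fin: "finite_fibres f"
  shows "((counting f)\<^sup>2 * dilate3 (counting f)) $ n = int (card {(x, y, z). f x + f y + 3 * f z = n})"
proof -
  note step1 = counting_mult[OF fin finite_fibres_mult3[OF fin]]
  note step2 = counting_mult[OF fin step1(2)]
  have "(counting f)\<^sup>2 * dilate3 (counting f) = counting f * (counting f * counting (\<lambda>x. 3 * f x))"
    by (simp add: dilate3_counting power2_eq_square mult.assoc)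
  also have "\<dots> = counting (\<lambda>(x, p). f x + (case p of (y, z) \<Rightarrow> f y + 3 * f z))"
    unfolding step1 step2 ..
  finally show ?thesis
    by (simp add: counting_nth) (rule arg_cong[where f = card], auto)
qed

lemma theta_ternary: "((counting square_nat)\<^sup>2 * dilate3 (counting square_nat)) $ n = int (ternary n)"
proof -
  have "square_nat x + square_nat y + 3 * square_nat z = n \<longleftrightarrow> x\<^sup>2 + y\<^sup>2 + 3 * z\<^sup>2 = int n" for x y z
    by (simp flip: of_nat_eq_iff[where ?'a = int] add: int_square_nat)
  then show ?thesis
    unfolding square_times_dilate3_nth[OF finite_fibres_square_nat] ternary_def by simp
qed

lemma theta_r5: "(counting square_nat ^ 5) $ n = int (r5 n)"
proof -
  note fin = finite_fibres_square_nat
  note s2 = counting_mult[OF fin fin]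
  note s3 = counting_mult[OF fin s2(2)]
  note s4 = counting_mult[OF fin s3(2)]
  note s5 = counting_mult[OF fin s4(2)]
  have iff: "square_nat a + (square_nat b + (square_nat c + (square_nat d + square_nat e))) = n \<longleftrightarrow>
      a\<^sup>2 + b\<^sup>2 + c\<^sup>2 + d\<^sup>2 + e\<^sup>2 = int n" for a b c d e
    by (simp flip: of_nat_eq_iff[where ?'a = int] add: int_square_nat add.assoc)
  have pow: "counting square_nat ^ 5 = counting square_nat *
      (counting square_nat * (counting square_nat * (counting square_nat * counting square_nat)))"
    by (simp add: eval_nat_numeral)
  show ?thesis
    unfolding pow s2(1) s3(1) s4(1) s5(1) r5_def counting_nth
    by (rule arg_cong[where f = "\<lambda>A. int (card A)"]) (auto simp: iff int_square_nat add.assoc)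
qed

lemma r5_cong_ternary: "[int (r5 n) = int (ternary n)] (mod 3)"
proof -
  let ?T = "counting square_nat"
  have "?T ^ 5 - ?T\<^sup>2 * dilate3 ?T = ?T\<^sup>2 * (?T ^ 3 - dilate3 ?T)"
    by (simp add: right_diff_distrib flip: power_add)
  then have "fps_const 3 dvd ?T ^ 5 - ?T\<^sup>2 * dilate3 ?T"
    using cube_cong_dilate3 by simp
  then have "3 dvd (?T ^ 5 - ?T\<^sup>2 * dilate3 ?T) $ n"
    by (simp only: const_dvd_fps_iff)
  then show ?thesis
    by (simp add: cong_iff_dvd_diff theta_r5 theta_ternary)
qed

lemma overpartitions_cong_ternary:
  "[(-1) ^ n * int (num_overpartitions (3 * n)) = int (ternary n)] (mod 3)"
proof -
  have "3 dvd extract3 0 (alternate overpartition_fps) $ n - 1 * ((counting square_nat)\<^sup>2 * dilate3 (counting square_nat)) $ n"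
    by (rule extract3_cong) (simp_all add: overpartition_fps_gauss extract3_square_nat)
  moreover have "(-1 :: int) ^ (3 * n) = (-1) ^ n" by (simp add: minus_one_power_iff)
  ultimately show ?thesis
    by (simp add: cong_iff_dvd_diff theta_ternary extract3_def alternate_def overpartition_fps_def)
qed

lemma pod_cong_ternary_tri:
  "[(-1) ^ n * int (pod (3 * n + 2)) = 2 * int (ternary_tri n)] (mod 3)"
proof -
  have "3 dvd extract3 2 (alternate pod_fps) $ n - 2 * ((counting tri_int)\<^sup>2 * dilate3 (counting tri_int)) $ n"
    by (rule extract3_cong) (simp_all add: pod_fps_gauss extract3_tri_int)
  moreover have "(-1 :: int) ^ (3 * n + 2) = (-1) ^ n" by (simp add: minus_one_power_iff)
  ultimately show ?thesis
    unfolding square_times_dilate3_nth[OF finite_fibres_tri_int]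
    by (simp add: cong_iff_dvd_diff ternary_tri_def extract3_def alternate_def pod_fps_def)
qed

section \<open>The quaternion order\<close>

text \<open>\<open>Quat x y z w\<close> stands for \<open>x + y \<omega> + i (z + w \<omega>)\<close> with \<open>i\<^sup>2 = -1\<close>, \<open>\<omega>\<^sup>2 = \<omega> - 1\<close>,
  \<open>\<omega> i = i (1 - \<omega>)\<close>. With \<open>j = 2 \<omega> - 1\<close>, the lattice \<open>suborder\<close> below is spanned by \<open>1, i, j, i j\<close>.\<close>

datatype quat = Quat (qx: int) (qy: int) (qz: int) (qw: int)

instantiation quat :: ring_1
begin

definition "0 = Quat 0 0 0 0"
definition "1 = Quat 1 0 0 0"
definition "p + q = Quat (qx p + qx q) (qy p + qy q) (qz p + qz q) (qw p + qw q)"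
definition "p - q = Quat (qx p - qx q) (qy p - qy q) (qz p - qz q) (qw p - qw q)"
definition "- p = Quat (- qx p) (- qy p) (- qz p) (- qw p)"
definition "p * q = Quat
  (qx p * qx q - qy p * qy q - (qz p * qz q + qw p * qz q + qw p * qw q))
  (qx p * qy q + qy p * qx q + qy p * qy q - (qz p * qw q - qw p * qz q))
  (qx p * qz q + qy p * qz q + qy p * qw q + (qz p * qx q - qw p * qy q))
  (qx p * qw q - qy p * qz q + (qz p * qy q + qw p * qx q + qw p * qy q))"

instance
  by standard
    (simp_all add: zero_quat_def one_quat_def plus_quat_def minus_quat_def uminus_quat_def
      times_quat_def algebra_simps)

end

text \<open>The ring is not commutative: \<open>g dvd a\<close> means that \<open>a\<close> lies in
  the right ideal generated by \<open>g\<close>. For the central elements \<open>of_int n\<close>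
  the side does not matter.\<close>

instance quat :: Rings.dvd ..

lemmas quat_defs = zero_quat_def one_quat_def plus_quat_def minus_quat_def uminus_quat_def
  times_quat_def

definition qconj :: "quat \<Rightarrow> quat" where
  "qconj p = Quat (qx p + qy p) (- qy p) (- qz p) (- qw p)"

definition qnorm :: "quat \<Rightarrow> int" where
  "qnorm p = (qx p)\<^sup>2 + qx p * qy p + (qy p)\<^sup>2 + (qz p)\<^sup>2 + qz p * qw p + (qw p)\<^sup>2"

definition qtrace :: "quat \<Rightarrow> int" where
  "qtrace p = 2 * qx p + qy p"

definition suborder :: "quat set" where
  "suborder = {p. even (qy p) \<and> even (qw p)}"

lemma of_nat_quat: "of_nat n = Quat (int n) 0 0 0"
  by (induction n) (simp_all add: quat_defs)

lemma of_int_quat: "of_int n = Quat n 0 0 0"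
  by (cases n) (simp_all add: of_nat_quat quat_defs)

lemma of_int_mult_quat: "of_int n * p = Quat (n * qx p) (n * qy p) (n * qz p) (n * qw p)"
  by (simp add: of_int_quat times_quat_def)

lemma of_int_quat_commute: "p * of_int n = of_int n * (p :: quat)"
  by (simp add: of_int_quat times_quat_def)

lemma of_int_dvd_quat_iff:
  "of_int n dvd p \<longleftrightarrow> n dvd qx p \<and> n dvd qy p \<and> n dvd qz p \<and> n dvd qw p"
proof
  assume "n dvd qx p \<and> n dvd qy p \<and> n dvd qz p \<and> n dvd qw p"
  then obtain a b c d where "qx p = n * a" "qy p = n * b" "qz p = n * c" "qw p = n * d"
    by (elim conjE dvdE)
  then have "p = of_int n * Quat a b c d"
    by (simp add: of_int_mult_quat quat.expand)
  then show "of_int n dvd p" by (rule dvdI)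
qed (auto simp: of_int_mult_quat)

lemma of_int_mult_quat_cancel: "n \<noteq> 0 \<Longrightarrow> of_int n * p = of_int n * q \<longleftrightarrow> p = (q :: quat)"
  by (auto simp: of_int_mult_quat quat.expand)

lemma qconj_mult: "qconj (p * q) = qconj q * qconj p"
  by (simp add: qconj_def times_quat_def algebra_simps)

lemma qconj_of_int [simp]: "qconj (of_int n) = of_int n"
  by (simp add: qconj_def of_int_quat)

lemma qconj_diff: "qconj (p - q) = qconj p - qconj q"
  by (simp add: qconj_def minus_quat_def)

lemma qconj_qconj [simp]: "qconj (qconj p) = p"
  by (simp add: qconj_def quat.expand)

lemma qconj_eq_uminus_iff: "qconj p = - p \<longleftrightarrow> qtrace p = 0"
  by (auto simp: qconj_def qtrace_def uminus_quat_def)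

lemma mult_qconj: "p * qconj p = of_int (qnorm p)"
  by (simp add: of_int_quat qconj_def times_quat_def qnorm_def algebra_simps power2_eq_square)

lemma qconj_mult_self: "qconj p * p = of_int (qnorm p)"
  by (simp add: of_int_quat qconj_def times_quat_def qnorm_def algebra_simps power2_eq_square)

lemma qnorm_mult: "qnorm (p * q) = qnorm p * qnorm q"
  by (simp add: times_quat_def qnorm_def algebra_simps power2_eq_square)

lemma qnorm_of_int [simp]: "qnorm (of_int n) = n\<^sup>2"
  by (simp add: of_int_quat qnorm_def)

lemma qnorm_qconj [simp]: "qnorm (qconj p) = qnorm p"
  by (simp add: qconj_def qnorm_def algebra_simps power2_eq_square)

lemma four_qnorm: "4 * qnorm p = (2 * qx p + qy p)\<^sup>2 + 3 * (qy p)\<^sup>2 + (2 * qz p + qw p)\<^sup>2 + 3 * (qw p)\<^sup>2"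
  by (simp add: qnorm_def algebra_simps power2_eq_square)

lemma qnorm_nonneg: "0 \<le> qnorm p"
proof -
  have "0 \<le> 4 * qnorm p" unfolding four_qnorm by simp
  then show ?thesis by simp
qed

lemma qnorm_eq_0_iff: "qnorm p = 0 \<longleftrightarrow> p = 0"
proof
  assume "qnorm p = 0"
  then have "(2 * qx p + qy p)\<^sup>2 + 3 * (qy p)\<^sup>2 + (2 * qz p + qw p)\<^sup>2 + 3 * (qw p)\<^sup>2 = 0"
    by (simp flip: four_qnorm)
  moreover have "0 \<le> (2 * qx p + qy p)\<^sup>2" "0 \<le> (qy p)\<^sup>2" "0 \<le> (2 * qz p + qw p)\<^sup>2" "0 \<le> (qw p)\<^sup>2"
    by simp_all
  ultimately have "(qy p)\<^sup>2 = 0" "(qw p)\<^sup>2 = 0" "(2 * qx p + qy p)\<^sup>2 = 0" "(2 * qz p + qw p)\<^sup>2 = 0"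
    by linarith+
  then show "p = 0" by (simp add: zero_quat_def quat.expand)
qed (simp add: qnorm_def zero_quat_def)

lemma qnorm_pos: "p \<noteq> 0 \<Longrightarrow> 0 < qnorm p"
  using qnorm_nonneg[of p] qnorm_eq_0_iff[of p] by linarith

lemma finite_qnorm: "finite {p. qnorm p = m}"
proof -
  have bound: "\<bar>a\<bar> \<le> 4 * m" if "a\<^sup>2 \<le> 4 * m" for a :: int
  proof -
    have "\<bar>a\<bar> \<le> a\<^sup>2"
      using self_le_power[of "\<bar>a\<bar>" 2] by (cases "a = 0") auto
    then show ?thesis using that by linarith
  qed
  have "{p. qnorm p = m} \<subseteq> (\<lambda>(x, y, z, w). Quat x y z w) `
      ({- 8 * m..8 * m} \<times> {- 4 * m..4 * m} \<times> {- 8 * m..8 * m} \<times> {- 4 * m..4 * m})"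
  proof
    fix p assume "p \<in> {p. qnorm p = m}"
    then have eq: "4 * m = (2 * qx p + qy p)\<^sup>2 + 3 * (qy p)\<^sup>2 + (2 * qz p + qw p)\<^sup>2 + 3 * (qw p)\<^sup>2"
      by (simp flip: four_qnorm)
    have "0 \<le> (2 * qx p + qy p)\<^sup>2" "0 \<le> (qy p)\<^sup>2" "0 \<le> (2 * qz p + qw p)\<^sup>2" "0 \<le> (qw p)\<^sup>2"
      by simp_all
    with eq have "(2 * qx p + qy p)\<^sup>2 \<le> 4 * m" "(qy p)\<^sup>2 \<le> 4 * m" "(2 * qz p + qw p)\<^sup>2 \<le> 4 * m"
      "(qw p)\<^sup>2 \<le> 4 * m" by linarith+
    from this[THEN bound]
    have "(qx p, qy p, qz p, qw p) \<in> {- 8 * m..8 * m} \<times> {- 4 * m..4 * m} \<times> {- 8 * m..8 * m} \<times> {- 4 * m..4 * m}"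
      by auto
    then have "(\<lambda>(x, y, z, w). Quat x y z w) (qx p, qy p, qz p, qw p) \<in> (\<lambda>(x, y, z, w). Quat x y z w) `
      ({- 8 * m..8 * m} \<times> {- 4 * m..4 * m} \<times> {- 8 * m..8 * m} \<times> {- 4 * m..4 * m})"
      by (rule imageI)
    then show "p \<in> (\<lambda>(x, y, z, w). Quat x y z w) `
      ({- 8 * m..8 * m} \<times> {- 4 * m..4 * m} \<times> {- 8 * m..8 * m} \<times> {- 4 * m..4 * m})"
      by simp
  qed
  then show ?thesis by (rule finite_subset) simp
qed

lemma quat_mult_cancel_left:
  fixes p q r :: quat
  assumes "p \<noteq> 0" and "p * q = p * r"
  shows "q = r"
proof -
  have "qconj p * (p * q) = qconj p * (p * r)" using assms by simp
  then have "of_int (qnorm p) * q = of_int (qnorm p) * r"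
    by (simp only: mult.assoc[symmetric] qconj_mult_self)
  then show ?thesis using assms(1) of_int_mult_quat_cancel qnorm_eq_0_iff by blast
qed

lemma suborder_mult: "p \<in> suborder \<Longrightarrow> q \<in> suborder \<Longrightarrow> p * q \<in> suborder"
  by (simp add: suborder_def times_quat_def)

lemma suborder_qconj: "p \<in> suborder \<Longrightarrow> qconj p \<in> suborder"
  by (simp add: suborder_def qconj_def)

lemma suborder_of_int_mult: "odd n \<Longrightarrow> of_int n * p \<in> suborder \<longleftrightarrow> p \<in> suborder"
  by (simp add: suborder_def of_int_mult_quat)

text \<open>The plane lattice is cut into equilateral triangles; the barycentric average of the squared
  distances to the three vertices of such a triangle is at most a third of the squared side.\<close>

lemma eisenstein_rounding_triangle:
  fixes r s m :: int
  assumes "0 \<le> r" "0 \<le> s" "r + s \<le> m" "0 < m"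
  shows "\<exists>p q. 3 * ((r - m * p)\<^sup>2 + (r - m * p) * (s - m * q) + (s - m * q)\<^sup>2) \<le> m\<^sup>2"
proof (rule ccontr)
  define f where "f p q = (r - m * p)\<^sup>2 + (r - m * p) * (s - m * q) + (s - m * q)\<^sup>2" for p q
  assume "\<not> ?thesis"
  then have *: "m\<^sup>2 + 1 \<le> 3 * f p q" for p q
    unfolding f_def by (smt (verit))
  have "(m - r - s) * (m\<^sup>2 + 1) \<le> (m - r - s) * (3 * f 0 0)"
    "r * (m\<^sup>2 + 1) \<le> r * (3 * f 1 0)" "s * (m\<^sup>2 + 1) \<le> s * (3 * f 0 1)"
    using * assms by (intro mult_left_mono; simp)+
  then have "m * (m\<^sup>2 + 1) \<le> 3 * ((m - r - s) * f 0 0 + r * f 1 0 + s * f 0 1)"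
    by (simp add: algebra_simps)
  also have "(m - r - s) * f 0 0 + r * f 1 0 + s * f 0 1 = m * (m * (r + s) - r\<^sup>2 - r * s - s\<^sup>2)"
    by (simp add: f_def algebra_simps power2_eq_square)
  finally have "m * (m\<^sup>2 + 1) \<le> m * (3 * (m * (r + s) - r\<^sup>2 - r * s - s\<^sup>2))"
    by (simp add: algebra_simps)
  then have "m\<^sup>2 + 1 \<le> 3 * (m * (r + s) - r\<^sup>2 - r * s - s\<^sup>2)"
    using \<open>0 < m\<close> by simp
  \<comment> \<open>Four times the gap \<open>m^2 - 3 * (m * (r + s) - r^2 - r * s - s^2)\<close> is
    \<open>(2 * m - 3 * (r + s))^2 + 3 * (r - s)^2\<close>; equality would be at the centroid of the
    triangle.\<close>
  moreover have "0 \<le> (2 * m - 3 * (r + s))\<^sup>2" "0 \<le> (r - s)\<^sup>2" by simp_all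
  ultimately show False
    by (simp add: algebra_simps power2_eq_square)
qed

lemma eisenstein_rounding:
  fixes a b m :: int
  assumes "0 < m"
  shows "\<exists>p q. 3 * ((a - m * p)\<^sup>2 + (a - m * p) * (b - m * q) + (b - m * q)\<^sup>2) \<le> m\<^sup>2"
proof -
  define r s where "r = a mod m" and "s = b mod m"
  have rs: "0 \<le> r" "r < m" "0 \<le> s" "s < m" using assms by (simp_all add: r_def s_def)
  have a: "a = m * (a div m) + r" and b: "b = m * (b div m) + s" by (simp_all add: r_def s_def)
  show ?thesis
  proof (cases "r + s \<le> m")
    case True
    obtain p q where "3 * ((r - m * p)\<^sup>2 + (r - m * p) * (s - m * q) + (s - m * q)\<^sup>2) \<le> m\<^sup>2"
      using eisenstein_rounding_triangle[OF rs(1,3) True assms] by blast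
    moreover have "a - m * (a div m + p) = r - m * p" "b - m * (b div m + q) = s - m * q"
      using a b by (simp_all add: distrib_left)
    ultimately show ?thesis by metis
  next
    case False
    \<comment> \<open>The complementary triangle of the parallelogram is carried to the first one by
      the point reflection (r, s) \<mapsto> (m - r, m - s).\<close>
    obtain p q where "3 * (((m - r) - m * p)\<^sup>2 + ((m - r) - m * p) * ((m - s) - m * q) + ((m - s) - m * q)\<^sup>2) \<le> m\<^sup>2"
      using eisenstein_rounding_triangle[of "m - r" "m - s" m] rs False assms by auto
    moreover have "a - m * (a div m + 1 - p) = - ((m - r) - m * p)" "b - m * (b div m + 1 - q) = - ((m - s) - m * q)"
      using a b by (simp_all add: algebra_simps)
    ultimately show ?thesis by (metis minus_mult_minus power2_minus)
  qed
qed

text \<open>The exact quotient is \<open>c / m\<close>. The norm splits orthogonally into two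
  Eisenstein planes; rounding in each leaves an error of at most a third, so the remainder has at
  most two thirds of the norm of \<open>b\<close>.\<close>

lemma quat_division:
  assumes "b \<noteq> 0"
  shows "\<exists>q. qnorm (a - b * q) < qnorm b"
proof -
  define m where "m = qnorm b"
  have m: "0 < m" using assms by (simp add: m_def qnorm_pos)
  define c where "c = qconj b * a"
  obtain x y z w where xy: "3 * ((qx c - m * x)\<^sup>2 + (qx c - m * x) * (qy c - m * y) + (qy c - m * y)\<^sup>2) \<le> m\<^sup>2"
    and zw: "3 * ((qz c - m * z)\<^sup>2 + (qz c - m * z) * (qw c - m * w) + (qw c - m * w)\<^sup>2) \<le> m\<^sup>2"
    using eisenstein_rounding[OF m] by meson
  define q where "q = Quat x y z w"
  have "qconj b * (a - b * q) = c - of_int m * q"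
    by (simp add: c_def m_def right_diff_distrib mult.assoc[symmetric] qconj_mult_self)
  then have "m * qnorm (a - b * q) = qnorm (c - of_int m * q)"
    by (metis m_def qnorm_mult qnorm_qconj)
  moreover have "3 * qnorm (c - of_int m * q) \<le> 2 * m\<^sup>2"
    using xy zw by (simp add: qnorm_def of_int_mult_quat minus_quat_def q_def)
  ultimately have "m * (3 * qnorm (a - b * q)) \<le> m * (2 * m)"
    by (simp add: power2_eq_square)
  then have "3 * qnorm (a - b * q) \<le> 2 * m" using m by simp
  then show ?thesis using m by (intro exI[of _ q]) (simp add: m_def)
qed

lemma right_ideal_principal:
  fixes I :: "quat set"
  assumes "\<And>a b. a \<in> I \<Longrightarrow> b \<in> I \<Longrightarrow> a - b \<in> I" and "\<And>a b. a \<in> I \<Longrightarrow> a * b \<in> I"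
    and "c \<in> I" "c \<noteq> 0"
  obtains g where "g \<in> I" "g \<noteq> 0" "\<And>a. a \<in> I \<Longrightarrow> g dvd a"
proof -
  obtain g where g: "g \<in> I" "g \<noteq> 0" and min: "\<And>b. b \<in> I \<Longrightarrow> b \<noteq> 0 \<Longrightarrow> nat (qnorm g) \<le> nat (qnorm b)"
    using exists_least_iff[of "\<lambda>n. \<exists>b. b \<in> I \<and> b \<noteq> 0 \<and> nat (qnorm b) = n"] assms(3,4)
    by (metis not_le)
  have "g dvd a" if "a \<in> I" for a
  proof -
    obtain q where q: "qnorm (a - g * q) < qnorm g" using quat_division[OF g(2)] by blast
    have "a - g * q \<in> I" using assms(1,2) g(1) that by blast
    with min q have "a - g * q = 0" using qnorm_nonneg by (metis nat_less_eq_zless not_le)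
    then show ?thesis by (metis dvdI eq_iff_diff_eq_0)
  qed
  with g that show ?thesis by blast
qed

text \<open>The units \<open>1\<close>, \<open>\<omega>\<close>, \<open>\<omega>\<^sup>2\<close> represent the cosets of \<open>(suborder / 2)\<^sup>\<times>\<close> in
  \<open>(order / 2)\<^sup>\<times> \<cong> S\<^sub>3\<close>.\<close>

lemma unit_multiple_in_suborder:
  assumes "odd (qnorm p)"
  obtains e where "qnorm e = 1" "p * e \<in> suborder"
proof -
  have "p * Quat 1 0 0 0 \<in> suborder \<or> p * Quat 0 1 0 0 \<in> suborder \<or> p * Quat (-1) 1 0 0 \<in> suborder"
    using assms unfolding suborder_def times_quat_def qnorm_def by auto
  moreover have "qnorm (Quat 1 0 0 0) = 1" "qnorm (Quat 0 1 0 0) = 1" "qnorm (Quat (-1) 1 0 0) = 1"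
    by (simp_all add: qnorm_def)
  ultimately show ?thesis using that by blast
qed

lemma suborder_units: "{e \<in> suborder. qnorm e = 1} = {1, -1, Quat 0 0 1 0, Quat 0 0 (-1) 0}"
proof (intro equalityI subsetI)
  fix e assume e: "e \<in> {e \<in> suborder. qnorm e = 1}"
  then obtain c d where cd: "qy e = 2 * c" "qw e = 2 * d" by (auto simp: suborder_def elim!: evenE)
  define a b where "a = qx e + c" and "b = qz e + d"
  have eq: "a\<^sup>2 + 3 * c\<^sup>2 + b\<^sup>2 + 3 * d\<^sup>2 = 1"
    using e cd by (simp add: a_def b_def qnorm_def algebra_simps power2_eq_square)
  have nn: "0 \<le> a\<^sup>2" "0 \<le> b\<^sup>2" "0 \<le> c\<^sup>2" "0 \<le> d\<^sup>2" by simp_all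
  have "c\<^sup>2 = 0" "d\<^sup>2 = 0" using eq nn by linarith+
  then have cd0: "c = 0" "d = 0" by simp_all
  with eq have sum: "a\<^sup>2 + b\<^sup>2 = 1" by simp
  have "a\<^sup>2 = 0 \<and> b\<^sup>2 = 1 \<or> a\<^sup>2 = 1 \<and> b\<^sup>2 = 0"
  proof (cases "a\<^sup>2 = 0")
    case False
    with nn(1) have "1 \<le> a\<^sup>2" by linarith
    with sum nn(2) have "a\<^sup>2 = 1" "b\<^sup>2 = 0" by linarith+
    then show ?thesis by blast
  qed (use sum in simp)
  then have "a = 0 \<and> (b = 1 \<or> b = -1) \<or> (a = 1 \<or> a = -1) \<and> b = 0"
    by (auto simp: power2_eq_1_iff)
  then show "e \<in> {1, -1, Quat 0 0 1 0, Quat 0 0 (-1) 0}"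
    using cd cd0 by (cases e) (auto simp: a_def b_def one_quat_def uminus_quat_def)
qed (auto simp: suborder_def one_quat_def uminus_quat_def qnorm_def)

lemma card_suborder_units: "card {e \<in> suborder. qnorm e = 1} = 4"
  unfolding suborder_units by (simp add: one_quat_def uminus_quat_def)

definition pure :: "int \<Rightarrow> quat set" where
  "pure m = {p \<in> suborder. qtrace p = 0 \<and> qnorm p = m}"

lemma finite_pure: "finite (pure m)"
  using finite_qnorm[of m] by (rule rev_finite_subset) (auto simp: pure_def)

lemma pure_qconj: "p \<in> pure m \<Longrightarrow> qconj p = - p"
  by (simp add: pure_def qconj_eq_uminus_iff)

section \<open>The action on a plane modulo a prime\<close>

text \<open>The matrices below satisfy the relations of the order modulo \<open>l\<close> exactly
  when the image of \<omega>, which has trace 1, has determinant 1; this is the condition on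
  \<open>u\<close> and \<open>v\<close>.\<close>

locale split_prime =
  fixes l u v :: int
  assumes prime_l: "prime l" and l_gt_3: "3 < l" and split: "l dvd u\<^sup>2 - u + 1 + v\<^sup>2"
begin

text \<open>The images of \<open>\<omega>\<close> and \<open>i\<close> modulo \<open>l\<close> are the matrices with rows \<open>(u, v), (v, 1 - u)\<close>
  and \<open>(0, -1), (1, 0)\<close>.\<close>

definition act :: "quat \<Rightarrow> int \<times> int \<Rightarrow> int \<times> int" where
  "act p g =
    ((qx p + u * qy p - v * qw p) * fst g + (v * qy p - qz p + (u - 1) * qw p) * snd g,
     (v * qy p + qz p + u * qw p) * fst g + (qx p + (1 - u) * qy p + v * qw p) * snd g)"

definition vanishes :: "int \<times> int \<Rightarrow> bool" where
  "vanishes g \<longleftrightarrow> l dvd fst g \<and> l dvd snd g"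

text \<open>A vector that vanishes modulo \<open>l\<close> is parallel to everything, so a line
  killed by a matrix counts among its eigenlines.\<close>

definition parallel :: "int \<times> int \<Rightarrow> int \<times> int \<Rightarrow> bool" where
  "parallel g h \<longleftrightarrow> l dvd fst g * snd h - snd g * fst h"

text \<open>Normalized integer representatives of the points of the projective line over the field
  with \<open>l\<close> elements.\<close>

definition lines :: "(int \<times> int) set" where
  "lines = insert (0, 1) (Pair 1 ` {0..<l})"

lemma odd_l: "odd l"
  using prime_l l_gt_3 prime_odd_int by fastforce

lemma l_dvd_mult: "l dvd a * b \<longleftrightarrow> l dvd a \<or> l dvd b"
  using prime_l by (simp add: prime_dvd_mult_iff)

lemma not_l_dvd_small: "0 < a \<Longrightarrow> a < l \<Longrightarrow> \<not> l dvd a"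
  by (auto dest: zdvd_imp_le)

text \<open>Modulo \<open>l\<close> the map \<open>act\<close> is a ring homomorphism to matrices;
  over the integers its defect is a multiple of \<open>u^2 - u + 1 + v^2\<close>.\<close>

lemma act_mult:
  "fst (act p (act q g)) = fst (act (p * q) g) + (u\<^sup>2 - u + 1 + v\<^sup>2) *
      ((qy p * qy q + qw p * qw q) * fst g - (qw p * qy q - qy p * qw q) * snd g)"
  "snd (act p (act q g)) = snd (act (p * q) g) + (u\<^sup>2 - u + 1 + v\<^sup>2) *
      ((qy p * qy q + qw p * qw q) * snd g + (qw p * qy q - qy p * qw q) * fst g)"
  by (simp_all add: act_def times_quat_def algebra_simps power2_eq_square)

lemma vanishes_act_mult: "vanishes (act (p * q) g) \<longleftrightarrow> vanishes (act p (act q g))"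
  unfolding vanishes_def act_mult using split by (simp add: dvd_add_left_iff)

lemma act_of_int: "act (of_int n) g = (n * fst g, n * snd g)"
  by (simp add: act_def of_int_quat)

lemma vanishes_act_diff: "vanishes (act p g) \<Longrightarrow> vanishes (act q g) \<Longrightarrow> vanishes (act (p - q) g)"
proof -
  have "fst (act (p - q) g) = fst (act p g) - fst (act q g)"
    "snd (act (p - q) g) = snd (act p g) - snd (act q g)"
    by (simp_all add: act_def minus_quat_def algebra_simps)
  then show "vanishes (act p g) \<Longrightarrow> vanishes (act q g) \<Longrightarrow> vanishes (act (p - q) g)"
    by (simp add: vanishes_def)
qed

lemma vanishes_act: "vanishes g \<Longrightarrow> vanishes (act p g)"
  by (simp add: vanishes_def act_def)

lemma vanishes_act_multiple: "of_int l dvd p \<Longrightarrow> vanishes (act p g)"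
  by (auto simp: of_int_dvd_quat_iff vanishes_def act_def)

lemma of_int_l_dvdI:
  assumes "\<And>g. vanishes (act p g)"
  shows "of_int l dvd p"
proof -
  define m11 m12 m21 m22 where "m11 = qx p + u * qy p - v * qw p"
    and "m12 = v * qy p - qz p + (u - 1) * qw p"
    and "m21 = v * qy p + qz p + u * qw p" and "m22 = qx p + (1 - u) * qy p + v * qw p"
  have m: "l dvd m11" "l dvd m21" "l dvd m12" "l dvd m22"
    using assms[of "(1, 0)"] assms[of "(0, 1)"]
    by (simp_all add: vanishes_def act_def m11_def m12_def m21_def m22_def)
  \<comment> \<open>These combinations isolate \<open>qy p\<close> and \<open>qw p\<close> with the
    coefficient \<open>(2 * u - 1)^2 + 4 * v^2\<close>, which is -3 modulo \<open>l\<close>; here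
    \<open>l > 3\<close> allows 3 to be cancelled.\<close>
  have "l dvd (2 * u - 1) * (m11 - m22) + 2 * v * (m12 + m21)"
    "l dvd (2 * u - 1) * (m12 + m21) - 2 * v * (m11 - m22)"
    using m by (auto intro!: dvd_add dvd_diff dvd_mult)
  moreover have "(2 * u - 1) * (m11 - m22) + 2 * v * (m12 + m21) = (u\<^sup>2 - u + 1 + v\<^sup>2) * (4 * qy p) - 3 * qy p"
    "(2 * u - 1) * (m12 + m21) - 2 * v * (m11 - m22) = (u\<^sup>2 - u + 1 + v\<^sup>2) * (4 * qw p) - 3 * qw p"
    by (simp_all add: m11_def m12_def m21_def m22_def algebra_simps power2_eq_square)
  moreover have "l dvd (u\<^sup>2 - u + 1 + v\<^sup>2) * k" for k
    using split by (rule dvd_mult2)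
  ultimately have "l dvd 3 * qy p" "l dvd 3 * qw p"
    by (metis dvd_diff_right_iff)+
  then have yw: "l dvd qy p" "l dvd qw p"
    using l_gt_3 not_l_dvd_small[of 3] by (simp_all add: l_dvd_mult)
  have "m11 + m22 = 2 * qx p + qy p" "m21 - m12 = 2 * qz p + qw p"
    by (simp_all add: m11_def m12_def m21_def m22_def algebra_simps)
  then have "l dvd 2 * qx p + qy p" "l dvd 2 * qz p + qw p"
    using m dvd_add[of l m11 m22] dvd_diff[of l m21 m12] by simp_all
  then have "l dvd 2 * qx p" "l dvd 2 * qz p"
    using yw by (simp_all add: dvd_add_left_iff)
  then have "l dvd qx p" "l dvd qz p"
    using l_gt_3 not_l_dvd_small[of 2] by (simp_all add: l_dvd_mult)
  with yw show ?thesis by (simp add: of_int_dvd_quat_iff)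
qed

lemma l_dvd_qnorm:
  assumes "vanishes (act p g)" "\<not> vanishes g"
  shows "l dvd qnorm p"
proof -
  have "vanishes (act (qconj p * p) g)"
    using assms(1) by (simp add: vanishes_act_mult vanishes_act)
  then have "l dvd qnorm p * fst g" "l dvd qnorm p * snd g"
    by (simp_all add: qconj_mult_self act_of_int vanishes_def)
  then show ?thesis using assms(2) by (auto simp: l_dvd_mult vanishes_def)
qed

text \<open>A matrix that is nonzero modulo \<open>l\<close> has a kernel of dimension at most one:
  by Cramer's rule, two independent kernel vectors would span every \<open>k\<close> up to the unit
  \<open>d\<close>.\<close>

lemma parallel_kernel:
  assumes "\<not> of_int l dvd p" "vanishes (act p g)" "vanishes (act p h)"
  shows "parallel g h"
proof (rule ccontr)
  define d where "d = fst g * snd h - snd g * fst h"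
  assume "\<not> parallel g h"
  then have d: "\<not> l dvd d" by (simp add: parallel_def d_def)
  have "vanishes (act p k)" for k
  proof -
    define a b where "a = fst k * snd h - snd k * fst h" and "b = fst g * snd k - snd g * fst k"
    have "d * fst (act p k) = a * fst (act p g) + b * fst (act p h)"
      "d * snd (act p k) = a * snd (act p g) + b * snd (act p h)"
      by (simp_all add: a_def b_def d_def act_def algebra_simps)
    then have "l dvd d * fst (act p k)" "l dvd d * snd (act p k)"
      using assms(2,3) by (simp_all add: vanishes_def)
    then show ?thesis using d by (simp add: l_dvd_mult vanishes_def)
  qed
  with assms(1) show False using of_int_l_dvdI by blast
qed

lemma parallel_act:
  assumes "parallel g h" "\<not> vanishes g" "vanishes (act p g)"
  shows "vanishes (act p h)"
proof -
  define d where "d = fst g * snd h - snd g * fst h"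
  have d: "l dvd d" using assms(1) by (simp add: parallel_def d_def)
  define m11 m12 m21 m22 where "m11 = qx p + u * qy p - v * qw p"
    and "m12 = v * qy p - qz p + (u - 1) * qw p"
    and "m21 = v * qy p + qz p + u * qw p" and "m22 = qx p + (1 - u) * qy p + v * qw p"
  have eqs: "fst g * fst (act p h) = fst h * fst (act p g) + m12 * d"
    "fst g * snd (act p h) = fst h * snd (act p g) + m22 * d"
    "snd g * fst (act p h) = snd h * fst (act p g) - m11 * d"
    "snd g * snd (act p h) = snd h * snd (act p g) - m21 * d"
    by (simp_all add: act_def d_def m11_def m12_def m21_def m22_def algebra_simps)
  have "l dvd fst g * fst (act p h)" "l dvd fst g * snd (act p h)"
    "l dvd snd g * fst (act p h)" "l dvd snd g * snd (act p h)"
    unfolding eqs using d assms(3) by (simp_all add: vanishes_def)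
  then show ?thesis using assms(2) by (auto simp: l_dvd_mult vanishes_def)
qed

lemma lines_not_vanishes: "L \<in> lines \<Longrightarrow> \<not> vanishes L"
  using l_gt_3 by (auto simp: lines_def vanishes_def)

lemma finite_lines: "finite lines"
  by (simp add: lines_def)

lemma card_lines: "int (card lines) = l + 1"
proof -
  have "card (Pair (1 :: int) ` {0..<l}) = nat l"
    by (subst card_image) (auto simp: inj_on_def)
  moreover have "(0, 1) \<notin> Pair (1 :: int) ` {0..<l}" by auto
  ultimately show ?thesis using l_gt_3 by (simp add: lines_def)
qed

lemma parallel_line_exists:
  assumes "\<not> vanishes g"
  obtains L where "L \<in> lines" "parallel L g"
proof (cases "l dvd fst g")
  case True
  then have "(0, 1) \<in> lines" "parallel (0, 1) g" by (simp_all add: lines_def parallel_def)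
  then show ?thesis by (rule that)
next
  case False
  then have "coprime (fst g) l"
    using prime_l by (metis coprime_commute prime_imp_coprime)
  then obtain x where "[fst g * x = 1] (mod l)"
    using cong_solve_coprime_int by blast
  then have "l dvd fst g * x - 1" by (simp add: cong_iff_dvd_diff)
  then have *: "l dvd (fst g * x - 1) * snd g" by simp
  define t where "t = (x * snd g) mod l"
  have "l dvd x * snd g - t" by (simp add: t_def)
  then have "l dvd fst g * (x * snd g - t)" by simp
  with * have "l dvd fst g * (x * snd g - t) - (fst g * x - 1) * snd g" by (rule dvd_diff[rotated])
  then have "parallel (1, t) g" by (simp add: parallel_def algebra_simps)
  moreover have "(1, t) \<in> lines" using l_gt_3 by (simp add: lines_def t_def)
  ultimately show ?thesis using that by blast
qed

lemma parallel_lines_eq: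
  assumes "L \<in> lines" "L' \<in> lines" "parallel L L'"
  shows "L = L'"
proof -
  have "s = t" if "0 \<le> s" "s < l" "0 \<le> t" "t < l" "l dvd t - s" for s t
    using that by (metis mod_eq_dvd_iff mod_pos_pos_trivial)
  moreover have "\<not> l dvd 1" "\<not> l dvd - 1" using not_l_dvd_small[of 1] l_gt_3 by simp_all
  moreover obtain s where "L = (0, 1) \<or> L = (1, s) \<and> 0 \<le> s \<and> s < l"
    using assms(1) by (auto simp: lines_def)
  moreover obtain t where "L' = (0, 1) \<or> L' = (1, t) \<and> 0 \<le> t \<and> t < l"
    using assms(2) by (auto simp: lines_def)
  ultimately show ?thesis using assms(3) by (elim disjE conjE) (simp_all add: parallel_def)
qed

lemma kernel_line_exists:
  assumes "l dvd qnorm p"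
  obtains L where "L \<in> lines" "vanishes (act p L)"
proof -
  define m11 m12 m21 m22 where m_defs: "m11 = qx p + u * qy p - v * qw p"
    "m12 = v * qy p - qz p + (u - 1) * qw p"
    "m21 = v * qy p + qz p + u * qw p" "m22 = qx p + (1 - u) * qy p + v * qw p"
  have "m11 * m22 - m12 * m21 = qnorm p - (u\<^sup>2 - u + 1 + v\<^sup>2) * ((qy p)\<^sup>2 + (qw p)\<^sup>2)"
    by (simp add: m_defs qnorm_def algebra_simps power2_eq_square)
  then have det: "l dvd m11 * m22 - m12 * m21"
    using assms split by simp
  have act: "act p g = (m11 * fst g + m12 * snd g, m21 * fst g + m22 * snd g)" for g
    by (simp add: act_def m_defs)
  \<comment> \<open>The candidates are the rows turned by a right angle: each is orthogonal to its
    own row and yields the determinant, up to sign, on the other. If both vanish, the matrix is zero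
    modulo \<open>l\<close>.\<close>
  have "\<exists>g. \<not> vanishes g \<and> vanishes (act p g)"
  proof (cases "vanishes (- m12, m11) \<and> vanishes (- m22, m21)")
    case True
    then have "\<not> vanishes (1, 0) \<and> vanishes (act p (1, 0))"
      using not_l_dvd_small[of 1] l_gt_3 by (simp add: vanishes_def act)
    then show ?thesis by blast
  next
    case False
    have "vanishes (act p (- m12, m11))" "vanishes (act p (- m22, m21))"
      using det by (simp_all add: vanishes_def act algebra_simps dvd_diff_commute)
    with False show ?thesis by blast
  qed
  then obtain g where g: "\<not> vanishes g" "vanishes (act p g)" by blast
  obtain L where L: "L \<in> lines" "parallel L g" using parallel_line_exists[OF g(1)] .
  then have "parallel g L" by (simp add: parallel_def dvd_diff_commute mult.commute)
  then have "vanishes (act p L)" using parallel_act g by blast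
  with L that show ?thesis by blast
qed

lemma annihilator_exists:
  assumes "\<not> vanishes g"
  obtains p where "vanishes (act p g)" "\<not> of_int l dvd p"
proof -
  define e f where "e = fst g" and "f = snd g"
  \<comment> \<open>Modulo \<open>l\<close> the matrix of \<open>p\<close> has the rows
    \<open>6 * (f, - e)\<close> and \<open>(0, 0)\<close>; the factor 6 clears the denominators 2
    and 3 that arise on inverting the representation.\<close>
  define a b where "a = (2 * u - 1) * f - 2 * v * e" and "b = (2 * u - 1) * e + 2 * v * f"
  define p where "p = Quat (3 * f + a) (- 2 * a) (3 * e - b) (2 * b)"
  define c where "c = u\<^sup>2 - u + 1 + v\<^sup>2"
  have act: "act p h = (6 * (f * fst h - e * snd h) - 4 * c * (f * fst h - e * snd h),
      4 * c * (e * fst h + f * snd h))" for h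
    by (simp add: act_def p_def a_def b_def c_def algebra_simps power2_eq_square)
  have "vanishes (act p g)"
    using split by (simp add: act vanishes_def c_def[symmetric]) (simp add: e_def f_def)
  moreover have "\<not> of_int l dvd p"
  proof
    assume "of_int l dvd p"
    then have "vanishes (act p (1, 0))" "vanishes (act p (0, 1))"
      by (simp_all add: vanishes_act_multiple)
    then have "l dvd 6 * f - 4 * c * f" "l dvd 4 * c * e - 6 * e"
      by (simp_all add: act vanishes_def)
    then have "l dvd 6 * f" "l dvd 6 * e"
      using split by (simp_all add: c_def[symmetric] dvd_diff_left_iff dvd_diff_right_iff)
    moreover have "\<not> l dvd 6"
      using not_l_dvd_small[of 2] not_l_dvd_small[of 3] l_gt_3 l_dvd_mult[of 2 3] by simp
    ultimately show False using assms by (simp add: l_dvd_mult vanishes_def e_def f_def)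
  qed
  ultimately show ?thesis using that by blast
qed

section \<open>Elements of norm l and the lines they determine\<close>

definition generators :: "quat set" where
  "generators = {a \<in> suborder. qnorm a = l}"

lemma not_l_dvd_generator: "a \<in> generators \<Longrightarrow> \<not> of_int l dvd a"
proof
  assume "a \<in> generators" "of_int l dvd a"
  then obtain b where "a = of_int l * b" and "qnorm a = l" by (auto simp: generators_def)
  then have "l * (l * qnorm b) = l * 1" by (simp add: qnorm_mult power2_eq_square)
  then have "l * qnorm b = 1" using l_gt_3 by simp
  then show False using l_gt_3 by (simp add: zmult_eq_1_iff)
qed

lemma l_dvd_qconj_iff: "of_int l dvd qconj p \<longleftrightarrow> of_int l dvd p"
  by (auto simp: of_int_dvd_quat_iff qconj_def) (metis dvd_add_left_iff)

text \<open>Modulo \<open>l\<close> the element \<open>a\<close> has rank one, and the product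
  \<open>qconj a * a\<close>, which is \<open>l\<close>, puts its image into the kernel of
  \<open>qconj a\<close>, the line \<open>L\<close>. So \<open>p * a\<close> is zero modulo
  \<open>l\<close> exactly when \<open>p\<close> kills \<open>L\<close>.\<close>

lemma l_dvd_mult_generator_iff:
  assumes a: "a \<in> generators" and L: "\<not> vanishes L" "vanishes (act (qconj a) L)"
  shows "of_int l dvd p * a \<longleftrightarrow> vanishes (act p L)"
proof -
  have na: "\<not> of_int l dvd qconj a" using a not_l_dvd_generator l_dvd_qconj_iff by blast
  have "vanishes (act (qconj a) (act a g))" for g
  proof -
    have "vanishes (act (qconj a * a) g)"
      using a by (simp add: qconj_mult_self generators_def act_of_int vanishes_def)
    then show ?thesis by (simp only: vanishes_act_mult)
  qed
  then have par: "parallel L (act a g)" for g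
    using parallel_kernel[OF na] L(2) by blast
  show ?thesis
  proof
    assume p: "of_int l dvd p * a"
    obtain g where g: "\<not> vanishes (act a g)"
      using of_int_l_dvdI not_l_dvd_generator[OF a] by blast
    have "parallel (act a g) L" using par[of g] by (simp add: parallel_def dvd_diff_commute mult.commute)
    moreover have "vanishes (act p (act a g))"
      using vanishes_act_multiple[OF p] by (simp add: vanishes_act_mult)
    ultimately show "vanishes (act p L)" using parallel_act g by blast
  next
    assume "vanishes (act p L)"
    then have "vanishes (act (p * a) g)" for g
      using parallel_act[OF par L(1)] by (simp add: vanishes_act_mult)
    then show "of_int l dvd p * a" by (rule of_int_l_dvdI)
  qed
qed

lemma generator_line_unique:
  assumes "a \<in> generators"
  shows "\<exists>!L. L \<in> lines \<and> vanishes (act (qconj a) L)"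
proof -
  have "l dvd qnorm (qconj a)" using assms by (simp add: generators_def)
  then obtain L where "L \<in> lines" "vanishes (act (qconj a) L)" by (rule kernel_line_exists)
  moreover have "\<not> of_int l dvd qconj a" using assms not_l_dvd_generator l_dvd_qconj_iff by blast
  ultimately show ?thesis using parallel_kernel parallel_lines_eq by (intro ex1I[of _ L]) auto
qed

text \<open>The right ideal of elements whose conjugate kills \<open>L\<close> contains
  \<open>l\<close> and lies strictly between the multiples of \<open>l\<close> and the whole order,
  so its generator has norm \<open>l\<close>; a unit then moves it into
  \<open>suborder\<close>.\<close>

lemma generator_exists:
  assumes L: "\<not> vanishes L"
  obtains a where "a \<in> generators" "vanishes (act (qconj a) L)"
proof -
  define I where "I = {b. vanishes (act (qconj b) L)}"
  obtain b' where "vanishes (act b' L)" "\<not> of_int l dvd b'" by (rule annihilator_exists[OF L])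
  then have b: "qconj b' \<in> I" "\<not> of_int l dvd qconj b'" by (simp_all add: I_def l_dvd_qconj_iff)
  have "(0 :: quat) = of_int l * 0" by simp
  then have "qconj b' \<noteq> 0" using b(2) dvdI by metis
  moreover have diff: "a - b \<in> I" if "a \<in> I" "b \<in> I" for a b
    using that by (simp add: I_def qconj_diff vanishes_act_diff)
  moreover have mult: "a * b \<in> I" if "a \<in> I" for a b
    using that by (simp add: I_def qconj_mult vanishes_act_mult vanishes_act)
  ultimately obtain g where g: "g \<in> I" "g \<noteq> 0" and dvd: "\<And>a. a \<in> I \<Longrightarrow> g dvd a"
    using right_ideal_principal[of I "qconj b'"] b(1) by blast
  have "of_int l \<in> I" by (simp add: I_def act_of_int vanishes_def)
  then obtain c where c: "of_int l = g * c" using dvd by (metis dvdE)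
  have norm: "qnorm g * qnorm c = l\<^sup>2" using c by (metis qnorm_mult qnorm_of_int)
  have "l dvd qnorm (qconj g)" using g(1) L by (intro l_dvd_qnorm[of _ L]) (simp_all add: I_def)
  then obtain k where k: "qnorm g = l * k" by (metis dvdE qnorm_qconj)
  have "l * (k * qnorm c) = l * l" using norm by (simp add: k power2_eq_square)
  then have kc: "k * qnorm c = l" using l_gt_3 by simp
  have k0: "0 < k" using qnorm_pos[OF g(2)] k l_gt_3 by (simp add: zero_less_mult_iff)
  \<comment> \<open>If \<open>c\<close> were a unit, every element of \<open>I\<close> would be a
    multiple of \<open>l\<close>, against the choice of \<open>b'\<close>.\<close>
  have "qnorm c \<noteq> 1"
  proof
    assume "qnorm c = 1"
    then have "c * qconj c = 1" by (simp add: mult_qconj)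
    then have "of_int l * qconj c = g" by (simp add: c mult.assoc)
    moreover obtain d where "qconj b' = g * d" using dvd[OF b(1)] by (metis dvdE)
    ultimately have "qconj b' = of_int l * (qconj c * d)" by (metis mult.assoc)
    then show False using b(2) dvdI by blast
  qed
  moreover have "k = 1 \<or> k = l"
    using prime_l kc k0 by (metis dvd_triv_left prime_int_iff less_imp_le)
  ultimately have "k = 1" using kc l_gt_3 by auto
  then have qg: "qnorm g = l" using k by simp
  then obtain e where e: "qnorm e = 1" "g * e \<in> suborder"
    using unit_multiple_in_suborder[of g] odd_l by auto
  have "g * e \<in> generators" using e qg by (simp add: generators_def qnorm_mult)
  moreover have "vanishes (act (qconj (g * e)) L)" using mult[OF g(1), of e] by (simp add: I_def)
  ultimately show ?thesis by (rule that)
qed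

text \<open>For generators \<open>a0\<close> and \<open>a\<close> over the same line the quotient of
  \<open>qconj a0 * a\<close> by \<open>l\<close> is integral, has norm 1, and stays in
  \<open>suborder\<close> because \<open>l\<close> is odd. The fibre is a coset of the four units of
  \<open>suborder\<close>.\<close>

lemma card_generators_of_line:
  assumes L: "\<not> vanishes L"
  shows "card {a \<in> generators. vanishes (act (qconj a) L)} = 4"
proof -
  obtain a0 where a0: "a0 \<in> generators" "vanishes (act (qconj a0) L)"
    using generator_exists[OF L] by blast
  have "a0 \<noteq> 0" using a0(1) l_gt_3 by (auto simp: generators_def qnorm_eq_0_iff[symmetric])
  have l0: "l \<noteq> 0" using l_gt_3 by simp
  have "{a \<in> generators. vanishes (act (qconj a) L)} = (*) a0 ` {e \<in> suborder. qnorm e = 1}"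
  proof (intro equalityI subsetI)
    fix a assume "a \<in> {a \<in> generators. vanishes (act (qconj a) L)}"
    then have a: "a \<in> generators" "vanishes (act (qconj a) L)" by simp_all
    have "of_int l dvd qconj a0 * a"
      using l_dvd_mult_generator_iff[OF a(1) L a(2)] a0(2) by blast
    then obtain e where e: "qconj a0 * a = of_int l * e" by (elim dvdE)
    have "of_int l * a = a0 * (qconj a0 * a)"
      using a0 by (simp add: mult.assoc[symmetric] mult_qconj generators_def)
    also have "\<dots> = of_int l * (a0 * e)"
      by (simp add: e mult.assoc[symmetric] of_int_quat_commute)
    finally have ae: "a = a0 * e" using l0 by (simp add: of_int_mult_quat_cancel)
    then have "l * qnorm e = l * 1" using a0 a by (simp add: generators_def qnorm_mult)
    then have "qnorm e = 1" using l0 by simp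
    moreover have "e \<in> suborder"
      using e a a0 odd_l suborder_of_int_mult[of l e]
      by (simp add: generators_def suborder_mult suborder_qconj flip: e)
    ultimately show "a \<in> (*) a0 ` {e \<in> suborder. qnorm e = 1}" using ae by blast
  next
    fix a assume "a \<in> (*) a0 ` {e \<in> suborder. qnorm e = 1}"
    then obtain e where a: "a = a0 * e" and e: "e \<in> suborder" "qnorm e = 1" by auto
    have "a \<in> generators" using a0 e by (simp add: a generators_def suborder_mult qnorm_mult)
    moreover have "vanishes (act (qconj a) L)"
      using a0 by (simp add: a qconj_mult vanishes_act_mult vanishes_act)
    ultimately show "a \<in> {a \<in> generators. vanishes (act (qconj a) L)}" by simp
  qed
  moreover have "inj_on ((*) a0) {e \<in> suborder. qnorm e = 1}"
    using quat_mult_cancel_left[OF \<open>a0 \<noteq> 0\<close>] by (auto intro: inj_onI)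
  ultimately show ?thesis using card_suborder_units by (simp add: card_image)
qed

lemma finite_generators: "finite generators"
  using finite_qnorm[of l] by (rule rev_finite_subset) (auto simp: generators_def)

text \<open>Each generator lies over one line, and over each line there are four generators.\<close>

lemma card_generators_with:
  assumes "\<And>a L. a \<in> generators \<Longrightarrow> L \<in> lines \<Longrightarrow> vanishes (act (qconj a) L) \<Longrightarrow> P a \<longleftrightarrow> Q L"
  shows "card {a \<in> generators. P a} = 4 * card {L \<in> lines. Q L}"
proof -
  let ?F = "\<lambda>L. {a \<in> generators. vanishes (act (qconj a) L)}"
  have "{a \<in> generators. P a} = (\<Union>L\<in>{L \<in> lines. Q L}. ?F L)"
  proof (intro equalityI subsetI)
    fix a assume "a \<in> {a \<in> generators. P a}"
    then obtain L where L: "L \<in> lines" "vanishes (act (qconj a) L)" "a \<in> generators" "P a"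
      using generator_line_unique[of a] by auto
    then have "Q L" using assms[OF L(3,1,2)] by simp
    then show "a \<in> (\<Union>L\<in>{L \<in> lines. Q L}. ?F L)" using L by (intro UN_I[of L]) simp_all
  next
    fix a assume "a \<in> (\<Union>L\<in>{L \<in> lines. Q L}. ?F L)"
    then obtain L where L: "L \<in> lines" "Q L" "a \<in> generators" "vanishes (act (qconj a) L)"
      by auto
    then have "P a" using assms[OF L(3,1,4)] by simp
    then show "a \<in> {a \<in> generators. P a}" using L by simp
  qed
  also have "card \<dots> = (\<Sum>L\<in>{L \<in> lines. Q L}. card (?F L))"
  proof (rule card_UN_disjoint)
    show "\<forall>L\<in>{L \<in> lines. Q L}. \<forall>L'\<in>{L \<in> lines. Q L}. L \<noteq> L' \<longrightarrow> ?F L \<inter> ?F L' = {}"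
    proof (intro ballI impI)
      fix L L' assume L: "L \<in> {L \<in> lines. Q L}" "L' \<in> {L \<in> lines. Q L}" "L \<noteq> L'"
      show "?F L \<inter> ?F L' = {}"
      proof (rule equals0I)
        fix a assume "a \<in> ?F L \<inter> ?F L'"
        then show False using L generator_line_unique[of a] by auto
      qed
    qed
  qed (use finite_lines finite_generators in auto)
  also have "\<dots> = (\<Sum>L\<in>{L \<in> lines. Q L}. 4)"
    using card_generators_of_line lines_not_vanishes by (intro sum.cong) auto
  finally show ?thesis by simp
qed

lemma card_generators: "int (card generators) = 4 * (l + 1)"
  using card_generators_with[of "\<lambda>_. True" "\<lambda>_. True"] card_lines by simp

section \<open>The Hecke relation\<close>

lemma not_l_dvd_2: "\<not> l dvd 2"
  using not_l_dvd_small[of 2] l_gt_3 by simp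

lemma residue_eqI:
  assumes "0 \<le> s" "s < l" "0 \<le> t" "t < l" "l dvd s - t"
  shows "s = t"
proof -
  have "s mod l = t mod l" using assms(5) by (simp only: mod_eq_dvd_iff)
  then show ?thesis using assms by simp
qed

lemma linear_congruence_solution:
  assumes "\<not> l dvd a"
  obtains t where "0 \<le> t" "t < l" "l dvd a * t - b"
proof -
  have "coprime a l"
    using prime_imp_coprime[OF prime_l assms] by (simp only: coprime_commute)
  then obtain x where "[a * x = 1] (mod l)"
    using cong_solve_coprime_int by blast
  then have "l dvd a * x - 1" by (simp add: cong_iff_dvd_diff)
  then have "l dvd (a * x - 1) * b" by simp
  moreover have "l dvd a * ((x * b) mod l - x * b)"
    by (rule dvd_mult[OF mod_eq_dvd_iff[THEN iffD1, OF mod_mod_trivial]])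
  ultimately have "l dvd (a * x - 1) * b + a * ((x * b) mod l - x * b)" by (rule dvd_add)
  then have "l dvd a * ((x * b) mod l) - b" by (simp add: algebra_simps)
  moreover have "0 \<le> (x * b) mod l" "(x * b) mod l < l" using l_gt_3 by simp_all
  ultimately show ?thesis using that by blast
qed

lemma card_square_roots: "int (card {s \<in> {0..<l}. l dvd s\<^sup>2 - d}) = 1 + Legendre d l"
proof -
  consider "l dvd d" | "\<not> l dvd d" "QuadRes l d" | "\<not> l dvd d" "\<not> QuadRes l d" by blast
  then show ?thesis
  proof cases
    case 1
    then have "l dvd s\<^sup>2 - d \<longleftrightarrow> l dvd s" for s
      by (simp add: dvd_diff_left_iff l_dvd_mult power2_eq_square)
    moreover have "s = 0" if "0 \<le> s" "s < l" "l dvd s" for s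
      using that not_l_dvd_small[of s] by (cases "s = 0") auto
    ultimately have "{s \<in> {0..<l}. l dvd s\<^sup>2 - d} = {0}"
      using l_gt_3 by auto
    then show ?thesis using 1 by (simp add: Legendre_def cong_0_iff)
  next
    case 2
    then obtain y where "l dvd y\<^sup>2 - d" by (auto simp: QuadRes_def cong_iff_dvd_diff)
    moreover define r where "r = y mod l"
    then have r: "0 \<le> r" "r < l" "l dvd r - y" using l_gt_3 mod_eq_dvd_iff[THEN iffD1, OF mod_mod_trivial] by simp_all
    then have "l dvd (r - y) * (r + y)" by simp
    ultimately have "l dvd (r - y) * (r + y) + (y\<^sup>2 - d)" by (rule dvd_add[rotated])
    then have rd: "l dvd r\<^sup>2 - d" by (simp add: algebra_simps power2_eq_square)
    with 2 have "r \<noteq> 0" by auto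
    have "l dvd (l - r)\<^sup>2 - d"
    proof -
      have "(l - r)\<^sup>2 - d = l * (l - 2 * r) + (r\<^sup>2 - d)" by (simp add: algebra_simps power2_eq_square)
      then show ?thesis using rd by (metis dvd_add dvd_triv_left)
    qed
    moreover have "s = r \<or> s = l - r" if "0 \<le> s" "s < l" "l dvd s\<^sup>2 - d" for s
    proof -
      have "l dvd (s\<^sup>2 - d) - (r\<^sup>2 - d)" by (rule dvd_diff[OF that(3) rd])
      also have "(s\<^sup>2 - d) - (r\<^sup>2 - d) = (s - r) * (s + r)" by (simp add: algebra_simps power2_eq_square)
      finally have "l dvd s - r \<or> l dvd s + r" by (simp add: l_dvd_mult)
      moreover have "s = l - r" if "l dvd s + r"
      proof (rule residue_eqI)
        have "l dvd (s + r) - l" using that by simp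
        then show "l dvd s - (l - r)" by (simp add: algebra_simps)
      qed (use \<open>0 \<le> s\<close> \<open>s < l\<close> r \<open>r \<noteq> 0\<close> in simp_all)
      moreover have "s = r" if "l dvd s - r"
        by (rule residue_eqI) (use that \<open>0 \<le> s\<close> \<open>s < l\<close> r in simp_all)
      ultimately show ?thesis by blast
    qed
    ultimately have "{s \<in> {0..<l}. l dvd s\<^sup>2 - d} = {r, l - r}"
      using r rd \<open>r \<noteq> 0\<close> by auto
    moreover have "r \<noteq> l - r"
    proof
      assume "r = l - r"
      then have "l = 2 * r" by simp
      then show False using odd_l by simp
    qed
    ultimately show ?thesis using 2 by (simp add: Legendre_def cong_0_iff)
  next
    case 3
    have "\<not> l dvd s\<^sup>2 - d" for s
      using 3 by (auto simp: QuadRes_def cong_iff_dvd_diff)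
    then show ?thesis using 3 by (simp add: Legendre_def cong_0_iff)
  qed
qed

text \<open>The form has discriminant \<open>4 * (a^2 + b * c)\<close>. If \<open>b\<close> is a
  unit, all zeros are affine, and completing the square in \<open>b * t + a\<close> reduces them to
  square roots; otherwise \<open>(0, 1)\<close> is a zero and the affine equation is linear.\<close>

lemma card_projective_zeros:
  assumes "\<not> (l dvd a \<and> l dvd b \<and> l dvd c)"
  shows "int (card {L \<in> lines. l dvd c * (fst L)\<^sup>2 - 2 * a * fst L * snd L - b * (snd L)\<^sup>2}) =
    1 + Legendre (a\<^sup>2 + b * c) l"
proof -
  let ?Z = "{L \<in> lines. l dvd c * (fst L)\<^sup>2 - 2 * a * fst L * snd L - b * (snd L)\<^sup>2}"
  define T where "T = {t \<in> {0..<l}. l dvd c - 2 * a * t - b * t\<^sup>2}"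
  have Z: "?Z = (if l dvd b then {(0, 1)} else {}) \<union> Pair 1 ` T"
    by (auto simp: lines_def T_def)
  have "finite T" unfolding T_def by (rule finite_subset[of _ "{0..<l}"]) auto
  have cT: "card (Pair (1 :: int) ` T) = card T"
    by (rule card_image) (simp add: inj_on_def)
  show ?thesis
  proof (cases "l dvd b")
    case False
    have key: "- b * (c - 2 * a * t - b * t\<^sup>2) = (b * t + a)\<^sup>2 - (a\<^sup>2 + b * c)" for t
      by (simp add: algebra_simps power2_eq_square)
    have T: "t \<in> T \<longleftrightarrow> 0 \<le> t \<and> t < l \<and> l dvd (b * t + a)\<^sup>2 - (a\<^sup>2 + b * c)" for t
      using False unfolding T_def key[symmetric] by (auto simp: l_dvd_mult)
    have cong: "l dvd ((b * t + a) mod l)\<^sup>2 - d \<longleftrightarrow> l dvd (b * t + a)\<^sup>2 - d" for t d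
      by (simp only: mod_eq_dvd_iff[symmetric] power_mod)
    have "bij_betw (\<lambda>t. (b * t + a) mod l) T {s \<in> {0..<l}. l dvd s\<^sup>2 - (a\<^sup>2 + b * c)}"
    proof (rule bij_betwI')
      fix t t' assume t: "t \<in> T" "t' \<in> T"
      have "t = t'" if "(b * t + a) mod l = (b * t' + a) mod l"
      proof -
        have "l dvd (b * t + a) - (b * t' + a)" using that by (simp add: mod_eq_dvd_iff)
        then have "l dvd b * (t - t')" by (simp add: algebra_simps)
        then have "l dvd t - t'" using False by (simp add: l_dvd_mult)
        then show ?thesis using t by (intro residue_eqI) (auto simp: T)
      qed
      then show "(b * t + a) mod l = (b * t' + a) mod l \<longleftrightarrow> t = t'" by blast
    next
      fix t assume "t \<in> T"
      then show "(b * t + a) mod l \<in> {s \<in> {0..<l}. l dvd s\<^sup>2 - (a\<^sup>2 + b * c)}"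
        using l_gt_3 by (simp add: T cong)
    next
      fix s assume s: "s \<in> {s \<in> {0..<l}. l dvd s\<^sup>2 - (a\<^sup>2 + b * c)}"
      obtain t where t: "0 \<le> t" "t < l" "l dvd b * t - (s - a)"
        using linear_congruence_solution[OF False] by blast
      then have "(b * t + a) mod l = s mod l" by (simp add: mod_eq_dvd_iff algebra_simps)
      then have "s = (b * t + a) mod l" using s by simp
      moreover from this s t cong have "t \<in> T" by (simp add: T)
      ultimately show "\<exists>t\<in>T. s = (b * t + a) mod l" by blast
    qed
    then have "card T = card {s \<in> {0..<l}. l dvd s\<^sup>2 - (a\<^sup>2 + b * c)}" by (rule bij_betw_same_card)
    then show ?thesis using False card_square_roots by (simp add: Z cT)
  next
    case True
    have T: "t \<in> T \<longleftrightarrow> 0 \<le> t \<and> t < l \<and> l dvd 2 * a * t - c" for t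
      using True by (auto simp: T_def dvd_diff_left_iff dvd_diff_commute)
    have Z': "card ?Z = Suc (card T)"
      using True \<open>finite T\<close> by (simp add: Z cT[symmetric] image_iff)
    show ?thesis
    proof (cases "l dvd a")
      case a: True
      have "T = {}" using a True assms by (auto simp: T dvd_diff_right_iff)
      moreover have "l dvd a\<^sup>2 + b * c" using a True by (simp add: power2_eq_square)
      ultimately show ?thesis using Z' by (simp add: Legendre_def cong_0_iff)
    next
      case a: False
      then have "\<not> l dvd 2 * a" using not_l_dvd_2 by (simp add: l_dvd_mult)
      then obtain t where t: "0 \<le> t" "t < l" "l dvd 2 * a * t - c"
        by (rule linear_congruence_solution)
      have "T = {t}"
      proof (intro equalityI subsetI)
        fix s assume s: "s \<in> T"
        then have "l dvd 2 * a * s - c" by (simp add: T)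
        from this t(3) have "l dvd (2 * a * s - c) - (2 * a * t - c)" by (rule dvd_diff)
        then have "l dvd (2 * a) * (s - t)" by (simp add: algebra_simps)
        then have "l dvd s - t" using \<open>\<not> l dvd 2 * a\<close> l_dvd_mult by blast
        then have "s = t" using s t by (intro residue_eqI) (simp_all add: T)
        then show "s \<in> {t}" by simp
      qed (use t in \<open>simp add: T\<close>)
      moreover have "[a\<^sup>2 = a\<^sup>2 + b * c] (mod l)"
        using True by (simp add: cong_iff_dvd_diff)
      then have "QuadRes l (a\<^sup>2 + b * c)" unfolding QuadRes_def by blast
      moreover have "\<not> [a\<^sup>2 + b * c = 0] (mod l)"
        using True a by (simp add: cong_0_iff dvd_add_left_iff l_dvd_mult power2_eq_square)
      ultimately show ?thesis using Z' by (simp add: Legendre_def)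
    qed
  qed
qed

text \<open>A trace-zero element acts by a matrix of trace 0 whose determinant is its norm modulo
  \<open>l\<close>. Its eigenlines are the zeros of the form
  \<open>c * x^2 - 2 * a * x * y - b * y^2\<close>, whose discriminant is therefore
  \<open>- 4 * m\<close> modulo \<open>l\<close>.\<close>

lemma card_eigenlines:
  assumes p: "p \<in> pure m"
  shows "int (card {L \<in> lines. parallel L (act p L)}) =
    (if of_int l dvd p then l + 1 else 1 + Legendre (- m) l)"
proof (cases "of_int l dvd p")
  case True
  then have "parallel L (act p L)" for L
    using vanishes_act_multiple[OF True, of L] by (simp add: parallel_def vanishes_def)
  then show ?thesis using True card_lines by simp
next
  case False
  define a b c where "a = qx p + u * qy p - v * qw p"
    and "b = v * qy p - qz p + (u - 1) * qw p" and "c = v * qy p + qz p + u * qw p"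
  have tr: "qy p = - 2 * qx p" using p by (simp add: pure_def qtrace_def)
  have act: "act p g = (a * fst g + b * snd g, c * fst g - a * snd g)" for g
    by (simp add: act_def a_def b_def c_def tr algebra_simps)
  have "\<not> (l dvd a \<and> l dvd b \<and> l dvd c)"
    using False of_int_l_dvdI[of p] by (auto simp: act vanishes_def)
  from card_projective_zeros[OF this]
  have "int (card {L \<in> lines. parallel L (act p L)}) = 1 + Legendre (a\<^sup>2 + b * c) l"
    by (simp add: parallel_def act algebra_simps power2_eq_square)
  moreover have "a\<^sup>2 + b * c = - m + (u\<^sup>2 - u + 1 + v\<^sup>2) * ((qy p)\<^sup>2 + (qw p)\<^sup>2)"
  proof -
    have "m = qnorm p" using p by (simp add: pure_def)
    then show ?thesis
      by (simp add: a_def b_def c_def qnorm_def tr algebra_simps power2_eq_square)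
  qed
  then have "[a\<^sup>2 + b * c = - m] (mod l)"
    using split by (simp add: cong_iff_dvd_diff)
  then have "Legendre (a\<^sup>2 + b * c) l = Legendre (- m) l"
    by (simp add: Legendre_def QuadRes_def cong_def)
  ultimately show ?thesis using False by simp
qed

section \<open>Conjugation by elements of norm l\<close>

lemma sandwich_pure:
  assumes "a \<in> generators" "p \<in> pure m"
  shows "a * p * qconj a \<in> pure (l\<^sup>2 * m)"
proof -
  have "qconj (a * p * qconj a) = - (a * p * qconj a)"
    using pure_qconj[OF assms(2)] by (simp add: qconj_mult mult.assoc)
  then show ?thesis
    using assms by (simp add: pure_def generators_def qconj_eq_uminus_iff suborder_mult
        suborder_qconj qnorm_mult power2_eq_square)
qed

lemma qconj_sandwich:
  assumes "a \<in> generators"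
  shows "qconj a * (a * p * qconj a) * a = of_int (l\<^sup>2) * p"
    and "a * (qconj a * p * a) * qconj a = of_int (l\<^sup>2) * p"
proof -
  have n: "qnorm a = l" using assms by (simp add: generators_def)
  have square: "of_int l * p * of_int l = of_int (l\<^sup>2) * p"
    by (simp only: of_int_quat_commute[of p] mult.assoc power2_eq_square of_int_mult)
  have "qconj a * (a * p * qconj a) * a = (qconj a * a) * p * (qconj a * a)"
    by (simp only: mult.assoc)
  then show "qconj a * (a * p * qconj a) * a = of_int (l\<^sup>2) * p"
    by (simp only: qconj_mult_self n square)
  have "a * (qconj a * p * a) * qconj a = (a * qconj a) * p * (a * qconj a)"
    by (simp only: mult.assoc)
  then show "a * (qconj a * p * a) * qconj a = of_int (l\<^sup>2) * p"
    by (simp only: mult_qconj n square)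
qed

lemma pure_of_sandwich:
  assumes a: "a \<in> generators" and w: "a * p * qconj a \<in> pure (l\<^sup>2 * m)"
  shows "p \<in> pure m"
proof -
  let ?w = "a * p * qconj a"
  have l2: "l\<^sup>2 \<noteq> 0" "odd (l\<^sup>2)" using l_gt_3 odd_l by simp_all
  note eq = qconj_sandwich(1)[OF a, of p]
  have "of_int (l\<^sup>2) * qconj p = qconj (of_int (l\<^sup>2) * p)"
    by (simp only: qconj_mult qconj_of_int of_int_quat_commute)
  also have "\<dots> = qconj a * qconj ?w * a"
    by (simp only: eq[symmetric] qconj_mult qconj_qconj mult.assoc)
  also have "\<dots> = of_int (l\<^sup>2) * (- p)"
    unfolding pure_qconj[OF w] using eq by simp
  finally have "qconj p = - p" using of_int_mult_quat_cancel[OF l2(1)] by blast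
  then have "qtrace p = 0" by (simp add: qconj_eq_uminus_iff)
  moreover have "l\<^sup>2 * qnorm p = l\<^sup>2 * m"
    using a w by (simp add: pure_def generators_def qnorm_mult power2_eq_square)
  then have "qnorm p = m" using l2 by simp
  moreover have "a \<in> suborder" "?w \<in> suborder" using a w by (simp_all add: pure_def generators_def)
  then have "qconj a * ?w * a \<in> suborder" by (metis suborder_mult suborder_qconj)
  then have "p \<in> suborder" unfolding eq using suborder_of_int_mult[OF l2(2)] by blast
  ultimately show ?thesis by (simp add: pure_def)
qed

text \<open>The condition amounts to \<open>l\<close> dividing \<open>qconj a * w * a\<close>, that
  is, to \<open>qconj a\<close> killing the image of \<open>L\<close> under \<open>w\<close>. As the
  kernel of \<open>qconj a\<close> is \<open>L\<close> itself, \<open>w\<close> must preserve this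
  line or kill it.\<close>

lemma imprimitive_sandwich_iff:
  assumes a: "a \<in> generators" and L: "L \<in> lines" "vanishes (act (qconj a) L)" and w: "w \<in> pure m"
  shows "(\<exists>p\<in>pure m. of_int l * w = a * p * qconj a) \<longleftrightarrow> parallel L (act w L)"
proof -
  have L0: "\<not> vanishes L" using L lines_not_vanishes by blast
  have na: "\<not> of_int l dvd qconj a" using a not_l_dvd_generator l_dvd_qconj_iff by blast
  have l0: "l \<noteq> 0" using l_gt_3 by simp
  have "(\<exists>p\<in>pure m. of_int l * w = a * p * qconj a) \<longleftrightarrow> of_int l dvd qconj a * w * a"
  proof
    assume "\<exists>p\<in>pure m. of_int l * w = a * p * qconj a"
    then obtain p where p: "of_int l * w = a * p * qconj a" by blast
    have "of_int l * (qconj a * w * a) = qconj a * (of_int l * w) * a"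
      by (simp add: mult.assoc[symmetric] of_int_quat_commute)
    also have "\<dots> = of_int l * (of_int l * p)"
      unfolding p qconj_sandwich(1)[OF a] by (simp add: power2_eq_square mult.assoc)
    finally have "qconj a * w * a = of_int l * p" using l0 by (simp add: of_int_mult_quat_cancel)
    then show "of_int l dvd qconj a * w * a" by (metis dvdI)
  next
    assume "of_int l dvd qconj a * w * a"
    then obtain p where p: "qconj a * w * a = of_int l * p" by (elim dvdE)
    have "of_int l * (a * p * qconj a) = a * (of_int l * p) * qconj a"
      by (simp add: mult.assoc[symmetric] of_int_quat_commute)
    also have "\<dots> = of_int l * (of_int l * w)"
      unfolding p[symmetric] qconj_sandwich(2)[OF a] by (simp add: power2_eq_square mult.assoc)
    finally have eq: "of_int l * w = a * p * qconj a" using l0 by (simp add: of_int_mult_quat_cancel)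
    have "of_int l * w \<in> pure (l\<^sup>2 * m)"
    proof -
      have "qtrace (of_int l * w) = l * qtrace w"
        by (simp add: qtrace_def of_int_mult_quat algebra_simps)
      then show ?thesis using w odd_l by (simp add: pure_def suborder_of_int_mult qnorm_mult)
    qed
    then have "p \<in> pure m" unfolding eq by (rule pure_of_sandwich[OF a])
    then show "\<exists>p\<in>pure m. of_int l * w = a * p * qconj a" using eq by blast
  qed
  also have "\<dots> \<longleftrightarrow> vanishes (act (qconj a) (act w L))"
    using l_dvd_mult_generator_iff[OF a L0 L(2)] by (simp add: vanishes_act_mult)
  also have "\<dots> \<longleftrightarrow> parallel L (act w L)"
    using parallel_kernel[OF na L(2)] parallel_act[OF _ L0 L(2)] by blast
  finally show ?thesis .
qed

text \<open>In the harder direction \<open>l\<close> divides \<open>w * a\<close>, hence by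
  conjugation \<open>qconj a * w\<close>, which gives \<open>w = a * b\<close>. A kernel line of
  \<open>b\<close> is also one of \<open>w\<close>, hence equals \<open>L\<close>; so
  \<open>l\<close> divides \<open>b * a\<close>, and \<open>qconj a\<close> splits off on the right
  as well.\<close>

lemma primitive_sandwich_iff:
  assumes a: "a \<in> generators" and L: "L \<in> lines" "vanishes (act (qconj a) L)"
    and w: "w \<in> pure (l\<^sup>2 * m)" "\<not> of_int l dvd w"
  shows "(\<exists>p\<in>pure m. w = a * p * qconj a) \<longleftrightarrow> vanishes (act w L)"
proof
  assume "\<exists>p\<in>pure m. w = a * p * qconj a"
  then show "vanishes (act w L)" using L by (auto simp: vanishes_act_mult vanishes_act)
next
  assume wL: "vanishes (act w L)"
  have L0: "\<not> vanishes L" using L lines_not_vanishes by blast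
  have l0: "l \<noteq> 0" using l_gt_3 by simp
  have na: "qnorm a = l" using a by (simp add: generators_def)
  have "of_int l dvd w * a" using wL l_dvd_mult_generator_iff[OF a L0 L(2)] by blast
  then have "of_int l dvd qconj (w * a)" by (simp add: l_dvd_qconj_iff)
  then have "of_int l dvd - (qconj a * w)" by (simp add: qconj_mult pure_qconj[OF w(1)])
  then have "of_int l dvd qconj a * w" by (simp add: of_int_dvd_quat_iff uminus_quat_def)
  then obtain b where b: "qconj a * w = of_int l * b" by (elim dvdE)
  have "of_int l * w = a * (qconj a * w)" by (simp add: mult.assoc[symmetric] mult_qconj na)
  also have "\<dots> = of_int l * (a * b)" by (simp add: b mult.assoc[symmetric] of_int_quat_commute)
  finally have wab: "w = a * b" using l0 by (simp add: of_int_mult_quat_cancel)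
  have "l * qnorm b = l * (l * m)" using w(1) by (simp add: pure_def wab qnorm_mult na power2_eq_square)
  then have "l dvd qnorm b" using l0 by simp
  then obtain L' where L': "L' \<in> lines" "vanishes (act b L')" by (rule kernel_line_exists)
  then have "vanishes (act w L')" by (simp add: wab vanishes_act_mult vanishes_act)
  then have "L' = L" using parallel_kernel[OF w(2)] wL parallel_lines_eq L'(1) L(1) by blast
  then have "of_int l dvd b * a" using L' l_dvd_mult_generator_iff[OF a L0 L(2)] by blast
  then obtain p where p: "b * a = of_int l * p" by (elim dvdE)
  have "of_int l * b = (b * a) * qconj a" by (simp add: mult.assoc mult_qconj na of_int_quat_commute)
  also have "\<dots> = of_int l * (p * qconj a)" by (simp add: p mult.assoc)
  finally have "b = p * qconj a" using l0 by (simp add: of_int_mult_quat_cancel)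
  then have eq: "w = a * p * qconj a" by (simp add: wab mult.assoc)
  with w(1) have "p \<in> pure m" using pure_of_sandwich[OF a] by simp
  with eq show "\<exists>p\<in>pure m. w = a * p * qconj a" by blast
qed

lemma primitive_kernel_line:
  assumes "w \<in> pure (l\<^sup>2 * m)" "\<not> of_int l dvd w"
  shows "card {L \<in> lines. vanishes (act w L)} = 1"
proof -
  have "l dvd qnorm w" using assms(1) by (simp add: pure_def)
  then obtain L where L: "L \<in> lines" "vanishes (act w L)" by (rule kernel_line_exists)
  then have "{L \<in> lines. vanishes (act w L)} = {L}"
    using parallel_kernel[OF assms(2)] parallel_lines_eq by blast
  then show ?thesis by simp
qed

lemma pure_imprimitive:
  "{w \<in> pure (l\<^sup>2 * m). of_int l dvd w} = (*) (of_int l) ` pure m"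
proof -
  have l0: "l \<noteq> 0" using l_gt_3 by simp
  have "of_int l * p \<in> pure (l\<^sup>2 * m) \<longleftrightarrow> p \<in> pure m" for p
  proof -
    have "qtrace (of_int l * p) = l * qtrace p"
      by (simp add: qtrace_def of_int_mult_quat algebra_simps)
    then show ?thesis using odd_l l0 by (simp add: pure_def suborder_of_int_mult qnorm_mult)
  qed
  then show ?thesis by (auto intro: dvdI elim: dvdE)
qed

lemma inj_of_int_l: "inj_on ((*) (of_int l :: quat)) A"
  using l_gt_3 by (auto simp: inj_on_def of_int_mult_quat_cancel)

lemma card_pure_imprimitive:
  "card {w \<in> pure m. of_int l dvd w} = (if l\<^sup>2 dvd m then card (pure (m div l\<^sup>2)) else 0)"
proof (cases "l\<^sup>2 dvd m")
  case True
  then have "l\<^sup>2 * (m div l\<^sup>2) = m" by simp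
  then have "{w \<in> pure m. of_int l dvd w} = (*) (of_int l) ` pure (m div l\<^sup>2)"
    using pure_imprimitive[of "m div l\<^sup>2"] by simp
  then show ?thesis using True by (simp add: card_image inj_of_int_l)
next
  case False
  have "{w \<in> pure m. of_int l dvd w} = {}"
  proof (rule equals0I)
    fix w assume "w \<in> {w \<in> pure m. of_int l dvd w}"
    then obtain p where "w = of_int l * p" "qnorm w = m" by (auto simp: pure_def elim: dvdE)
    then show False using False by (auto simp: qnorm_mult)
  qed
  then have "card {w \<in> pure m. of_int l dvd w} = 0" by (simp only: card.empty)
  then show ?thesis using False by simp
qed

text \<open>Both sides count the pairs of a generator \<open>a\<close> and a pure \<open>p\<close> of norm \<open>m\<close>; the right-hand
  side sorts them by \<open>w = a * p * qconj a\<close>.\<close>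

lemma card_generators_times_pure:
  "card generators * card (pure m) =
    (\<Sum>w\<in>pure (l\<^sup>2 * m). card {a \<in> generators. \<exists>p\<in>pure m. w = a * p * qconj a})"
proof -
  let ?G = "\<lambda>w. {a \<in> generators. \<exists>p\<in>pure m. w = a * p * qconj a}"
  have "card (generators \<times> pure m) = card (SIGMA w:pure (l\<^sup>2 * m). ?G w)"
  proof (rule bij_betw_same_card)
    show "bij_betw (\<lambda>(a, p). (a * p * qconj a, a)) (generators \<times> pure m) (SIGMA w:pure (l\<^sup>2 * m). ?G w)"
    proof (rule bij_betwI')
      fix x y assume xy: "x \<in> generators \<times> pure m" "y \<in> generators \<times> pure m"
      obtain a p b q where x: "x = (a, p)" and y: "y = (b, q)" by (cases x, cases y)
      have "p = q" if eq: "a * p * qconj a = a * q * qconj a"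
      proof -
        have a: "a \<in> generators" using xy x by simp
        have "of_int (l\<^sup>2) * p = of_int (l\<^sup>2) * q"
          unfolding qconj_sandwich(1)[OF a, symmetric] eq ..
        moreover have "l\<^sup>2 \<noteq> 0" using l_gt_3 by simp
        ultimately show ?thesis using of_int_mult_quat_cancel by blast
      qed
      then show "((case x of (a, p) \<Rightarrow> (a * p * qconj a, a)) = (case y of (a, p) \<Rightarrow> (a * p * qconj a, a))) = (x = y)"
        by (auto simp: x y)
    next
      fix x assume "x \<in> generators \<times> pure m"
      then show "(case x of (a, p) \<Rightarrow> (a * p * qconj a, a)) \<in> (SIGMA w:pure (l\<^sup>2 * m). ?G w)"
        using sandwich_pure by auto
    next
      fix z assume "z \<in> (SIGMA w:pure (l\<^sup>2 * m). ?G w)"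
      then obtain a p where "a \<in> generators" "p \<in> pure m" "z = (a * p * qconj a, a)" by auto
      then show "\<exists>x\<in>generators \<times> pure m. z = (case x of (a, p) \<Rightarrow> (a * p * qconj a, a))"
        by (intro bexI[of _ "(a, p)"]) auto
    qed
  qed
  then show ?thesis using finite_pure finite_generators by (simp add: card_SigmaI card_cartesian_product)
qed

text \<open>A primitive \<open>w\<close> is reached from the 4 generators over its kernel line, and
  \<open>l\<close> times \<open>w\<close> from 4 generators per eigenline of \<open>w\<close>. The
  total is the \<open>4 * (l + 1)\<close> generators for each \<open>p\<close>; dividing by 4 and
  solving for the count at \<open>l^2 * m\<close> gives the relation.\<close>

theorem card_pure_hecke:
  "int (card (pure (l\<^sup>2 * m))) = (l + 1 - Legendre (- m) l) * int (card (pure m))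
    - l * (if l\<^sup>2 dvd m then int (card (pure (m div l\<^sup>2))) else 0)"
proof -
  let ?G = "\<lambda>w. {a \<in> generators. \<exists>p\<in>pure m. w = a * p * qconj a}"
  define P where "P = {w \<in> pure (l\<^sup>2 * m). \<not> of_int l dvd w}"
  define I where "I = {w \<in> pure m. of_int l dvd w}"
  define n n1 n2 where "n = int (card (pure (l\<^sup>2 * m)))" and "n1 = int (card (pure m))" and "n2 = int (card I)"
  have fin: "finite P" "finite I" "I \<subseteq> pure m" using finite_pure by (simp_all add: P_def I_def)
  have split_pure: "pure (l\<^sup>2 * m) = P \<union> (*) (of_int l) ` pure m" "P \<inter> (*) (of_int l) ` pure m = {}"
    unfolding pure_imprimitive[symmetric] P_def by auto
  have n: "n = int (card P) + n1"
    using card_Un_disjoint[OF fin(1) _ split_pure(2)] finite_pure split_pure(1)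
    by (simp add: n_def n1_def card_image inj_of_int_l)
  have prim: "int (card (?G w)) = 4" if "w \<in> P" for w
    using card_generators_with[of "\<lambda>a. \<exists>p\<in>pure m. w = a * p * qconj a" "\<lambda>L. vanishes (act w L)"]
      primitive_sandwich_iff[of _ _ w m] primitive_kernel_line[of w m] that by (simp add: P_def)
  have imprim: "int (card (?G (of_int l * w))) = 4 * (if w \<in> I then l + 1 else 1 + Legendre (- m) l)"
    if "w \<in> pure m" for w
    using card_generators_with[of "\<lambda>a. \<exists>p\<in>pure m. of_int l * w = a * p * qconj a" "\<lambda>L. parallel L (act w L)"]
      imprimitive_sandwich_iff[OF _ _ _ that] card_eigenlines[OF that] that by (simp add: I_def)
  have "4 * (l + 1) * n1 = int (card generators * card (pure m))"
    by (simp add: card_generators n1_def)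
  also have "\<dots> = (\<Sum>w\<in>pure (l\<^sup>2 * m). int (card (?G w)))"
    by (simp add: card_generators_times_pure)
  also have "\<dots> = (\<Sum>w\<in>P. int (card (?G w))) + (\<Sum>w\<in>pure m. int (card (?G (of_int l * w))))"
    unfolding split_pure(1) using fin finite_pure split_pure(2)
    by (subst sum.union_disjoint) (simp_all add: sum.reindex inj_of_int_l)
  also have "(\<Sum>w\<in>P. int (card (?G w))) = 4 * int (card P)"
    using prim by simp
  also have "(\<Sum>w\<in>pure m. int (card (?G (of_int l * w)))) =
      (\<Sum>w\<in>pure m. 4 * (if w \<in> I then l + 1 else 1 + Legendre (- m) l))"
    using imprim by (intro sum.cong) auto
  also have "\<dots> = 4 * ((l + 1) * n2 + (1 + Legendre (- m) l) * (n1 - n2))"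
  proof -
    let ?f = "\<lambda>w. 4 * (if w \<in> I then l + 1 else 1 + Legendre (- m) l)"
    have card_diff: "int (card (pure m - I)) = n1 - n2"
      using fin finite_pure by (simp add: n1_def n2_def card_Diff_subset of_nat_diff card_mono)
    have "sum ?f (pure m) = sum ?f (pure m - I) + sum ?f I"
      by (rule sum.subset_diff[OF fin(3) finite_pure])
    also have "sum ?f (pure m - I) = int (card (pure m - I)) * (4 * (1 + Legendre (- m) l))"
      by simp
    also have "sum ?f I = n2 * (4 * (l + 1))"
      by (simp add: n2_def)
    finally show ?thesis unfolding card_diff by (simp only: algebra_simps)
  qed
  finally have "(l + 1) * n1 = (n - n1) + (l + 1) * n2 + (1 + Legendre (- m) l) * (n1 - n2)"
    using n by (simp add: algebra_simps)
  then have "n = (l + 1 - Legendre (- m) l) * n1 - l * n2 + Legendre (- m) l * n2"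
    by (simp add: algebra_simps)
  \<comment> \<open>If \<open>n2\<close> is nonzero, then \<open>l^2\<close> divides
    \<open>m\<close> and the symbol is zero.\<close>
  moreover have "Legendre (- m) l * n2 = 0"
  proof (cases "l\<^sup>2 dvd m")
    case True
    then have "l dvd m" by (metis dvd_mult_left power2_eq_square)
    then show ?thesis by (simp add: Legendre_def cong_0_iff)
  qed (simp add: n2_def I_def card_pure_imprimitive)
  ultimately have "n = (l + 1 - Legendre (- m) l) * n1 - l * n2"
    by linarith
  then show ?thesis by (auto simp: n_def n1_def n2_def I_def card_pure_imprimitive)
qed

end

section \<open>The congruences\<close>

text \<open>8 times a triangular number is an odd square minus 1, and the three shifts add up to
  \<open>1 + 1 + 3 = 5\<close>.\<close>

lemma ternary_tri_eq:
  "ternary_tri n = card {(x :: int, y :: int, z :: int). odd x \<and> odd y \<and> odd z \<and> x\<^sup>2 + y\<^sup>2 + 3 * z\<^sup>2 = 8 * int n + 5}"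
proof -
  let ?h = "\<lambda>(x :: int, y :: int, z :: int). (2 * x + 1, 2 * y + 1, 2 * z + 1)"
  have iff: "tri_int x + tri_int y + 3 * tri_int z = n \<longleftrightarrow>
      (2 * x + 1)\<^sup>2 + (2 * y + 1)\<^sup>2 + 3 * (2 * z + 1)\<^sup>2 = 8 * int n + 5" for x y z
  proof -
    have tri: "8 * int (tri_int x) = (2 * x + 1)\<^sup>2 - 1" for x
      using int_tri_int[of x] by (simp add: power2_eq_square algebra_simps)
    show ?thesis using tri[of x] tri[of y] tri[of z] by linarith
  qed
  have "{(x :: int, y :: int, z :: int). odd x \<and> odd y \<and> odd z \<and> x\<^sup>2 + y\<^sup>2 + 3 * z\<^sup>2 = 8 * int n + 5} =
      ?h ` {(x, y, z). tri_int x + tri_int y + 3 * tri_int z = n}"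
  proof (intro equalityI subsetI)
    fix t assume t: "t \<in> {(x :: int, y :: int, z :: int). odd x \<and> odd y \<and> odd z \<and> x\<^sup>2 + y\<^sup>2 + 3 * z\<^sup>2 = 8 * int n + 5}"
    then obtain x y z where xyz: "t = (2 * x + 1, 2 * y + 1, 2 * z + 1)" by (auto elim!: oddE)
    have "(x, y, z) \<in> {(x, y, z). tri_int x + tri_int y + 3 * tri_int z = n}"
      using t unfolding xyz by (simp only: mem_Collect_eq prod.case iff)
    moreover have "t = ?h (x, y, z)" by (simp add: xyz)
    ultimately show "t \<in> ?h ` {(x, y, z). tri_int x + tri_int y + 3 * tri_int z = n}" by (rule image_eqI[rotated])
  next
    fix t assume "t \<in> ?h ` {(x, y, z). tri_int x + tri_int y + 3 * tri_int z = n}"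
    then obtain x y z where xyz: "t = (2 * x + 1, 2 * y + 1, 2 * z + 1)"
      and "tri_int x + tri_int y + 3 * tri_int z = n" by auto
    then show "t \<in> {(x :: int, y :: int, z :: int). odd x \<and> odd y \<and> odd z \<and> x\<^sup>2 + y\<^sup>2 + 3 * z\<^sup>2 = 8 * int n + 5}"
      unfolding xyz iff by simp
  qed
  moreover have "inj_on ?h A" for A by (auto simp: inj_on_def)
  ultimately show ?thesis by (simp add: ternary_tri_def card_image)
qed

lemma finite_ternary: "finite {(x :: int, y :: int, z :: int). x\<^sup>2 + y\<^sup>2 + 3 * z\<^sup>2 = m}"
proof (rule finite_subset)
  have bound: "\<bar>x\<bar> \<le> m" if "x\<^sup>2 \<le> m" for x :: int
  proof -
    have "\<bar>x\<bar> \<le> x\<^sup>2" using self_le_power[of "\<bar>x\<bar>" 2] by (cases "x = 0") auto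
    then show ?thesis using that by linarith
  qed
  show "{(x :: int, y :: int, z :: int). x\<^sup>2 + y\<^sup>2 + 3 * z\<^sup>2 = m} \<subseteq> {- m..m} \<times> {- m..m} \<times> {- m..m}"
  proof
    fix t assume t: "t \<in> {(x :: int, y :: int, z :: int). x\<^sup>2 + y\<^sup>2 + 3 * z\<^sup>2 = m}"
    obtain x y z where xyz: "t = (x, y, z)" by (cases t)
    have "0 \<le> x\<^sup>2" "0 \<le> y\<^sup>2" "0 \<le> z\<^sup>2" by simp_all
    with t have "x\<^sup>2 \<le> m" "y\<^sup>2 \<le> m" "z\<^sup>2 \<le> m" unfolding xyz by auto
    then have "\<bar>x\<bar> \<le> m" "\<bar>y\<bar> \<le> m" "\<bar>z\<bar> \<le> m" using bound by blast+
    then show "t \<in> {- m..m} \<times> {- m..m} \<times> {- m..m}" unfolding xyz by auto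
  qed
qed simp

text \<open>A solution has either three odd entries, or exactly one, which is \<open>x\<close> or \<open>y\<close>. Multiplication of
  \<open>y + z \<surd>-3\<close> by \<open>(1 - \<surd>-3) / 2\<close> maps the all-odd solutions with \<open>y \<equiv> z (mod 4)\<close>, which are half of
  the all-odd ones, bijectively to those in which only \<open>x\<close> is odd.\<close>

lemma ternary_8n_5: "ternary (8 * n + 5) = 2 * ternary_tri n"
proof -
  define Q where "Q = (\<lambda>x y z :: int. x\<^sup>2 + y\<^sup>2 + 3 * z\<^sup>2 = 8 * int n + 5)"
  define O' where "O' = {(x, y, z). odd x \<and> odd y \<and> odd z \<and> Q x y z}"
  define E1 where "E1 = {(x, y, z). odd x \<and> even y \<and> even z \<and> Q x y z}"
  define E2 where "E2 = {(x, y, z). even x \<and> odd y \<and> even z \<and> Q x y z}"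
  define Op where "Op = {(x, y, z). (x, y, z) \<in> O' \<and> 4 dvd y - z}"
  define Om where "Om = {(x, y, z). (x, y, z) \<in> O' \<and> 4 dvd y + z}"
  have "finite {(x, y, z). Q x y z}" unfolding Q_def by (rule finite_ternary)
  then have fin: "finite O'" "finite E1" "finite E2" "finite Op" "finite Om"
    by (rule rev_finite_subset; auto simp: O'_def E1_def E2_def Op_def Om_def)+
  have sq_even: "4 dvd a\<^sup>2" if "even a" for a :: int
    using that by (auto elim!: evenE simp: power2_eq_square)
  have sq_odd: "8 dvd a\<^sup>2 - 1" if "odd a" for a :: int
  proof -
    obtain b where b: "a = 2 * b + 1" using \<open>odd a\<close> by (rule oddE)
    have "even (b * (b + 1))" by simp
    then obtain c where "b * (b + 1) = 2 * c" by (rule evenE)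
    then have "a\<^sup>2 - 1 = 8 * c" unfolding b by (simp add: power2_eq_square algebra_simps)
    then show ?thesis by simp
  qed
  have "{(x, y, z). Q x y z} = O' \<union> (E1 \<union> E2)"
  proof (intro equalityI subsetI)
    fix t assume t: "t \<in> {(x, y, z). Q x y z}"
    obtain x y z where xyz: "t = (x, y, z)" by (cases t)
    have eq: "x\<^sup>2 + y\<^sup>2 + 3 * z\<^sup>2 = 8 * int n + 5" using t by (simp add: xyz Q_def)
    have "even (x\<^sup>2 + y\<^sup>2 + 3 * z\<^sup>2) \<longleftrightarrow> even (8 * int n + 5)" unfolding eq ..
    then have par: "odd x \<longleftrightarrow> (odd y \<longleftrightarrow> odd z)" by simp blast
    \<comment> \<open>With \<open>z\<close> as the only odd entry the form would be 3 modulo 4,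
      whereas \<open>8 * n + 5\<close> is 1.\<close>
    have "\<not> (even x \<and> even y \<and> odd z)"
    proof
      assume e: "even x \<and> even y \<and> odd z"
      then have "4 dvd x\<^sup>2" "4 dvd y\<^sup>2" "8 dvd z\<^sup>2 - 1" using sq_even sq_odd by blast+
      then show False using eq by presburger
    qed
    then show "t \<in> O' \<union> (E1 \<union> E2)" using par t by (auto simp: xyz O'_def E1_def E2_def)
  qed (auto simp: O'_def E1_def E2_def)
  moreover have "card (O' \<union> (E1 \<union> E2)) = card O' + (card E1 + card E2)"
    using fin by (subst card_Un_disjoint, simp, simp, force simp: O'_def E1_def E2_def,
        subst card_Un_disjoint) (auto simp: E1_def E2_def)
  moreover have "card E2 = card E1"
  proof (rule bij_betw_same_card)
    show "bij_betw (\<lambda>(x, y, z). (y, x, z)) E2 E1"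
      by (rule bij_betw_byWitness[where f' = "\<lambda>(x, y, z). (y, x, z)"])
        (auto simp: E1_def E2_def Q_def add.commute)
  qed
  moreover have "card Om = card Op"
  proof (rule bij_betw_same_card)
    show "bij_betw (\<lambda>(x, y, z). (x, y, - z)) Om Op"
      by (rule bij_betw_byWitness[where f' = "\<lambda>(x, y, z). (x, y, - z)"])
        (auto simp: Om_def Op_def O'_def Q_def)
  qed
  moreover have "card Op = card E1"
  proof (rule bij_betw_same_card)
    show "bij_betw (\<lambda>(x, y, z). (x, (y + 3 * z) div 2, (z - y) div 2)) Op E1"
    \<comment> \<open>The witness for the inverse is multiplication by
      \<open>(1 + \<surd>-3) / 2\<close>.\<close>
    proof (rule bij_betw_byWitness[where f' = "\<lambda>(x, y, z). (x, (y - 3 * z) div 2, (y + z) div 2)"])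
      have fwd: "\<exists>k. y = z + 4 * k" if "4 dvd y - z" for y z :: int
        using that by (metis add.commute diff_add_cancel dvdE)
      show "\<forall>t\<in>Op. (\<lambda>(x, y, z). (x, (y - 3 * z) div 2, (y + z) div 2))
          ((\<lambda>(x, y, z). (x, (y + 3 * z) div 2, (z - y) div 2)) t) = t"
        using fwd by (force simp: Op_def)
      show "\<forall>t\<in>E1. (\<lambda>(x, y, z). (x, (y + 3 * z) div 2, (z - y) div 2))
          ((\<lambda>(x, y, z). (x, (y - 3 * z) div 2, (y + z) div 2)) t) = t"
        by (auto simp: E1_def elim!: evenE)
      show "(\<lambda>(x, y, z). (x, (y + 3 * z) div 2, (z - y) div 2)) ` Op \<subseteq> E1"
      proof clarify
        fix x y z assume "(x, y, z) \<in> Op"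
        then have o: "odd x" "odd y" "odd z" and Q: "Q x y z" and "4 dvd y - z"
          by (auto simp: Op_def O'_def)
        then obtain k where k: "y = z + 4 * k" using fwd by blast
        then have "(y + 3 * z) div 2 = 2 * (z + k)" "(z - y) div 2 = - 2 * k" by simp_all
        moreover have "Q x (2 * (z + k)) (- 2 * k)"
          using Q by (simp add: Q_def k power2_eq_square algebra_simps)
        ultimately show "(x, (y + 3 * z) div 2, (z - y) div 2) \<in> E1"
          using o by (simp add: E1_def)
      qed
      show "(\<lambda>(x, y, z). (x, (y - 3 * z) div 2, (y + z) div 2)) ` E1 \<subseteq> Op"
      proof clarify
        fix x y z assume e: "(x, y, z) \<in> E1"
        then obtain a b where ab: "y = 2 * a" "z = 2 * b" by (auto simp: E1_def elim!: evenE)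
        have eq: "x\<^sup>2 + 4 * (a\<^sup>2 + 3 * b\<^sup>2) = 8 * int n + 5"
          using e by (simp add: E1_def Q_def ab power2_eq_square)
        have "8 dvd x\<^sup>2 - 1" using e sq_odd by (auto simp: E1_def)
        then obtain c where "x\<^sup>2 - 1 = 8 * c" ..
        with eq have "a\<^sup>2 + 3 * b\<^sup>2 = 2 * (int n - c) + 1" by simp
        then have "odd (a\<^sup>2 + 3 * b\<^sup>2)" by simp
        then have odd: "odd (a + b)" by simp
        have "(y - 3 * z) div 2 = a - 3 * b" "(y + z) div 2 = a + b" by (simp_all add: ab)
        moreover have "Q x (a - 3 * b) (a + b)"
          using eq by (simp add: Q_def power2_eq_square algebra_simps)
        moreover have "4 dvd (a - 3 * b) - (a + b)" by simp
        ultimately show "(x, (y - 3 * z) div 2, (y + z) div 2) \<in> Op"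
          using e odd by (simp add: Op_def O'_def E1_def)
      qed
    qed
  qed
  moreover have "O' = Op \<union> Om"
  proof -
    have "4 dvd y - z \<or> 4 dvd y + z" if "odd y" "odd z" for y z :: int
      using that by presburger
    then show ?thesis by (auto simp: O'_def Op_def Om_def)
  qed
  moreover have "Op \<inter> Om = {}"
  proof -
    have "\<not> (4 dvd y - z \<and> 4 dvd y + z)" if "odd y" for y z :: int
      using that by presburger
    then show ?thesis by (auto simp: O'_def Op_def Om_def)
  qed
  then have "card (Op \<union> Om) = card Op + card Om" using fin by (simp add: card_Un_disjoint)
  \<comment> \<open>The solutions outside \<open>O'\<close> number twice \<open>card E1\<close>,
    that is \<open>card Op + card Om\<close>, which is \<open>card O'\<close> again.\<close>
  ultimately have "card {(x, y, z). Q x y z} = 2 * card O'" by simp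
  then show ?thesis by (simp add: ternary_def ternary_tri_eq Q_def O'_def)
qed

text \<open>This serves the prime 3. Anisotropy of \<open>x^2 + y^2\<close> modulo 3 makes
  \<open>x\<close> and \<open>y\<close> multiples of 3; after division by 3 the same follows for
  \<open>z\<close>.\<close>

lemma ternary_9: "ternary (9 * n) = ternary n"
proof -
  let ?h = "\<lambda>(x :: int, y :: int, z :: int). (3 * x, 3 * y, 3 * z)"
  have "{(x :: int, y :: int, z :: int). x\<^sup>2 + y\<^sup>2 + 3 * z\<^sup>2 = int (9 * n)} =
      ?h ` {(x, y, z). x\<^sup>2 + y\<^sup>2 + 3 * z\<^sup>2 = int n}"
  proof (intro equalityI subsetI)
    fix t assume t: "t \<in> {(x :: int, y :: int, z :: int). x\<^sup>2 + y\<^sup>2 + 3 * z\<^sup>2 = int (9 * n)}"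
    obtain x y z where xyz: "t = (x, y, z)" by (cases t)
    have eq: "x\<^sup>2 + y\<^sup>2 + 3 * z\<^sup>2 = 9 * int n" using t by (simp add: xyz)
    then have "3 dvd x\<^sup>2 + y\<^sup>2" by presburger
    from mod_3_sum_squares[OF this] obtain a b where ab: "x = 3 * a" "y = 3 * b" by (metis dvdE)
    have eq': "3 * (a\<^sup>2 + b\<^sup>2) + z\<^sup>2 = 3 * int n" using eq by (simp add: ab power2_eq_square)
    then have "3 dvd z\<^sup>2" by presburger
    then have "3 dvd z" by (simp add: prime_dvd_power_iff)
    then obtain c where c: "z = 3 * c" ..
    have "a\<^sup>2 + b\<^sup>2 + 3 * c\<^sup>2 = int n" using eq' by (simp add: c power2_eq_square)
    then show "t \<in> ?h ` {(x, y, z). x\<^sup>2 + y\<^sup>2 + 3 * z\<^sup>2 = int n}"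
      by (intro image_eqI[of _ _ "(a, b, c)"]) (simp_all add: xyz ab c)
  qed auto
  moreover have "inj_on ?h A" for A by (auto simp: inj_on_def)
  ultimately show ?thesis by (simp add: ternary_def card_image)
qed

text \<open>With the basis \<open>i\<close>, \<open>j\<close>, \<open>i j\<close> of the trace-zero
  part, the norm of \<open>b i + c j + d i j\<close> is \<open>b^2 + 3 c^2 + 3 d^2\<close>. The
  value \<open>3 n\<close> forces \<open>b = 3 z\<close>, and dividing by 3 leaves
  \<open>c^2 + d^2 + 3 z^2\<close>.\<close>

lemma ternary_eq_card_pure: "ternary n = card (pure (3 * int n))"
proof -
  let ?h = "\<lambda>(x, y, z). Quat (- x) (2 * x) (3 * z - y) (2 * y)"
  have iff: "?h (x, y, z) \<in> pure (3 * int n) \<longleftrightarrow> x\<^sup>2 + y\<^sup>2 + 3 * z\<^sup>2 = int n" for x y z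
  proof -
    have "qnorm (?h (x, y, z)) = 3 * (x\<^sup>2 + y\<^sup>2 + 3 * z\<^sup>2)"
      by (simp add: qnorm_def power2_eq_square algebra_simps)
    then show ?thesis by (auto simp: pure_def suborder_def qtrace_def)
  qed
  have "pure (3 * int n) = ?h ` {(x, y, z). x\<^sup>2 + y\<^sup>2 + 3 * z\<^sup>2 = int n}"
  proof (intro equalityI subsetI)
    fix p assume p: "p \<in> pure (3 * int n)"
    obtain a b c d where abcd: "p = Quat a b c d" by (cases p)
    have b: "b = - 2 * a" using p by (simp add: pure_def qtrace_def abcd)
    obtain y where d: "d = 2 * y" using p by (auto simp: pure_def suborder_def abcd elim: evenE)
    have "3 * a\<^sup>2 + (c + y)\<^sup>2 + 3 * y\<^sup>2 = 3 * int n"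
      using p by (simp add: pure_def qnorm_def abcd b d power2_eq_square algebra_simps)
    then have "3 dvd (c + y)\<^sup>2" by presburger
    then have "3 dvd c + y" by (simp add: prime_dvd_power_iff)
    then obtain z where z: "c + y = 3 * z" ..
    have eq: "p = ?h (- a, y, z)" using z by (simp add: abcd b d)
    have "?h (- a, y, z) \<in> pure (3 * int n)" using p by (simp only: eq[symmetric])
    then have "(- a, y, z) \<in> {(x, y, z). x\<^sup>2 + y\<^sup>2 + 3 * z\<^sup>2 = int n}"
      unfolding iff by (simp only: mem_Collect_eq prod.case)
    with eq show "p \<in> ?h ` {(x, y, z). x\<^sup>2 + y\<^sup>2 + 3 * z\<^sup>2 = int n}" by (rule image_eqI)
  qed (use iff in auto)
  moreover have "inj_on ?h A" for A by (auto simp: inj_on_def)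
  ultimately show ?thesis by (simp add: ternary_def card_image)
qed

text \<open>\<open>u^2 - u + 1\<close> and \<open>- v^2\<close> each take \<open>(l + 1) / 2\<close>
  values modulo \<open>l\<close>, too many to be disjoint. The first polynomial is symmetric under u
  \<mapsto> 1 - u, and the range from 1 to \<open>m + 1\<close> meets each pair of residues
  once.\<close>

lemma split_prime_exists:
  fixes l :: int
  assumes "prime l" "3 < l"
  obtains u v where "split_prime l u v"
proof -
  define m where "m = (l - 1) div 2"
  have l: "l = 2 * m + 1" using assms prime_odd_int[of l] by (auto simp: m_def elim!: oddE)
  define U where "U = (\<lambda>u. (u\<^sup>2 - u + 1) mod l) ` {1..m + 1}"
  define V where "V = (\<lambda>v. (- v\<^sup>2) mod l) ` {0..m}"
  have dvd: "l dvd a * b \<longleftrightarrow> l dvd a \<or> l dvd b" for a b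
    using assms by (simp add: prime_dvd_mult_iff)
  have small: "a = 0" if "l dvd a" "\<bar>a\<bar> < l" for a
    using that by (metis abs_of_pos assms(2) dvd_imp_le_int less_trans not_less zero_less_numeral)
  have "inj_on (\<lambda>u. (u\<^sup>2 - u + 1) mod l) {1..m + 1}"
  proof (rule inj_onI)
    fix a b assume ab: "a \<in> {1..m + 1}" "b \<in> {1..m + 1}"
      and "(a\<^sup>2 - a + 1) mod l = (b\<^sup>2 - b + 1) mod l"
    then have "l dvd (a\<^sup>2 - a + 1) - (b\<^sup>2 - b + 1)" by (simp only: mod_eq_dvd_iff)
    also have "(a\<^sup>2 - a + 1) - (b\<^sup>2 - b + 1) = (a - b) * (a + b - 1)"
      by (simp add: power2_eq_square algebra_simps)
    finally have "l dvd a - b \<or> l dvd a + b - 1" by (simp only: dvd)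
    then show "a = b"
    proof
      assume "l dvd a - b"
      then have "a - b = 0" by (rule small) (use ab l in auto)
      then show ?thesis by simp
    next
      assume "l dvd a + b - 1"
      \<comment> \<open>\<open>a + b - 1\<close> runs from 1 to \<open>l\<close>, so the only
        multiple of \<open>l\<close> is \<open>l\<close> itself, reached at
        \<open>a = b = m + 1\<close>.\<close>
      then have "l dvd a + b - 1 - l" by simp
      then have "a + b - 1 - l = 0" by (rule small) (use ab l in auto)
      then show ?thesis using ab l by auto
    qed
  qed
  then have "card U = nat (m + 1)" by (simp add: U_def card_image)
  moreover have "inj_on (\<lambda>v. (- v\<^sup>2) mod l) {0..m}"
  proof (rule inj_onI)
    fix a b assume ab: "a \<in> {0..m}" "b \<in> {0..m}" and "(- a\<^sup>2) mod l = (- b\<^sup>2) mod l"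
    then have "l dvd (- a\<^sup>2) - (- b\<^sup>2)" by (simp only: mod_eq_dvd_iff)
    also have "(- a\<^sup>2) - (- b\<^sup>2) = (b - a) * (a + b)"
      by (simp add: power2_eq_square algebra_simps)
    finally have "l dvd b - a \<or> l dvd a + b" by (simp only: dvd)
    then show "a = b"
    proof
      assume "l dvd b - a"
      then have "b - a = 0" by (rule small) (use ab l in auto)
      then show ?thesis by simp
    next
      assume "l dvd a + b"
      then have "a + b = 0" by (rule small) (use ab l in auto)
      then show ?thesis using ab by auto
    qed
  qed
  then have "card V = nat (m + 1)" by (simp add: V_def card_image)
  moreover have "U \<union> V \<subseteq> {0..<l}" using assms by (auto simp: U_def V_def)
  then have "card (U \<union> V) \<le> card {0..<l}" by (intro card_mono) simp_all
  then have "card (U \<union> V) \<le> nat l" by simp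
  moreover have "finite U" "finite V" by (simp_all add: U_def V_def)
  ultimately have "U \<inter> V \<noteq> {}"
    using card_Un_disjoint[of U V] l assms by auto
  then obtain u v where "(u\<^sup>2 - u + 1) mod l = (- v\<^sup>2) mod l" by (auto simp: U_def V_def)
  then have "l dvd (u\<^sup>2 - u + 1) - (- v\<^sup>2)" by (simp only: mod_eq_dvd_iff)
  then have "split_prime l u v" using assms by (simp add: split_prime_def)
  then show ?thesis by (rule that)
qed

lemma ternary_hecke:
  fixes l :: nat
  assumes "prime l" "3 < l"
  shows "int (ternary (l\<^sup>2 * n)) = (int l + 1 - Legendre (- 3 * int n) (int l)) * int (ternary n)
    - int l * (if l\<^sup>2 dvd n then int (ternary (n div l\<^sup>2)) else 0)"
proof -
  have "prime (int l)" "3 < int l" using assms by simp_all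
  then obtain u v where "split_prime (int l) u v" by (rule split_prime_exists)
  then interpret split_prime "int l" u v .
  have "coprime (l\<^sup>2) 3"
    using assms primes_coprime[of l 3] by simp
  then have dvd: "(int l)\<^sup>2 dvd 3 * int n \<longleftrightarrow> l\<^sup>2 dvd n"
    by (metis coprime_dvd_mult_right_iff int_dvd_int_iff of_nat_mult of_nat_numeral of_nat_power)
  have quotient: "3 * int n div (int l)\<^sup>2 = 3 * int (n div l\<^sup>2)" if "l\<^sup>2 dvd n"
    using that by (auto elim!: dvdE)
  have scale: "3 * int (l\<^sup>2 * n) = (int l)\<^sup>2 * (3 * int n)" by simp
  show ?thesis
    unfolding ternary_eq_card_pure scale card_pure_hecke dvd using quotient by simp
qed

section \<open>The Legendre symbol of -3\<close>

lemma Legendre_values: "Legendre a p \<in> {-1, 0, 1}"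
  by (simp add: Legendre_def)

lemma Legendre_eqI:
  assumes "2 < p" "[Legendre a q = b] (mod p)" "b \<in> {-1, 0, 1}"
  shows "Legendre a q = b"
proof -
  have dvd: "p dvd Legendre a q - b" using assms(2) by (simp add: cong_iff_dvd_diff)
  have less: "\<bar>Legendre a q - b\<bar> < p" using assms(1,3) Legendre_values[of a q] by auto
  show ?thesis
  proof (rule ccontr)
    assume "Legendre a q \<noteq> b"
    then have "\<bar>p\<bar> \<le> \<bar>Legendre a q - b\<bar>" using dvd by (intro dvd_imp_le_int) simp_all
    then show False using less by linarith
  qed
qed

lemma Legendre_mult:
  fixes p :: nat
  assumes "prime p" "2 < p"
  shows "Legendre (a * b) p = Legendre a p * Legendre b p"
proof (rule Legendre_eqI)
  have "[Legendre (a * b) p = (a * b) ^ ((p - 1) div 2)] (mod p)"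
    using assms by (rule euler_criterion)
  also have "(a * b) ^ ((p - 1) div 2) = a ^ ((p - 1) div 2) * b ^ ((p - 1) div 2)"
    by (rule power_mult_distrib)
  also have "[a ^ ((p - 1) div 2) * b ^ ((p - 1) div 2) = Legendre a p * Legendre b p] (mod p)"
    using euler_criterion[OF assms] by (intro cong_mult) (simp_all add: cong_sym)
  finally show "[Legendre (a * b) p = Legendre a p * Legendre b p] (mod p)" .
  show "Legendre a p * Legendre b p \<in> {-1, 0, 1}"
    using Legendre_values[of a p] Legendre_values[of b p] by auto
qed (use assms in simp)

text \<open>The symbol of -1 at \<open>p\<close> equals the sign in the reciprocity law for
  \<open>p\<close> and 3, and the two cancel. So the symbol of -3 at \<open>p\<close> is that of
  \<open>p\<close> at 3, where Euler's criterion has exponent 1.\<close>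

lemma Legendre_minus_3:
  fixes p :: nat
  assumes "prime p" "3 < p"
  shows "[Legendre (- 3) p = int p] (mod 3)"
proof -
  have p2: "2 < p" using assms by simp
  have "Legendre (- 1) p = (- 1) ^ ((p - 1) div 2)"
    using euler_criterion[OF assms(1) p2, of "- 1"] p2
    by (intro Legendre_eqI[of p]) (auto simp: minus_one_power_iff)
  moreover have "Legendre p 3 * Legendre 3 p = (- 1) ^ ((p - 1) div 2)"
    using Quadratic_Reciprocity[of p 3] assms by simp
  ultimately have "Legendre (- 3) p = Legendre p 3 * (Legendre 3 p * Legendre 3 p)"
    using Legendre_mult[OF assms(1) p2, of "- 1" 3] by (simp add: mult.assoc)
  moreover have "Legendre 3 p \<noteq> 0"
  proof
    assume "Legendre 3 p = 0"
    then have "int p dvd 3" by (auto simp: Legendre_def cong_0_iff split: if_splits)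
    then show False using assms(2) by (auto dest: zdvd_imp_le)
  qed
  then have "Legendre 3 p * Legendre 3 p = 1" using Legendre_values[of 3 p] by auto
  ultimately have "Legendre (- 3) p = Legendre p 3" by simp
  moreover have "[Legendre p 3 = int p ^ ((3 - 1) div 2)] (mod int 3)"
    using euler_criterion[of 3 "int p"] by simp
  ultimately show ?thesis by simp
qed

section \<open>From the ternary form back to partitions\<close>

lemma num_overpartitions_cong_ternary:
  "[int (num_overpartitions (3 * n)) = (-1) ^ n * int (ternary n)] (mod 3)"
proof -
  have "[(-1) ^ n * ((-1) ^ n * int (num_overpartitions (3 * n))) = (-1) ^ n * int (ternary n)] (mod 3)"
    by (intro cong_mult cong_refl overpartitions_cong_ternary)
  then show ?thesis by (simp flip: mult.assoc power_add mult_2)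
qed

lemma num_overpartitions_cong_r5:
  "[int (num_overpartitions (3 * n)) = (-1) ^ n * int (r5 n)] (mod 3)"
proof -
  have "[(-1) ^ n * int (ternary n) = (-1) ^ n * int (r5 n)] (mod 3)"
    by (intro cong_mult cong_refl cong_sym[OF r5_cong_ternary])
  with num_overpartitions_cong_ternary show ?thesis by (rule cong_trans)
qed

lemma pod_cong_r5: "[int (pod (3 * n + 2)) = (-1) ^ n * int (r5 (8 * n + 5))] (mod 3)"
proof -
  have "[(-1) ^ n * int (pod (3 * n + 2)) = int (ternary (8 * n + 5))] (mod 3)"
    using pod_cong_ternary_tri[of n] by (simp add: ternary_8n_5)
  then have "[(-1) ^ n * int (pod (3 * n + 2)) = int (r5 (8 * n + 5))] (mod 3)"
    using cong_sym[OF r5_cong_ternary] by (rule cong_trans)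
  then have "[(-1) ^ n * ((-1) ^ n * int (pod (3 * n + 2))) = (-1) ^ n * int (r5 (8 * n + 5))] (mod 3)"
    by (intro cong_mult cong_refl)
  then show ?thesis by (simp flip: mult.assoc power_add mult_2)
qed

text \<open>The argument is \<open>3 * (8 * n + 5)\<close>, and the oddness of
  \<open>8 * n + 5\<close> is the origin of the extra sign.\<close>

lemma pod_cong_num_overpartitions:
  "[(-1) ^ (n + 1) * int (pod (3 * n + 2)) = int (num_overpartitions (24 * n + 15))] (mod 3)"
proof -
  have "[(-1) ^ (n + 1) * int (pod (3 * n + 2)) =
      (-1) ^ (n + 1) * ((-1) ^ n * int (r5 (8 * n + 5)))] (mod 3)"
    by (intro cong_mult cong_refl pod_cong_r5)
  also have "(-1) ^ (n + 1) * ((-1) ^ n * int (r5 (8 * n + 5))) = (-1) ^ (8 * n + 5) * int (r5 (8 * n + 5))"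
    by (simp flip: mult.assoc power_add mult_2 add: minus_one_power_iff)
  also have "[\<dots> = int (num_overpartitions (3 * (8 * n + 5)))] (mod 3)"
    by (rule cong_sym[OF num_overpartitions_cong_r5])
  finally show ?thesis by (simp add: algebra_simps)
qed

lemma num_overpartitions_hecke:
  fixes l n :: nat
  assumes "prime l" "odd l"
  shows "[int (num_overpartitions (3 * l\<^sup>2 * n)) =
         (int l - int l * Legendre (int n) (int l) + 1) * int (num_overpartitions (3 * n))
         - int l * (if l\<^sup>2 dvd 3 * n then int (num_overpartitions (3 * n div l\<^sup>2)) else 0)] (mod 3)"
proof -
  have sign: "(-1 :: int) ^ (l\<^sup>2 * m) = (-1) ^ m" for m
    using assms(2) by (simp add: minus_one_power_iff)
  have lhs: "[int (num_overpartitions (3 * l\<^sup>2 * n)) = (-1) ^ n * int (ternary (l\<^sup>2 * n))] (mod 3)"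
    using num_overpartitions_cong_ternary[of "l\<^sup>2 * n"] by (simp add: sign mult.assoc)
  have "3 \<le> l" using prime_ge_2_nat[OF assms(1)] assms(2) by (cases "l = 2") auto
  then consider "l = 3" | "3 < l" by linarith
  then show ?thesis
  proof cases
    case 1
    have nine: "ternary (l\<^sup>2 * n) = ternary n" by (simp add: 1 ternary_9)
    have "[int (num_overpartitions (3 * l\<^sup>2 * n)) = int (num_overpartitions (3 * n))] (mod 3)"
      by (rule cong_trans[OF lhs[unfolded nine] cong_sym[OF num_overpartitions_cong_ternary]])
    \<comment> \<open>For \<open>l = 3\<close> both terms with the factor \<open>l\<close> vanish
      modulo 3, and what remains is the descent from \<open>9 * n\<close> to
      \<open>n\<close>.\<close>
    also have "[int (num_overpartitions (3 * n)) =
         (int l - int l * Legendre (int n) (int l) + 1) * int (num_overpartitions (3 * n))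
         - int l * (if l\<^sup>2 dvd 3 * n then int (num_overpartitions (3 * n div l\<^sup>2)) else 0)] (mod 3)"
      unfolding cong_iff_dvd_diff 1 by (simp add: algebra_simps)
    finally show ?thesis .
  next
    case 2
    \<comment> \<open>One sign serves all three terms: \<open>l^2\<close> is odd, so
      \<open>n\<close>, \<open>l^2 * n\<close> and, where it is an integer, \<open>n / l^2\<close>
      have the same parity.\<close>
    define \<epsilon> where "\<epsilon> = (-1 :: int) ^ n"
    define c where "c = (if l\<^sup>2 dvd n then int (ternary (n div l\<^sup>2)) else 0)"
    have "coprime (l\<^sup>2) 3" using assms(1) 2 primes_coprime[of l 3] by simp
    then have dvd: "l\<^sup>2 dvd 3 * n \<longleftrightarrow> l\<^sup>2 dvd n" by (simp add: coprime_dvd_mult_right_iff)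
    have last: "[(if l\<^sup>2 dvd 3 * n then int (num_overpartitions (3 * n div l\<^sup>2)) else 0) = \<epsilon> * c] (mod 3)"
    proof (cases "l\<^sup>2 dvd n")
      case True
      then obtain m where m: "n = l\<^sup>2 * m" ..
      have "l\<^sup>2 > 0" using 2 by simp
      then show ?thesis
        using num_overpartitions_cong_ternary[of m]
        by (simp add: m \<epsilon>_def c_def sign mult.left_commute[of 3])
    qed (simp add: dvd c_def)
    have "Legendre (- 3 * int n) l = Legendre (- 3) l * Legendre (int n) l"
      using 2 by (intro Legendre_mult assms) simp
    then have leg: "[Legendre (- 3 * int n) l = int l * Legendre (int n) l] (mod 3)"
      using cong_mult[OF Legendre_minus_3[OF assms(1) 2] cong_refl] by metis
    have "(-1) ^ n * int (ternary (l\<^sup>2 * n)) =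
        (int l + 1 - Legendre (- 3 * int n) l) * (\<epsilon> * int (ternary n)) - int l * (\<epsilon> * c)"
      unfolding ternary_hecke[OF assms(1) 2] c_def[symmetric] \<epsilon>_def[symmetric] by (simp only: algebra_simps)
    with lhs have "[int (num_overpartitions (3 * l\<^sup>2 * n)) =
        (int l + 1 - Legendre (- 3 * int n) l) * (\<epsilon> * int (ternary n)) - int l * (\<epsilon> * c)] (mod 3)" by simp
    also have "[(int l + 1 - Legendre (- 3 * int n) l) * (\<epsilon> * int (ternary n)) - int l * (\<epsilon> * c) =
        (int l + 1 - int l * Legendre (int n) l) * int (num_overpartitions (3 * n))
         - int l * (if l\<^sup>2 dvd 3 * n then int (num_overpartitions (3 * n div l\<^sup>2)) else 0)] (mod 3)"
      unfolding \<epsilon>_def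
      by (intro cong_diff cong_mult cong_refl leg cong_sym[OF num_overpartitions_cong_ternary]
          cong_sym[OF last[unfolded \<epsilon>_def]])
    finally show ?thesis by (simp only: algebra_simps)
  qed
qed

theorem theorem1p4:
  "(\<forall>n::nat. [int (num_overpartitions (3 * n)) = (- 1) ^ n * int (r5 n)] (mod 3)) \<and>
   (\<forall>n::nat. [int (pod (3 * n + 2)) = (- 1) ^ n * int (r5 (8 * n + 5))] (mod 3)) \<and>
   (\<forall>(l::nat) (n::nat). prime l \<and> odd l \<longrightarrow>
      [int (num_overpartitions (3 * l\<^sup>2 * n)) =
         (int l - int l * Legendre (int n) (int l) + 1) * int (num_overpartitions (3 * n))
         - int l * (if l\<^sup>2 dvd 3 * n then int (num_overpartitions (3 * n div l\<^sup>2)) else 0)] (mod 3)) \<and>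
   (\<forall>n::nat. [(- 1) ^ (n + 1) * int (pod (3 * n + 2)) = int (num_overpartitions (24 * n + 15))] (mod 3))"
  using num_overpartitions_cong_r5 pod_cong_r5 num_overpartitions_hecke pod_cong_num_overpartitions
  by blast

end
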